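(* Let $k\in\{1,\dots,d\}$, let $\mathcal{E}\subset\mathbb{R}^d$ be a non-degenerate ellipsoid, and let $X_0,\dots,X_k$ be independent random vectors uniformly distributed in $\mathcal{E}$. Let $\xi$ be a uniformly distributed random $k$-dimensional linear subspace of $\mathbb{R}^d$, and let $P_\xi$ be the orthogonal projection to $\xi$. Then for any real number $p>-1$, $$\mathbb{E}\,|\operatorname{conv}(X_0,\dots,X_k)|^p=\frac{1}{(k!)^p}\,\frac{\kappa_{d+p}^{k+1}}{\kappa_d^{k+1}}\,\frac{\kappa_{k(d+p)+d}}{\kappa_{(k+1)(d+p)}}\,\frac{b_{d,k}}{b_{d+p,k}}\,\frac{\mathbb{E}\,|P_\xi\mathcal{E}|^p}{\kappa_k^p}.$$
   Context: $|\cdot|$ denotes $k$-dimensional volume. For real $q>0$, $\kappa_q:=\pi^{q/2}/\Gamma(q/2+1)$ and $\omega_q:=q\kappa_q$. For real $q>k-1$, $b_{q,k}:=\dfrac{\omega_{q-k+1}\,\omega_{q-k+2}\cdots\omega_q}{\omega_1\cdots\omega_k}$ (both numerator and denominator have $k$ factors). "Uniformly distributed" for a random $k$-dimensional linear subspace means distributed according to the unique rotation invariant probability measure on the Grassmannian $G_{d,k}$ of $k$-dimensional linear subspaces of $\mathbb{R}^d$. *)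

theory Defs
  imports "HOL-Probability.Probability"
begin

text \<open>
  The constant \<open>\<kappa>\<^sub>q = \<pi>\<^bsup>q/2\<^esup> / \<Gamma>(q/2 + 1)\<close> for real \<open>q\<close> is the library's \<^const>\<open>unit_ball_vol\<close>.
\<close>

definition unit_sphere_area :: "real \<Rightarrow> real"  (* omega_q *)
  where "unit_sphere_area q = q * unit_ball_vol q"

definition flag_coeff :: "real \<Rightarrow> nat \<Rightarrow> real"  (* b_{q,k}, meant for q > k - 1 *)
  where "flag_coeff q k =
    (\<Prod>i=1..k. unit_sphere_area (q - real k + real i)) / (\<Prod>i=1..k. unit_sphere_area (real i))"

definition nondegenerate_ellipsoid :: "(real ^ 'n) set \<Rightarrow> bool"
  where "nondegenerate_ellipsoid E \<longleftrightarrow>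
    (\<exists>(c :: real ^ 'n) (A :: real ^ 'n ^ 'n). invertible A \<and> E = (\<lambda>x. c + A *v x) ` cball 0 1)"


subsection \<open>Volume in a flat of dimension \<open>k\<close>\<close>

definition orthonormal_family :: "nat \<Rightarrow> (nat \<Rightarrow> 'a::euclidean_space) \<Rightarrow> bool"
  where "orthonormal_family k b \<longleftrightarrow> (\<forall>i<k. \<forall>j<k. b i \<bullet> b j = (if i = j then 1 else 0))"

definition flat_chart :: "nat \<Rightarrow> 'a \<Rightarrow> (nat \<Rightarrow> 'a) \<Rightarrow> (nat \<Rightarrow> real) \<Rightarrow> 'a::euclidean_space"
  where "flat_chart k a b c = a + (\<Sum>i<k. c i *\<^sub>R b i)"

text \<open>
  The \<open>k\<close>-dimensional volume of a Borel set \<open>S\<close> lying in some affine subspace of dimension \<open>k\<close>: choose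
  Cartesian coordinates on such a subspace and take the \<open>k\<close>-dimensional Lebesgue measure of \<open>S\<close> in
  these coordinates. The value does not depend on the choice, since any two systems of Cartesian
  coordinates on the same subspace differ by an isometry, and since it is 0 whenever \<open>S\<close> is contained
  in two different subspaces of dimension \<open>k\<close>. For sets not contained in any such subspace the value
  is meaningless.
\<close>

definition flat_volume :: "nat \<Rightarrow> 'a::euclidean_space set \<Rightarrow> real"
  where "flat_volume k S =
    (let (a, b) = (SOME (a, b). orthonormal_family k b \<and> S \<subseteq> range (flat_chart k a b))
     in measure (\<Pi>\<^sub>M i\<in>{..<k}. lborel)
          {c \<in> space (\<Pi>\<^sub>M i\<in>{..<k}. (lborel :: real measure)). flat_chart k a b c \<in> S})"


subsection \<open>Random linear subspaces\<close>

definition orth_proj :: "'a::euclidean_space set \<Rightarrow> 'a \<Rightarrow> 'a"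
  where "orth_proj L x = (THE y. y \<in> L \<and> (\<forall>z\<in>L. orthogonal (x - y) z))"

text \<open>
  The Grassmannian \<open>G\<^bsub>d,k\<^esub>\<close> as a measurable space. Its usual topology is the one making the embedding
  of a subspace as its orthogonal projection matrix a homeomorphism onto the image; the
  \<open>\<sigma>\<close>-algebra below is the Borel \<open>\<sigma>\<close>-algebra of this topology. Only the space and the
  \<open>\<sigma>\<close>-algebra of this \<^typ>\<open>'a measure\<close> are used.
\<close>

definition grassmannian :: "nat \<Rightarrow> (real ^ 'n) set measure"
  where "grassmannian k =
    vimage_algebra {L. subspace L \<and> dim L = k} (\<lambda>L. matrix (orth_proj L)) borel"

text \<open>
  For \<open>k \<le> d\<close> exactly one measure satisfies this: the rotation group acts transitively on the
  Grassmannian.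
\<close>

definition rotation_invariant_prob :: "nat \<Rightarrow> (real ^ 'n) set measure \<Rightarrow> bool"
  where "rotation_invariant_prob k \<nu> \<longleftrightarrow>
    prob_space \<nu> \<and> sets \<nu> = sets (grassmannian k) \<and>
    (\<forall>Q :: real ^ 'n ^ 'n. rotation_matrix Q \<longrightarrow>
       distr \<nu> (grassmannian k) (\<lambda>L. (\<lambda>x. Q *v x) ` L) = \<nu>)"

definition uniform_random_subspace :: "'w measure \<Rightarrow> nat \<Rightarrow> ('w \<Rightarrow> (real ^ 'n) set) \<Rightarrow> bool"
  where "uniform_random_subspace M k \<xi> \<longleftrightarrow>
    \<xi> \<in> M \<rightarrow>\<^sub>M grassmannian k \<and> rotation_invariant_prob k (distr M (grassmannian k) \<xi>)"

end

theory Submission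
  imports Defs
begin

text \<open>
  Write \<open>vol\<close> for the volume of the parallelotope spanned by \<open>k\<close> vectors, \<open>X\<^sub>0, \<dots>, X\<^sub>k\<close> as \<open>A Y\<^sub>0 + c, \<dots>, A Y\<^sub>k + c\<close>
  with \<open>Y\<^sub>i\<close> in the unit ball, and \<open>C\<^sub>A = \<integral> vol (A w\<^sub>1, \<dots>, A w\<^sub>k)\<^sup>p exp (- \<Sum> |w\<^sub>i|\<^sup>2)\<close>. Both sides of the claim are
  explicit multiples of \<open>C\<^sub>A\<close>.

  On the left, completing squares one variable at a time is a triangular substitution, under which \<open>vol\<^sup>p\<close>
  is homogeneous, so that \<open>\<integral> vol (A (y\<^sub>i - y\<^sub>k))\<^sup>p exp (- \<Sum> s\<^sub>i |y\<^sub>i|\<^sup>2)\<close> equals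
  \<open>\<pi>\<^bsup>d/2\<^esup> C\<^sub>A (\<Prod> s\<^sub>i)\<^bsup>-(d+p)/2\<^esup> (\<Sum> s\<^sub>i)\<^bsup>p/2\<^esup>\<close>. Up to the power of \<open>\<Sum> s\<^sub>i\<close> this is the Laplace
  transform of independent Gamma variables; adding to all \<open>|y\<^sub>i|\<^sup>2\<close>, respectively to all Gamma variables, one
  common Gamma variable absorbs that power. Uniqueness of the Laplace transform then identifies the measures
  of the cube \<open>[0,1]\<^bsup>k+1\<^esup>\<close> under both laws, and these are Beta integrals times the moment over the ball and
  times \<open>C\<^sub>A\<close>.

  On the right, integrate \<open>vol (P\<^sub>L A w\<^sub>1, \<dots>, P\<^sub>L A w\<^sub>k)\<^sup>p exp (- \<Sum> |w\<^sub>i|\<^sup>2)\<close> over \<open>L\<close> and \<open>w\<close>. Integrating over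
  \<open>w\<close> first gives a constant times the \<open>p\<close>-th moment of the volume of the projected ellipsoid; integrating over
  \<open>L\<close> first gives a constant times \<open>C\<^sub>A\<close>, by rotation invariance. The ratio of the constants is found by
  taking \<open>A\<close> to be the identity.
\<close>

text \<open>The sign of \<open>p\<close> shapes the proof. For p > 0 the factor
  \<open>(\<Sum> s\<^sub>i) powr (p / 2)\<close> grows with the parameters, so it is not itself the
  Laplace transform of a measure; a common Gamma variable of shape b multiplies the transform by a
  multiple of \<open>(\<Sum> s\<^sub>i) powr (- b)\<close>, and b > p / 2 makes the exponent
  negative. The auxiliary b cancels between the two Beta integrals. For p < 0 the volume to the
  power p is singular. Gaussian weights keep this under control: one vector at a time is integrated
  out, and its height over the others is the norm of an orthogonal projection of a Gaussian vector,
  onto a space that loses one dimension with each vector. The last of these spaces still has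
  dimension at least 1, which is where p > -1 enters. Volume is defined through heights rather than
  Gram determinants, since both the successive integration and the triangular substitution act on
  one height at a time; heights also serve as Jacobians. Integrals are taken in
  \<open>ennreal\<close>, and as \<open>0 powr p = 0\<close>, degenerate positions contribute 0 for
  negative p too.\<close>

section \<open>Gram-Schmidt residuals and the volume of parallelotopes\<close>

text \<open>If \<open>gs v j = 0\<close>, then the coefficient of \<open>gs v j\<close> is \<open>0 / 0 = 0\<close>.\<close>

fun gs :: "(nat \<Rightarrow> 'a::euclidean_space) \<Rightarrow> nat \<Rightarrow> 'a"
  where "gs v i = v i - (\<Sum>j<i. ((v i \<bullet> gs v j) / (gs v j \<bullet> gs v j)) *\<^sub>R gs v j)"

declare gs.simps [simp del]

definition gs_unit :: "(nat \<Rightarrow> 'a::euclidean_space) \<Rightarrow> nat \<Rightarrow> 'a"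
  where "gs_unit v i = gs v i /\<^sub>R norm (gs v i)"

text \<open>This is the square root of the Gram determinant, written as a product of heights so that
  the last vector can be split off (\<open>pvol_Suc\<close>) and integrated with the others held
  fixed.\<close>

definition pvol :: "nat \<Rightarrow> (nat \<Rightarrow> 'a::euclidean_space) \<Rightarrow> real"
  where "pvol k v = (\<Prod>i<k. norm (gs v i))"

lemma inner_span_eq_0:
  assumes "\<And>y. y \<in> S \<Longrightarrow> x \<bullet> y = 0" "w \<in> span S"
  shows "x \<bullet> w = 0"
  using assms(2,1) by (induction rule: span_induct_alt) (auto simp: inner_add_right)

lemma gs_orthogonal_less: "i < j \<Longrightarrow> gs v j \<bullet> gs v i = 0"
proof (induction j arbitrary: i rule: less_induct)
  case (less j)
  have z: "gs v l \<bullet> gs v i = 0" if "l < j" "l \<noteq> i" for l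
    using less.IH[of l i] less.IH[of i l] less.prems that
    by (cases "l < i") (auto simp: inner_commute)
  \<comment> \<open>Only the term l = i survives. If \<open>gs v i = 0\<close>, that term and
    \<open>v j \<bullet> gs v i\<close> are both 0, so the quotient 0 / 0 does no harm.\<close>
  have "(\<Sum>l<j. ((v j \<bullet> gs v l) / (gs v l \<bullet> gs v l)) *\<^sub>R gs v l) \<bullet> gs v i
      = (\<Sum>l<j. if l = i then v j \<bullet> gs v i else 0)"
    unfolding inner_sum_left using z by (intro sum.cong) auto
  also have "\<dots> = v j \<bullet> gs v i"
    using less.prems by simp
  finally show ?case
    by (subst gs.simps) (simp add: inner_diff_left)
qed

lemma gs_orthogonal: "i \<noteq> j \<Longrightarrow> gs v j \<bullet> gs v i = 0"
  by (metis gs_orthogonal_less inner_commute linorder_neqE_nat)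

lemma diff_gs_in_span_gs: "v i - gs v i \<in> span (gs v ` {..<i})"
  by (subst gs.simps) (auto intro!: span_sum span_scale intro: span_base)

lemma span_gs: "span (gs v ` {..<i}) = span (v ` {..<i})"
proof (induction i)
  case 0
  show ?case by simp
next
  case (Suc i)
  have *: "v i - gs v i \<in> span (v ` {..<i})"
    using diff_gs_in_span_gs[of v i] Suc by simp
  have "span (gs v ` {..<Suc i}) = span (insert (gs v i) (gs v ` {..<i}))"
    by (simp add: lessThan_Suc)
  also have "\<dots> = span (insert (gs v i) (v ` {..<i}))"
    using Suc by (simp add: span_insert)
  also have "\<dots> = span (insert (v i) (v ` {..<i}))"
    using * eq_span_insert_eq by metis
  finally show ?case by (simp add: lessThan_Suc)
qed

lemma diff_gs_in_span: "v i - gs v i \<in> span (v ` {..<i})"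
  using diff_gs_in_span_gs[of v i] span_gs[of v i] by simp

lemma gs_perp:
  assumes "w \<in> span (v ` {..<i})"
  shows "gs v i \<bullet> w = 0"
proof -
  have "w \<in> span (gs v ` {..<i})"
    using assms by (simp add: span_gs)
  moreover have "gs v i \<bullet> y = 0" if "y \<in> gs v ` {..<i}" for y
    using that by (auto simp: gs_orthogonal)
  ultimately show ?thesis
    by (rule inner_span_eq_0[rotated])
qed

text \<open>The difference of two candidates lies in the span of the preceding vectors and is
  orthogonal to it, hence to itself. This characterization, rather than the recursion, yields the
  behaviour of residuals under linear maps and triangular substitutions.\<close>

lemma gs_unique:
  assumes "\<And>w. w \<in> span (v ` {..<i}) \<Longrightarrow> x \<bullet> w = 0" "v i - x \<in> span (v ` {..<i})"
  shows "gs v i = x"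
proof -
  have *: "gs v i - x \<in> span (v ` {..<i})"
    using span_diff[OF assms(2) diff_gs_in_span[of v i]] by simp
  have "(gs v i - x) \<bullet> (gs v i - x) = gs v i \<bullet> (gs v i - x) - x \<bullet> (gs v i - x)"
    by (simp add: inner_diff_left)
  also have "\<dots> = 0"
    using * assms(1) gs_perp by simp
  finally show ?thesis by simp
qed

lemma gs_cong:
  assumes "\<And>j. j \<le> i \<Longrightarrow> v j = w j"
  shows "gs v i = gs w i"
proof -
  have "v ` {..<i} = w ` {..<i}"
    using assms by (intro image_cong) auto
  then show ?thesis
    using assms[of i] gs_perp[of _ w i] diff_gs_in_span[of w i] by (intro gs_unique) auto
qed

lemma pvol_cong: "(\<And>j. j < k \<Longrightarrow> v j = w j) \<Longrightarrow> pvol k v = pvol k w"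
  unfolding pvol_def by (intro prod.cong refl arg_cong[where f = norm] gs_cong) auto

lemma pvol_nonneg: "0 \<le> pvol k v"
  by (simp add: pvol_def prod_nonneg)

lemma pvol_nonzero_iff: "pvol k v \<noteq> 0 \<longleftrightarrow> (\<forall>i<k. gs v i \<noteq> 0)"
  by (auto simp: pvol_def)

lemma pvol_0 [simp]: "pvol 0 v = 1"
  by (simp add: pvol_def)

lemma pvol_Suc: "pvol (Suc k) v = pvol k v * norm (gs v k)"
  by (simp add: pvol_def)

lemma gs_unit_scale: "gs v i = norm (gs v i) *\<^sub>R gs_unit v i"
  by (cases "gs v i = 0") (simp_all add: gs_unit_def)

lemma orthonormal_gs_unit:
  assumes "pvol k v \<noteq> 0"
  shows "orthonormal_family k (gs_unit v)"
  unfolding orthonormal_family_def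
proof (intro allI impI)
  fix i j assume "i < k" "j < k"
  then have "gs v i \<noteq> 0" "gs v j \<noteq> 0"
    using assms by (auto simp: pvol_nonzero_iff)
  then show "gs_unit v i \<bullet> gs_unit v j = (if i = j then 1 else 0)"
    using gs_orthogonal[of j i v]
    by (auto simp: gs_unit_def dot_square_norm power2_eq_square field_simps)
qed

lemma span_gs_unit:
  assumes "pvol k v \<noteq> 0" "i \<le> k"
  shows "span (gs_unit v ` {..<i}) = span (v ` {..<i})"
proof -
  have "gs_unit v j \<in> span (gs v ` {..<i})" if "j < i" for j
    using that unfolding gs_unit_def by (intro span_scale span_base) auto
  moreover have "gs v j \<in> span (gs_unit v ` {..<i})" if "j < i" for j
    using that by (subst gs_unit_scale) (intro span_scale span_base, auto)
  ultimately have "span (gs_unit v ` {..<i}) = span (gs v ` {..<i})"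
    by (intro subset_antisym span_minimal subspace_span) auto
  then show ?thesis by (simp add: span_gs)
qed

section \<open>Orthonormal families, coordinates and spans\<close>

lemma orthonormal_familyD: "orthonormal_family k b \<Longrightarrow> i < k \<Longrightarrow> j < k \<Longrightarrow> b i \<bullet> b j = (if i = j then 1 else 0)"
  by (simp add: orthonormal_family_def)

lemma orthonormal_family_mono: "orthonormal_family k b \<Longrightarrow> j \<le> k \<Longrightarrow> orthonormal_family j b"
  by (simp add: orthonormal_family_def)

lemma orthonormal_family_norm: "orthonormal_family k b \<Longrightarrow> i < k \<Longrightarrow> norm (b i) = 1"
  by (simp add: norm_eq_sqrt_inner orthonormal_family_def)

lemma orthonormal_family_inj: "orthonormal_family k b \<Longrightarrow> inj_on b {..<k}"
  by (rule inj_onI) (metis lessThan_iff orthonormal_familyD zero_neq_one)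

lemma orthonormal_family_pairwise: "orthonormal_family k b \<Longrightarrow> pairwise orthogonal (b ` {..<k})"
  by (auto simp: pairwise_def orthogonal_def orthonormal_family_def)

lemma orthonormal_family_independent:
  assumes "orthonormal_family k b"
  shows "independent (b ` {..<k})"
proof (rule pairwise_orthogonal_independent)
  show "pairwise orthogonal (b ` {..<k})"
    using assms by (rule orthonormal_family_pairwise)
  show "0 \<notin> b ` {..<k}"
    using orthonormal_family_norm[OF assms] by fastforce
qed

lemma orthonormal_family_dim:
  assumes "orthonormal_family k b"
  shows "dim (span (b ` {..<k})) = k"
  using orthonormal_family_independent[OF assms] orthonormal_family_inj[OF assms]
  by (simp add: dim_eq_card_independent card_image)

lemma orthonormal_sum_inner:
  assumes "orthonormal_family k b" "j < k"
  shows "(\<Sum>i<k. c i *\<^sub>R b i) \<bullet> b j = c j"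
proof -
  have "(\<Sum>i<k. c i *\<^sub>R b i) \<bullet> b j = (\<Sum>i<k. if i = j then c j else 0)"
    unfolding inner_sum_left using assms by (intro sum.cong) (auto simp: orthonormal_familyD)
  then show ?thesis using assms(2) by simp
qed

lemma orthonormal_sum_norm:
  assumes "orthonormal_family k b"
  shows "(norm (\<Sum>i<k. c i *\<^sub>R b i))\<^sup>2 = (\<Sum>i<k. (c i)\<^sup>2)"
proof -
  have "(\<Sum>i<k. c i *\<^sub>R b i) \<bullet> (\<Sum>i<k. c i *\<^sub>R b i) = (\<Sum>j<k. c j * ((\<Sum>i<k. c i *\<^sub>R b i) \<bullet> b j))"
    by (simp only: inner_sum_right inner_scaleR_right)
  also have "\<dots> = (\<Sum>j<k. (c j)\<^sup>2)"
    by (intro sum.cong refl) (simp add: orthonormal_sum_inner[OF assms] power2_eq_square)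
  finally show ?thesis by (simp add: dot_square_norm)
qed

lemma orthonormal_expansion:
  assumes "orthonormal_family k b" "x \<in> span (b ` {..<k})"
  shows "(\<Sum>i<k. (x \<bullet> b i) *\<^sub>R b i) = x"
proof -
  let ?y = "x - (\<Sum>i<k. (x \<bullet> b i) *\<^sub>R b i)"
  have y: "?y \<in> span (b ` {..<k})"
    using assms(2) by (intro span_diff span_sum span_scale) (auto intro: span_base)
  have "orthogonal ?y z" if "z \<in> b ` {..<k}" for z
    using that orthonormal_sum_inner[OF assms(1)] by (auto simp: orthogonal_def inner_diff_left)
  then have "orthogonal ?y ?y"
    using y orthogonal_to_span by blast
  then show ?thesis by (simp add: orthogonal_def)
qed

section \<open>Volumes of parallelotopes under linear maps and substitutions\<close>

lemma pvol_nonzero_dim: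
  assumes "pvol k v \<noteq> 0"
  shows "dim (span (v ` {..<k})) = k"
  using orthonormal_family_dim[OF orthonormal_gs_unit[OF assms]] span_gs_unit[OF assms, of k] by simp

lemma pvol_zero_dim:
  assumes "pvol k v = 0"
  shows "dim (span (v ` {..<k})) < k"
proof -
  obtain i where i: "i < k" "gs v i = 0"
    using assms pvol_nonzero_iff by blast
  have "v i \<in> span (v ` {..<i})"
    using diff_gs_in_span[of v i] i by simp
  moreover have "span (v ` {..<i}) \<subseteq> span (v ` ({..<k} - {i}))"
    using i(1) by (intro span_mono) auto
  ultimately have "span (insert (v i) (v ` ({..<k} - {i}))) = span (v ` ({..<k} - {i}))"
    by (intro span_redundant) auto
  moreover have "insert (v i) (v ` ({..<k} - {i})) = v ` {..<k}"
    using i(1) by auto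
  ultimately have "dim (span (v ` {..<k})) = dim (v ` ({..<k} - {i}))"
    by (metis dim_span)
  also have "\<dots> \<le> card (v ` ({..<k} - {i}))"
    by (intro dim_le_card') auto
  also have "\<dots> \<le> card ({..<k} - {i})"
    by (intro card_image_le) auto
  also have "\<dots> < k" using i by auto
  finally show ?thesis .
qed

lemma pvol_nonzero_iff_dim: "pvol k v \<noteq> 0 \<longleftrightarrow> dim (span (v ` {..<k})) = k"
  using pvol_nonzero_dim pvol_zero_dim by (metis less_irrefl)

lemma gs_orthonormal:
  assumes "orthonormal_family k b" "i < k"
  shows "gs b i = b i"
proof (rule gs_unique)
  fix w assume w: "w \<in> span (b ` {..<i})"
  have "b i \<bullet> y = 0" if "y \<in> b ` {..<i}" for y
    using that assms by (auto simp: orthonormal_familyD)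
  then show "b i \<bullet> w = 0"
    using w by (rule inner_span_eq_0)
qed (simp add: span_zero)

lemma span_linear_image_lessThan:
  assumes "linear T"
  shows "span ((\<lambda>i. T (v i)) ` A) = T ` span (v ` A)"
proof -
  have "(\<lambda>i. T (v i)) ` A = T ` (v ` A)" by auto
  then show ?thesis by (simp only: linear_span_image[OF assms])
qed

text \<open>The vector \<open>v i\<close> differs from
  \<open>norm (gs v i) *\<^sub>R gs_unit v i\<close> by a combination of earlier vectors.
  \<open>T\<close> maps that combination into the span of the earlier images, which the images of
  the earlier unit vectors span as well.\<close>

lemma gs_linear_image:
  assumes T: "linear T" and nz: "pvol k v \<noteq> 0" and i: "i < k"
  shows "gs (\<lambda>j. T (v j)) i = norm (gs v i) *\<^sub>R gs (\<lambda>j. T (gs_unit v j)) i"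
proof (rule gs_unique)
  let ?e = "gs_unit v"
  have sp: "span ((\<lambda>j. T (v j)) ` {..<i}) = span ((\<lambda>j. T (?e j)) ` {..<i})"
    using span_gs_unit[OF nz, of i] i by (simp add: span_linear_image_lessThan[OF T])
  show "(norm (gs v i) *\<^sub>R gs (\<lambda>j. T (?e j)) i) \<bullet> w = 0" if "w \<in> span ((\<lambda>j. T (v j)) ` {..<i})" for w
    using that gs_perp unfolding sp by auto
  have "T (v i - gs v i) \<in> span ((\<lambda>j. T (v j)) ` {..<i})"
    using diff_gs_in_span[of v i] by (auto simp: span_linear_image_lessThan[OF T])
  moreover have "norm (gs v i) *\<^sub>R (T (?e i) - gs (\<lambda>j. T (?e j)) i) \<in> span ((\<lambda>j. T (v j)) ` {..<i})"
    unfolding sp using diff_gs_in_span[of "\<lambda>j. T (?e j)" i] by (intro span_scale)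
  moreover have "T (gs v i) = norm (gs v i) *\<^sub>R T (?e i)"
    by (subst gs_unit_scale) (simp add: linear_scale[OF T])
  ultimately have "(T (v i) - T (gs v i)) + (T (gs v i) - norm (gs v i) *\<^sub>R gs (\<lambda>j. T (?e j)) i)
      \<in> span ((\<lambda>j. T (v j)) ` {..<i})"
    by (intro span_add) (auto simp: linear_diff[OF T] scaleR_diff_right)
  then show "T (v i) - norm (gs v i) *\<^sub>R gs (\<lambda>j. T (?e j)) i \<in> span ((\<lambda>j. T (v j)) ` {..<i})"
    by simp
qed

text \<open>The distortion of volume by \<open>T\<close> is separated from the vectors: the second
  factor sees only an orthonormal basis of their span.\<close>

lemma pvol_linear_image:
  assumes "linear T" "pvol k v \<noteq> 0"
  shows "pvol k (\<lambda>j. T (v j)) = pvol k v * pvol k (\<lambda>j. T (gs_unit v j))"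
  unfolding pvol_def by (simp add: gs_linear_image[OF assms] flip: prod.distrib)

lemma pvol_linear_image_zero:
  assumes "linear T" "pvol k v = 0"
  shows "pvol k (\<lambda>j. T (v j)) = 0"
proof -
  have "dim (T ` span (v ` {..<k})) \<le> dim (span (v ` {..<k}))"
    using assms(1) by (rule dim_image_le)
  then have "dim (span ((\<lambda>j. T (v j)) ` {..<k})) < k"
    using pvol_zero_dim[OF assms(2)] by (simp only: span_linear_image_lessThan[OF assms(1)])
  then show ?thesis
    using pvol_nonzero_iff_dim by (metis less_irrefl)
qed

lemma span_update_scale:
  fixes v :: "nat \<Rightarrow> 'a::euclidean_space"
  assumes "\<beta> \<noteq> 0" "z \<in> span (v ` {..<i})"
  shows "span ((v(i := \<beta> *\<^sub>R v i + z)) ` {..<j}) = span (v ` {..<j})"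
proof (cases "i < j")
  case True
  let ?w = "v(i := \<beta> *\<^sub>R v i + z)"
  have z: "z \<in> span (v ` {..<j})" "z \<in> span (?w ` {..<j})"
  proof -
    have "v ` {..<i} \<subseteq> v ` {..<j}"
      using True by (intro image_mono) auto
    moreover have "v ` {..<i} = ?w ` {..<i}"
      by (rule image_cong) simp_all
    moreover have "?w ` {..<i} \<subseteq> ?w ` {..<j}"
      using True by (intro image_mono) auto
    ultimately have "v ` {..<i} \<subseteq> v ` {..<j}" "v ` {..<i} \<subseteq> ?w ` {..<j}"
      by (simp_all only:)
    then show "z \<in> span (v ` {..<j})" "z \<in> span (?w ` {..<j})"
      using subsetD[OF span_mono assms(2)] by (simp_all del: fun_upd_apply)
  qed
  have 1: "?w l \<in> span (v ` {..<j})" if "l < j" for l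
  proof -
    have "v l \<in> span (v ` {..<j})"
      using that by (intro span_base imageI) simp
    then show ?thesis
      using z(1) by (cases "l = i") (simp_all add: span_add span_scale)
  qed
  have "?w i \<in> span (?w ` {..<j})"
    using True by (intro span_base imageI) simp
  then have "(1 / \<beta>) *\<^sub>R (?w i - z) \<in> span (?w ` {..<j})"
    using z(2) by (intro span_scale span_diff)
  then have vi: "v i \<in> span (?w ` {..<j})"
    using assms(1) by simp
  have 2: "v l \<in> span (?w ` {..<j})" if "l < j" for l
  proof (cases "l = i")
    case False
    have "?w l \<in> span (?w ` {..<j})"
      using that by (intro span_base imageI) simp
    then show ?thesis using False by simp
  qed (use vi in simp)
  show ?thesis
    using 1 2 by (intro subset_antisym span_minimal subspace_span image_subsetI) (simp_all only: lessThan_iff)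
next
  case False
  then have "(v(i := \<beta> *\<^sub>R v i + z)) ` {..<j} = v ` {..<j}"
    by (intro image_cong) auto
  then show ?thesis by simp
qed

text \<open>Changing one vector by a nonzero factor and by preceding vectors leaves the span of
  every initial segment intact, so the other residuals keep their characterization.\<close>

lemma gs_update_scale:
  assumes "\<beta> \<noteq> 0" "z \<in> span (v ` {..<i})"
  shows "gs (v(i := \<beta> *\<^sub>R v i + z)) j = (if j = i then \<beta> *\<^sub>R gs v j else gs v j)"
proof (rule gs_unique; unfold span_update_scale[OF assms])
  show "(if j = i then \<beta> *\<^sub>R gs v j else gs v j) \<bullet> w = 0" if "w \<in> span (v ` {..<j})" for w
    using gs_perp[OF that] by auto
  have "\<beta> *\<^sub>R (v i - gs v i) + z \<in> span (v ` {..<i})"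
    using diff_gs_in_span[of v i] assms(2) by (intro span_add span_scale)
  then show "(v(i := \<beta> *\<^sub>R v i + z)) j - (if j = i then \<beta> *\<^sub>R gs v j else gs v j) \<in> span (v ` {..<j})"
    using diff_gs_in_span[of v j] by (cases "j = i") (simp_all add: scaleR_diff_right add_diff_eq diff_add_eq)
qed

text \<open>This homogeneity in a single vector is what makes completing the square compatible with
  powers of the volume.\<close>

lemma pvol_update_scale:
  assumes "\<beta> \<noteq> 0" "z \<in> span (v ` {..<i})" "i < k"
  shows "pvol k (v(i := \<beta> *\<^sub>R v i + z)) = \<bar>\<beta>\<bar> * pvol k v"
proof -
  have "pvol k (v(i := \<beta> *\<^sub>R v i + z)) = (\<Prod>j<k. (if j = i then \<bar>\<beta>\<bar> else 1) * norm (gs v j))"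
    unfolding pvol_def gs_update_scale[OF assms(1,2)] by (intro prod.cong) auto
  then show ?thesis
    using assms(3) by (simp add: prod.distrib pvol_def)
qed

lemma pvol_scaleR:
  assumes "c \<noteq> 0"
  shows "pvol k (\<lambda>i. c *\<^sub>R v i) = \<bar>c\<bar> ^ k * pvol k v"
proof -
  have "gs (\<lambda>i. c *\<^sub>R v i) i = c *\<^sub>R gs v i" for i
  proof (rule gs_unique)
    have sp: "span ((\<lambda>i. c *\<^sub>R v i) ` {..<i}) = (\<lambda>x. c *\<^sub>R x) ` span (v ` {..<i})"
      by (rule span_linear_image_lessThan) (simp add: linear_scale_self)
    show "(c *\<^sub>R gs v i) \<bullet> w = 0" if "w \<in> span ((\<lambda>i. c *\<^sub>R v i) ` {..<i})" for w
      using that unfolding sp by (auto simp: gs_perp)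
    show "c *\<^sub>R v i - c *\<^sub>R gs v i \<in> span ((\<lambda>i. c *\<^sub>R v i) ` {..<i})"
      unfolding sp using diff_gs_in_span[of v i] by (auto simp flip: scaleR_diff_right)
  qed
  then show ?thesis by (simp add: pvol_def prod.distrib)
qed

lemma norm_gs_le: "norm (gs v i) \<le> norm (v i)"
proof -
  have "orthogonal (gs v i) (v i - gs v i)"
    using gs_perp[OF diff_gs_in_span] by (simp add: orthogonal_def)
  from norm_add_Pythagorean[OF this] have "(norm (v i))\<^sup>2 \<ge> (norm (gs v i))\<^sup>2"
    by simp
  then show ?thesis by (rule power2_le_imp_le) simp
qed

lemma pvol_isometry:
  assumes T: "linear T" "\<And>x y. T x \<bullet> T y = x \<bullet> y"
  shows "pvol k (\<lambda>i. T (v i)) = pvol k v"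
proof -
  have "gs (\<lambda>i. T (v i)) i = T (gs v i)" for i
  proof (rule gs_unique; unfold span_linear_image_lessThan[OF T(1)])
    show "T (gs v i) \<bullet> w = 0" if "w \<in> T ` span (v ` {..<i})" for w
      using that gs_perp T(2) by auto
    show "T (v i) - T (gs v i) \<in> T ` span (v ` {..<i})"
      using diff_gs_in_span[of v i] by (auto simp flip: linear_diff[OF T(1)])
  qed
  then show ?thesis by (simp add: pvol_def norm_eq_sqrt_inner T(2))
qed

section \<open>Orthonormal bases and orthogonal projections\<close>

lemma orthonormal_family_extend:
  fixes b :: "nat \<Rightarrow> 'a::euclidean_space"
  assumes "orthonormal_family j b" "j \<le> DIM('a)"
  obtains e where "orthonormal_family DIM('a) e" "\<forall>i<j. e i = b i"
proof -
  have "\<exists>e. orthonormal_family (j + n) e \<and> (\<forall>i<j. e i = b i)" if "j + n \<le> DIM('a)" for n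
    using that
  proof (induction n)
    case 0
    then show ?case using assms by auto
  next
    case (Suc n)
    then obtain e where e: "orthonormal_family (j + n) e" "\<forall>i<j. e i = b i"
      by auto
    have "dim (span (e ` {..<j + n})) < DIM('a)"
      using orthonormal_family_dim[OF e(1)] Suc.prems by simp
    then obtain x where x: "x \<noteq> 0" "\<And>y. y \<in> span (e ` {..<j + n}) \<Longrightarrow> orthogonal x y"
      using orthogonal_to_subspace_exists[of "e ` {..<j + n}"] by auto
    have xe: "x \<bullet> e i = 0" "e i \<bullet> x = 0" if "i < j + n" for i
      using x(2)[of "e i"] that by (auto simp: orthogonal_def inner_commute span_base)
    let ?e = "e(j + n := x /\<^sub>R norm x)"
    have "orthonormal_family (j + Suc n) ?e"
      using e(1) xe x(1)
      by (auto simp: orthonormal_family_def less_Suc_eq dot_square_norm power2_eq_square field_simps)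
    moreover have "\<forall>i<j. ?e i = b i" using e(2) by simp
    ultimately show ?case by blast
  qed
  from this[of "DIM('a) - j"] assms(2) show ?thesis
    using that by auto
qed

lemma subspace_orthonormal_family:
  fixes L :: "'a::euclidean_space set"
  assumes "subspace L"
  obtains b where "orthonormal_family (dim L) b" "span (b ` {..<dim L}) = L"
proof -
  obtain B where B: "B \<subseteq> L" "pairwise orthogonal B" "\<And>x. x \<in> B \<Longrightarrow> norm x = 1"
    "independent B" "card B = dim L" "span B = L"
    using orthonormal_basis_subspace[OF assms] by metis
  then obtain b where b: "bij_betw b {..<dim L} B"
    using ex_bij_betw_nat_finite[of B] independent_imp_finite by (auto simp: atLeast0LessThan)
  have "orthonormal_family (dim L) b"
    unfolding orthonormal_family_def
  proof (intro allI impI)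
    fix i j assume "i < dim L" "j < dim L"
    moreover from this have "b i \<in> B" "b j \<in> B" "i \<noteq> j \<Longrightarrow> b i \<noteq> b j"
      using b by (auto simp: bij_betw_def inj_on_def)
    ultimately show "b i \<bullet> b j = (if i = j then 1 else 0)"
      using B(2,3) by (auto simp: pairwise_def orthogonal_def dot_square_norm)
  qed
  moreover have "b ` {..<dim L} = B" using b by (simp add: bij_betw_def)
  ultimately show ?thesis using that B(6) by metis
qed

lemma orth_proj_unique:
  assumes "subspace L" "y \<in> L" "\<And>z. z \<in> L \<Longrightarrow> orthogonal (x - y) z"
  shows "orth_proj L x = y"
  unfolding orth_proj_def
proof (rule the_equality)
  show "y \<in> L \<and> (\<forall>z\<in>L. orthogonal (x - y) z)" using assms by auto
  fix y' assume y': "y' \<in> L \<and> (\<forall>z\<in>L. orthogonal (x - y') z)"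
  have "y' - y \<in> L" using assms y' by (simp add: subspace_diff)
  then have "orthogonal (x - y) (y' - y)" "orthogonal (x - y') (y' - y)"
    using assms(3) y' by auto
  then have "(y' - y) \<bullet> (y' - y) = 0"
    by (simp add: orthogonal_def inner_diff_left)
  then show "y' = y" by simp
qed

lemma orth_proj_orthonormal:
  assumes "orthonormal_family k b"
  shows "orth_proj (span (b ` {..<k})) x = (\<Sum>i<k. (x \<bullet> b i) *\<^sub>R b i)"
proof (rule orth_proj_unique)
  show "(\<Sum>i<k. (x \<bullet> b i) *\<^sub>R b i) \<in> span (b ` {..<k})"
    by (intro span_sum span_scale span_base) auto
  fix z assume z: "z \<in> span (b ` {..<k})"
  have "orthogonal (x - (\<Sum>i<k. (x \<bullet> b i) *\<^sub>R b i)) y" if "y \<in> b ` {..<k}" for y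
    using that orthonormal_sum_inner[OF assms] by (auto simp: orthogonal_def inner_diff_left)
  then show "orthogonal (x - (\<Sum>i<k. (x \<bullet> b i) *\<^sub>R b i)) z"
    using z orthogonal_to_span by blast
qed simp

lemma
  fixes L :: "'a::euclidean_space set"
  assumes "subspace L"
  shows orth_proj_in: "orth_proj L x \<in> L"
    and orth_proj_orthogonal: "z \<in> L \<Longrightarrow> (x - orth_proj L x) \<bullet> z = 0"
    and linear_orth_proj: "linear (orth_proj L)"
    and orth_proj_inner: "z \<in> L \<Longrightarrow> orth_proj L x \<bullet> z = x \<bullet> z"
proof -
  obtain b where b: "orthonormal_family (dim L) b" "span (b ` {..<dim L}) = L"
    using assms by (rule subspace_orthonormal_family)
  have P: "orth_proj L x = (\<Sum>i<dim L. (x \<bullet> b i) *\<^sub>R b i)" for x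
    using orth_proj_orthonormal[OF b(1)] b(2) by simp
  show "linear (orth_proj L)"
  proof (rule linearI)
    show "orth_proj L (x + y) = orth_proj L x + orth_proj L y" for x y
      by (simp only: P inner_add_left scaleR_add_left sum.distrib)
    show "orth_proj L (r *\<^sub>R x) = r *\<^sub>R orth_proj L x" for r x
      by (simp only: P inner_scaleR_left scaleR_sum_right scaleR_scaleR)
  qed
  show "orth_proj L x \<in> L"
  proof -
    have "orth_proj L x \<in> span (b ` {..<dim L})"
      unfolding P by (intro span_sum span_scale span_base) auto
    then show ?thesis using b(2) by simp
  qed
  have *: "(x - orth_proj L x) \<bullet> z = 0" if "z \<in> L" for z
  proof (rule inner_span_eq_0)
    show "(x - orth_proj L x) \<bullet> y = 0" if "y \<in> b ` {..<dim L}" for y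
      using that orthonormal_sum_inner[OF b(1)] by (auto simp: P inner_diff_left)
    show "z \<in> span (b ` {..<dim L})"
      using \<open>z \<in> L\<close> b(2) by simp
  qed
  show "z \<in> L \<Longrightarrow> (x - orth_proj L x) \<bullet> z = 0"
    by (rule *)
  show "orth_proj L x \<bullet> z = x \<bullet> z" if "z \<in> L"
    using *[OF that] by (simp add: inner_diff_left)
qed

lemma orth_proj_id: "subspace L \<Longrightarrow> x \<in> L \<Longrightarrow> orth_proj L x = x"
  by (rule orth_proj_unique) (auto simp: orthogonal_def)

section \<open>Lebesgue measure in orthonormal coordinates\<close>

interpretation lb: product_sigma_finite "\<lambda>_. lborel :: 'a::euclidean_space measure"
  by standard

text \<open>Fubini, one coordinate at a time. The weights \<open>w\<close> let a coordinate map act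
  on a part of the space only, as with the indicator of the ball when the ball is mapped onto an
  ellipsoid; translations and scalings have weight 1.\<close>

lemma nn_integral_PiM_transform:
  fixes N M :: "'i \<Rightarrow> 'a measure"
  assumes "finite I" "product_sigma_finite N" "product_sigma_finite M"
    and f: "\<And>i. i \<in> I \<Longrightarrow> f i \<in> N i \<rightarrow>\<^sub>M M i"
    and w: "\<And>i. i \<in> I \<Longrightarrow> w i \<in> borel_measurable (N i)"
    and K: "\<And>i g. i \<in> I \<Longrightarrow> g \<in> borel_measurable (M i) \<Longrightarrow>
      (\<integral>\<^sup>+x. g (f i x) * w i x \<partial>N i) = K i * (\<integral>\<^sup>+x. g x \<partial>M i)"
    and F: "F \<in> borel_measurable (Pi\<^sub>M I M)"
  shows "(\<integral>\<^sup>+x. F (\<lambda>i\<in>I. f i (x i)) * (\<Prod>i\<in>I. w i (x i)) \<partial>Pi\<^sub>M I N)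
    = (\<Prod>i\<in>I. K i) * (\<integral>\<^sup>+x. F x \<partial>Pi\<^sub>M I M)"
  using assms(1) f w K F
proof (induction I arbitrary: F rule: finite_induct)
  case empty
  interpret N: product_sigma_finite N by fact
  interpret M: product_sigma_finite M by fact
  show ?case by (subst N.nn_integral_empty, simp, subst M.nn_integral_empty) (simp_all add: restrict_def)
next
  case (insert i I)
  interpret N: product_sigma_finite N by fact
  interpret M: product_sigma_finite M by fact
  note [measurable] = insert.prems(4) insert.prems(1,2)
  have [measurable]: "(\<lambda>x. \<lambda>j\<in>J. f j (x j)) \<in> Pi\<^sub>M J N \<rightarrow>\<^sub>M Pi\<^sub>M J M" if "J \<subseteq> insert i I" for J
  proof (rule measurable_restrict)
    fix j assume j: "j \<in> J"
    then have "j \<in> insert i I" using that by auto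
    then show "(\<lambda>x. f j (x j)) \<in> Pi\<^sub>M J N \<rightarrow>\<^sub>M M j"
      by (rule measurable_compose[OF measurable_component_singleton[OF j] insert.prems(1)])
  qed
  have [measurable]: "(\<lambda>x. \<Prod>j\<in>J. w j (x j)) \<in> borel_measurable (Pi\<^sub>M J N)" if "J \<subseteq> insert i I" for J
  proof (rule borel_measurable_prod_ennreal)
    fix j assume j: "j \<in> J"
    then have "j \<in> insert i I" using that by auto
    then show "(\<lambda>x. w j (x j)) \<in> borel_measurable (Pi\<^sub>M J N)"
      by (rule measurable_compose[OF measurable_component_singleton[OF j] insert.prems(2)])
  qed
  have [measurable]: "(\<lambda>x. \<integral>\<^sup>+y. F (x(i := y)) \<partial>M i) \<in> borel_measurable (Pi\<^sub>M I M)"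
    using measurable_compose[OF measurable_add_dim insert.prems(4)]
    by (intro sigma_finite_measure.borel_measurable_nn_integral[OF M.sigma_finite_measures]) (simp add: case_prod_beta')
  have "(\<integral>\<^sup>+x. F (\<lambda>j\<in>insert i I. f j (x j)) * (\<Prod>j\<in>insert i I. w j (x j)) \<partial>Pi\<^sub>M (insert i I) N)
     = (\<integral>\<^sup>+x. \<integral>\<^sup>+y. F (\<lambda>j\<in>insert i I. f j ((x(i := y)) j)) * (\<Prod>j\<in>insert i I. w j ((x(i := y)) j)) \<partial>N i \<partial>Pi\<^sub>M I N)"
    by (intro N.product_nn_integral_insert insert.hyps) measurable
  also have "\<dots> = (\<integral>\<^sup>+x. \<integral>\<^sup>+y. (F ((\<lambda>j\<in>I. f j (x j))(i := f i y)) * w i y) * (\<Prod>j\<in>I. w j (x j)) \<partial>N i \<partial>Pi\<^sub>M I N)"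
  proof (intro nn_integral_cong)
    fix x y
    have 1: "(\<lambda>j\<in>insert i I. f j ((x(i := y)) j)) = (\<lambda>j\<in>I. f j (x j))(i := f i y)"
      using insert.hyps by (auto simp: restrict_def fun_eq_iff)
    have 2: "(\<Prod>j\<in>insert i I. w j ((x(i := y)) j)) = w i y * (\<Prod>j\<in>I. w j (x j))"
      using insert.hyps by (auto intro!: arg_cong2[where f = times] prod.cong)
    show "F (\<lambda>j\<in>insert i I. f j ((x(i := y)) j)) * (\<Prod>j\<in>insert i I. w j ((x(i := y)) j)) =
      (F ((\<lambda>j\<in>I. f j (x j))(i := f i y)) * w i y) * (\<Prod>j\<in>I. w j (x j))"
      unfolding 1 2 by (simp add: mult_ac)
  qed
  also have "\<dots> = (\<integral>\<^sup>+x. (K i * (\<integral>\<^sup>+y. F ((\<lambda>j\<in>I. f j (x j))(i := y)) \<partial>M i)) * (\<Prod>j\<in>I. w j (x j)) \<partial>Pi\<^sub>M I N)"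
  proof (intro nn_integral_cong)
    fix x assume x: "x \<in> space (Pi\<^sub>M I N)"
    have r: "(\<lambda>j\<in>I. f j (x j)) \<in> space (Pi\<^sub>M I M)"
      using x by (auto simp: space_PiM PiE_iff intro!: measurable_space[OF insert.prems(1)])
    have [measurable]: "(\<lambda>y. F ((\<lambda>j\<in>I. f j (x j))(i := y))) \<in> borel_measurable (M i)"
      using r insert.hyps by measurable
    have "(\<integral>\<^sup>+y. (F ((\<lambda>j\<in>I. f j (x j))(i := f i y)) * w i y) * (\<Prod>j\<in>I. w j (x j)) \<partial>N i)
       = (\<integral>\<^sup>+y. (F ((\<lambda>j\<in>I. f j (x j))(i := f i y)) * w i y) \<partial>N i) * (\<Prod>j\<in>I. w j (x j))"
      using insert.prems(1,2) by (intro nn_integral_multc) measurable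
    also have "(\<integral>\<^sup>+y. (F ((\<lambda>j\<in>I. f j (x j))(i := f i y)) * w i y) \<partial>N i)
       = K i * (\<integral>\<^sup>+y. F ((\<lambda>j\<in>I. f j (x j))(i := y)) \<partial>M i)"
      by (rule insert.prems(3)) auto
    finally show "(\<integral>\<^sup>+y. (F ((\<lambda>j\<in>I. f j (x j))(i := f i y)) * w i y) * (\<Prod>j\<in>I. w j (x j)) \<partial>N i)
       = (K i * (\<integral>\<^sup>+y. F ((\<lambda>j\<in>I. f j (x j))(i := y)) \<partial>M i)) * (\<Prod>j\<in>I. w j (x j))" .
  qed
  also have "\<dots> = (\<Prod>j\<in>I. K j) * (\<integral>\<^sup>+x. K i * (\<integral>\<^sup>+y. F (x(i := y)) \<partial>M i) \<partial>Pi\<^sub>M I M)"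
    by (rule insert.IH) ((rule insert.prems; simp)+, measurable)
  also have "(\<integral>\<^sup>+x. K i * (\<integral>\<^sup>+y. F (x(i := y)) \<partial>M i) \<partial>Pi\<^sub>M I M) = K i * (\<integral>\<^sup>+x. \<integral>\<^sup>+y. F (x(i := y)) \<partial>M i \<partial>Pi\<^sub>M I M)"
    by (intro nn_integral_cmult) measurable
  also have "(\<integral>\<^sup>+x. \<integral>\<^sup>+y. F (x(i := y)) \<partial>M i \<partial>Pi\<^sub>M I M) = (\<integral>\<^sup>+x. F x \<partial>Pi\<^sub>M (insert i I) M)"
    by (intro M.product_nn_integral_insert[symmetric] insert.hyps) measurable
  finally show ?case
    using insert.hyps by (simp add: mult_ac)
qed

lemma nn_integral_lborel_affine:
  fixes t :: "'a::euclidean_space"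
  assumes [measurable]: "f \<in> borel_measurable borel" and "c \<noteq> 0"
  shows "(\<integral>\<^sup>+x. f x \<partial>lborel) = ennreal (\<bar>c\<bar> ^ DIM('a)) * (\<integral>\<^sup>+x. f (t + c *\<^sub>R x) \<partial>lborel)"
  by (subst lborel_affine[OF \<open>c \<noteq> 0\<close>, of t])
    (simp add: nn_integral_density nn_integral_distr nn_integral_cmult)

lemma nn_integral_lborel_translate:
  fixes t :: "'a::euclidean_space"
  assumes "f \<in> borel_measurable borel"
  shows "(\<integral>\<^sup>+x. f (x + t) \<partial>lborel) = (\<integral>\<^sup>+x. f x \<partial>lborel)"
  using nn_integral_lborel_affine[OF assms, of 1 t] by (simp add: add.commute)

lemma nn_integral_PiM_translate:
  fixes a :: "'i \<Rightarrow> 'a::euclidean_space"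
  assumes "finite I" "F \<in> borel_measurable (Pi\<^sub>M I (\<lambda>_. lborel))"
  shows "(\<integral>\<^sup>+x. F (\<lambda>i\<in>I. x i + a i) \<partial>Pi\<^sub>M I (\<lambda>_. lborel)) = (\<integral>\<^sup>+x. F x \<partial>Pi\<^sub>M I (\<lambda>_. lborel))"
proof -
  have "(\<integral>\<^sup>+x. F (\<lambda>i\<in>I. x i + a i) * (\<Prod>i\<in>I. 1) \<partial>Pi\<^sub>M I (\<lambda>_. lborel))
    = (\<Prod>i\<in>I. 1) * (\<integral>\<^sup>+x. F x \<partial>Pi\<^sub>M I (\<lambda>_. lborel))"
    using nn_integral_lborel_translate
    by (intro nn_integral_PiM_transform[where f = "\<lambda>i x. x + a i" and K = "\<lambda>_. 1" and w = "\<lambda>_ _. 1"] assms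
        lb.product_sigma_finite_axioms) auto
  then show ?thesis by simp
qed

lemma measurable_comb [measurable]:
  fixes b :: "nat \<Rightarrow> 'a::euclidean_space"
  shows "(\<lambda>c. \<Sum>i<k. c i *\<^sub>R b i) \<in> borel_measurable (Pi\<^sub>M {..<k} (\<lambda>_. lborel))"
  by (intro borel_measurable_sum borel_measurable_scaleR) auto

lemma restrict_comb: "(\<Sum>i<k. (\<lambda>i\<in>{..<k}. c i) i *\<^sub>R b i) = (\<Sum>i<k. c i *\<^sub>R b i)"
  by (intro sum.cong) auto

lemma nn_integral_PL_Suc:
  fixes F :: "(nat \<Rightarrow> 'a::euclidean_space) \<Rightarrow> ennreal"
  assumes "F \<in> borel_measurable (Pi\<^sub>M {..<Suc k} (\<lambda>_. lborel))"
  shows "(\<integral>\<^sup>+x. F x \<partial>Pi\<^sub>M {..<Suc k} (\<lambda>_. lborel))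
      = (\<integral>\<^sup>+x. \<integral>\<^sup>+y. F (x(k := y)) \<partial>lborel \<partial>Pi\<^sub>M {..<k} (\<lambda>_. lborel))"
    and "(\<integral>\<^sup>+x. F x \<partial>Pi\<^sub>M {..<Suc k} (\<lambda>_. lborel))
      = (\<integral>\<^sup>+y. \<integral>\<^sup>+x. F (x(k := y)) \<partial>Pi\<^sub>M {..<k} (\<lambda>_. lborel) \<partial>lborel)"
  using assms unfolding lessThan_Suc
  by (auto intro: lb.product_nn_integral_insert lb.product_nn_integral_insert_rev)

text \<open>In the orthonormal basis the vectors form a triangular matrix with the residual norms on
  the diagonal. Each new vector translates the earlier coordinates, under which Lebesgue measure is
  invariant, and rescales its own coordinate by \<open>norm (gs v j)\<close>. So \<open>pvol\<close>
  is the Jacobian, without recourse to determinants.\<close>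

lemma nn_integral_comb_gs:
  fixes v :: "nat \<Rightarrow> 'a::euclidean_space"
  assumes nz: "pvol k v \<noteq> 0" and F: "F \<in> borel_measurable borel"
  shows "(\<integral>\<^sup>+c. F (\<Sum>i<k. c i *\<^sub>R gs_unit v i) \<partial>Pi\<^sub>M {..<k} (\<lambda>_. lborel))
    = ennreal (pvol k v) * (\<integral>\<^sup>+t. F (\<Sum>i<k. t i *\<^sub>R v i) \<partial>Pi\<^sub>M {..<k} (\<lambda>_. lborel))"
proof -
  have "(\<integral>\<^sup>+c. F (\<Sum>i<j. c i *\<^sub>R gs_unit v i) \<partial>Pi\<^sub>M {..<j} (\<lambda>_. lborel))
    = ennreal (pvol j v) * (\<integral>\<^sup>+t. F (\<Sum>i<j. t i *\<^sub>R v i) \<partial>Pi\<^sub>M {..<j} (\<lambda>_. lborel))"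
    if "j \<le> k" "F \<in> borel_measurable borel" for j and F :: "'a \<Rightarrow> ennreal"
    using that
  proof (induction j arbitrary: F)
    case 0
    then show ?case by (simp add: lb.nn_integral_empty)
  next
    case (Suc j)
    note [measurable] = Suc.prems(2)
    let ?e = "gs_unit v" and ?m = "norm (gs v j)"
    have m: "?m > 0"
      using nz Suc.prems(1) by (auto simp: pvol_nonzero_iff)
    \<comment> \<open>The coordinates of the part of \<open>v j\<close> in the span of its
      predecessors; they become the translation of the earlier coordinates.\<close>
    define a where "a i = (v j - gs v j) \<bullet> ?e i" for i
    have on: "orthonormal_family j ?e"
      using orthonormal_gs_unit[OF nz] Suc.prems(1) by (auto intro: orthonormal_family_mono)
    have "v j - gs v j \<in> span (?e ` {..<j})"
      using diff_gs_in_span[of v j] span_gs_unit[OF nz, of j] Suc.prems(1) by simp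
    from orthonormal_expansion[OF on this] have vj: "v j = (\<Sum>i<j. a i *\<^sub>R ?e i) + ?m *\<^sub>R ?e j"
      by (simp add: a_def flip: gs_unit_scale)
    have cm: "(\<lambda>t. F (\<Sum>i<n. t i *\<^sub>R b i)) \<in> borel_measurable (Pi\<^sub>M {..<n} (\<lambda>_. lborel))"
      for n and b :: "nat \<Rightarrow> 'a"
      by (rule measurable_compose[OF measurable_comb Suc.prems(2)])
    interpret P: sigma_finite_measure "Pi\<^sub>M {..<j} (\<lambda>_. lborel :: real measure)"
      by (rule lb.sigma_finite) simp
    have [measurable]: "(\<lambda>x. \<Sum>i<j. snd x i *\<^sub>R b i) \<in> borel_measurable (N \<Otimes>\<^sub>M Pi\<^sub>M {..<j} (\<lambda>_. lborel))"
      for N :: "real measure" and b :: "nat \<Rightarrow> 'a"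
      by (rule measurable_compose[OF measurable_snd measurable_comb])
    have [measurable]: "(\<lambda>y. \<integral>\<^sup>+t. F ((\<Sum>i<j. t i *\<^sub>R b i) + g y *\<^sub>R w) \<partial>Pi\<^sub>M {..<j} (\<lambda>_. lborel)) \<in> borel_measurable borel"
      if [measurable]: "g \<in> borel_measurable borel" for g and b :: "nat \<Rightarrow> 'a" and w
      by (rule P.borel_measurable_nn_integral) (simp add: case_prod_beta', measurable)
    have upd: "(\<Sum>i<Suc j. (t(j := y)) i *\<^sub>R b i) = (\<Sum>i<j. t i *\<^sub>R b i) + y *\<^sub>R b j"
      for t :: "nat \<Rightarrow> real" and y and b :: "nat \<Rightarrow> 'a"
      by simp
    have "(\<integral>\<^sup>+t. F (\<Sum>i<Suc j. t i *\<^sub>R v i) \<partial>Pi\<^sub>M {..<Suc j} (\<lambda>_. lborel))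
      = (\<integral>\<^sup>+y. \<integral>\<^sup>+t. F ((\<Sum>i<j. t i *\<^sub>R v i) + y *\<^sub>R v j) \<partial>Pi\<^sub>M {..<j} (\<lambda>_. lborel) \<partial>lborel)"
      by (subst nn_integral_PL_Suc(2)[OF cm]) (simp only: upd)
    then have "ennreal (pvol j v) * (\<integral>\<^sup>+t. F (\<Sum>i<Suc j. t i *\<^sub>R v i) \<partial>Pi\<^sub>M {..<Suc j} (\<lambda>_. lborel))
      = (\<integral>\<^sup>+y. ennreal (pvol j v) * (\<integral>\<^sup>+t. F ((\<Sum>i<j. t i *\<^sub>R v i) + y *\<^sub>R v j) \<partial>Pi\<^sub>M {..<j} (\<lambda>_. lborel)) \<partial>lborel)"
      by (simp only:) (rule nn_integral_cmult[symmetric], measurable)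
    also have "\<dots> = (\<integral>\<^sup>+y. \<integral>\<^sup>+c. F ((\<Sum>i<j. c i *\<^sub>R ?e i) + y *\<^sub>R v j) \<partial>Pi\<^sub>M {..<j} (\<lambda>_. lborel) \<partial>lborel)"
      using Suc.prems(1) by (intro nn_integral_cong Suc.IH[symmetric]) auto
    also have "\<dots> = (\<integral>\<^sup>+y. \<integral>\<^sup>+c. F ((\<Sum>i<j. c i *\<^sub>R ?e i) + (?m * y) *\<^sub>R ?e j) \<partial>Pi\<^sub>M {..<j} (\<lambda>_. lborel) \<partial>lborel)"
    proof (rule nn_integral_cong)
      fix y :: real
      let ?G = "\<lambda>c. F ((\<Sum>i<j. c i *\<^sub>R ?e i) + (?m * y) *\<^sub>R ?e j)"
      have *: "(\<Sum>i<j. c i *\<^sub>R ?e i) + y *\<^sub>R v j = (\<Sum>i<j. (\<lambda>i\<in>{..<j}. c i + y * a i) i *\<^sub>R ?e i) + (?m * y) *\<^sub>R ?e j" for c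
        unfolding restrict_comb vj by (simp add: algebra_simps sum.distrib scaleR_sum_right)
      show "(\<integral>\<^sup>+c. F ((\<Sum>i<j. c i *\<^sub>R ?e i) + y *\<^sub>R v j) \<partial>Pi\<^sub>M {..<j} (\<lambda>_. lborel)) = integral\<^sup>N (Pi\<^sub>M {..<j} (\<lambda>_. lborel)) ?G"
        unfolding * by (rule nn_integral_PiM_translate) auto
    qed
    finally have 1: "ennreal (pvol j v) * (\<integral>\<^sup>+t. F (\<Sum>i<Suc j. t i *\<^sub>R v i) \<partial>Pi\<^sub>M {..<Suc j} (\<lambda>_. lborel))
      = (\<integral>\<^sup>+y. \<integral>\<^sup>+c. F ((\<Sum>i<j. c i *\<^sub>R ?e i) + (?m * y) *\<^sub>R ?e j) \<partial>Pi\<^sub>M {..<j} (\<lambda>_. lborel) \<partial>lborel)" .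
    have "(\<integral>\<^sup>+c. F (\<Sum>i<Suc j. c i *\<^sub>R ?e i) \<partial>Pi\<^sub>M {..<Suc j} (\<lambda>_. lborel))
      = (\<integral>\<^sup>+y. \<integral>\<^sup>+c. F ((\<Sum>i<j. c i *\<^sub>R ?e i) + y *\<^sub>R ?e j) \<partial>Pi\<^sub>M {..<j} (\<lambda>_. lborel) \<partial>lborel)"
      by (subst nn_integral_PL_Suc(2)[OF cm]) (simp only: upd)
    also have "\<dots> = ennreal ?m * (\<integral>\<^sup>+y. \<integral>\<^sup>+c. F ((\<Sum>i<j. c i *\<^sub>R ?e i) + (?m * y) *\<^sub>R ?e j) \<partial>Pi\<^sub>M {..<j} (\<lambda>_. lborel) \<partial>lborel)"
      using m by (subst nn_integral_lborel_affine[where c = ?m and t = 0]) (simp_all, measurable)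
    also note 1[symmetric]
    finally show ?case
      by (simp add: pvol_Suc ennreal_mult pvol_nonneg mult_ac)
  qed
  from this[OF order_refl F] show ?thesis .
qed

lemma emeasure_PL_ball:
  "(\<integral>\<^sup>+c. indicator {x::real. x \<le> 1} (\<Sum>i<k. (c i)\<^sup>2) \<partial>Pi\<^sub>M {..<k} (\<lambda>_. lborel)) = ennreal (unit_ball_vol (real k))"
proof -
  let ?M = "Pi\<^sub>M {..<k} (\<lambda>_. lborel :: real measure)"
  have "(\<integral>\<^sup>+c. indicator {x::real. x \<le> 1} (\<Sum>i<k. (c i)\<^sup>2) \<partial>?M)
    = (\<integral>\<^sup>+c. indicator ({f. sqrt (\<Sum>i<k. (f i)\<^sup>2) \<le> 1} \<inter> space ?M) c \<partial>?M)"
    by (intro nn_integral_cong) (auto simp: indicator_def)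
  also have "\<dots> = emeasure ?M ({f. sqrt (\<Sum>i<k. (f i)\<^sup>2) \<le> 1} \<inter> space ?M)"
  proof (rule nn_integral_indicator)
    have "{f \<in> space ?M. sqrt (\<Sum>i<k. (f i)\<^sup>2) \<le> 1} \<in> sets ?M" by measurable
    then show "{f. sqrt (\<Sum>i<k. (f i)\<^sup>2) \<le> 1} \<inter> space ?M \<in> sets ?M"
      by (simp add: Int_def conj_commute)
  qed
  also have "\<dots> = ennreal (unit_ball_vol (real k))"
    using emeasure_cball_aux[of "{..<k}" 1] by simp
  finally show ?thesis .
qed

text \<open>The uniqueness argument for translation-invariant measures: the double integral of
  \<open>F (comb c + y) * B y\<close> is evaluated in both orders. Each order splits off one of the
  two integrals of \<open>F\<close>, multiplied by the measure of the unit ball, and by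
  \<open>emeasure_PL_ball\<close> this measure is the same in both.\<close>

lemma nn_integral_orthonormal:
  fixes b :: "nat \<Rightarrow> 'a::euclidean_space"
  assumes b: "orthonormal_family DIM('a) b" and F [measurable]: "F \<in> borel_measurable borel"
  shows "(\<integral>\<^sup>+x. F x \<partial>lborel) = (\<integral>\<^sup>+c. F (\<Sum>i<DIM('a). c i *\<^sub>R b i) \<partial>Pi\<^sub>M {..<DIM('a)} (\<lambda>_. lborel))"
proof -
  let ?d = "DIM('a)" and ?M = "Pi\<^sub>M {..<DIM('a)} (\<lambda>_. lborel :: real measure)"
  define comb where "comb c = (\<Sum>i<?d. c i *\<^sub>R b i)" for c
  define B :: "'a \<Rightarrow> ennreal" where "B = indicator (cball 0 1)"
  have [measurable]: "comb \<in> borel_measurable ?M"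
    unfolding comb_def by (rule measurable_comb)
  have B_m [measurable]: "B \<in> borel_measurable borel"
    unfolding B_def by (intro borel_measurable_indicator borel_closed closed_cball)
  interpret pair_sigma_finite ?M "lborel :: 'a measure"
    by (intro pair_sigma_finite.intro lb.sigma_finite finite_lessThan lborel.sigma_finite_measure_axioms)
  have "span (b ` {..<?d}) = UNIV"
    using orthonormal_family_dim[OF b] dim_eq_full[of "b ` {..<?d}"] by simp
  then have ex: "comb (\<lambda>i. y \<bullet> b i) = y" for y
    unfolding comb_def using orthonormal_expansion[OF b, of y] by simp
  have tr: "(\<integral>\<^sup>+c. G (comb c + y) \<partial>?M) = (\<integral>\<^sup>+c. G (comb c) \<partial>?M)" if [measurable]: "G \<in> borel_measurable borel" for G y
  proof -
    have "comb c + y = comb (\<lambda>i\<in>{..<?d}. c i + y \<bullet> b i)" for c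
      by (subst (2) comb_def, subst restrict_comb, subst (1) ex[of y, symmetric])
        (simp add: comb_def scaleR_add_left sum.distrib)
    then show ?thesis
      using nn_integral_PiM_translate[of "{..<?d}" "\<lambda>c. G (comb c)" "\<lambda>i. y \<bullet> b i"] by simp
  qed
  have vol: "(\<integral>\<^sup>+c. B (comb c) \<partial>?M) = ennreal (unit_ball_vol ?d)"
  proof -
    have "B (comb c) = indicator {x::real. x \<le> 1} (\<Sum>i<?d. (c i)\<^sup>2)" for c
      using orthonormal_sum_norm[OF b, of c] by (auto simp: B_def comb_def indicator_def abs_square_le_1 simp flip: orthonormal_sum_norm[OF b, of c])
    then show ?thesis by (simp add: emeasure_PL_ball)
  qed
  have vol': "(\<integral>\<^sup>+y. B y \<partial>lborel) = ennreal (unit_ball_vol ?d)"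
    by (simp add: B_def emeasure_cball)
  \<comment> \<open>The symmetry of the ball turns \<open>B (y - comb c)\<close> into a translate in
    \<open>c\<close>, to which \<open>tr\<close> applies.\<close>
  have Bm: "B (- x) = B x" for x by (simp add: B_def indicator_def)
  have "(\<integral>\<^sup>+c. F (comb c) \<partial>?M) * ennreal (unit_ball_vol ?d) = (\<integral>\<^sup>+y. (\<integral>\<^sup>+c. F (comb c) \<partial>?M) * B y \<partial>lborel)"
    by (subst vol'[symmetric], rule nn_integral_cmult[symmetric]) simp
  also have "\<dots> = (\<integral>\<^sup>+y. (\<integral>\<^sup>+c. F (comb c + y) * B y \<partial>?M) \<partial>lborel)"
    by (intro nn_integral_cong) (simp add: tr nn_integral_multc)
  also have "\<dots> = (\<integral>\<^sup>+c. (\<integral>\<^sup>+y. F (comb c + y) * B y \<partial>lborel) \<partial>?M)"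
    by (rule Fubini') measurable
  also have "\<dots> = (\<integral>\<^sup>+c. (\<integral>\<^sup>+y. F y * B (y - comb c) \<partial>lborel) \<partial>?M)"
  proof (rule nn_integral_cong)
    fix c
    show "(\<integral>\<^sup>+y. F (comb c + y) * B y \<partial>lborel) = (\<integral>\<^sup>+y. F y * B (y - comb c) \<partial>lborel)"
      using nn_integral_lborel_translate[of "\<lambda>y. F y * B (y - comb c)" "comb c"] by (simp add: add.commute)
  qed
  also have "\<dots> = (\<integral>\<^sup>+y. (\<integral>\<^sup>+c. F y * B (y - comb c) \<partial>?M) \<partial>lborel)"
    by (rule Fubini'[symmetric]) measurable
  also have "\<dots> = (\<integral>\<^sup>+y. F y * ennreal (unit_ball_vol ?d) \<partial>lborel)"
  proof (rule nn_integral_cong)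
    fix y
    have "B (y - comb c) = B (comb c + - y)" for c
      using Bm[of "y - comb c"] by simp
    then show "(\<integral>\<^sup>+c. F y * B (y - comb c) \<partial>?M) = F y * ennreal (unit_ball_vol ?d)"
      using tr[OF B_m, of "- y"] by (simp add: nn_integral_cmult vol del: add_uminus_conv_diff)
  qed
  also have "\<dots> = (\<integral>\<^sup>+y. F y \<partial>lborel) * ennreal (unit_ball_vol ?d)"
    by (rule nn_integral_multc) simp
  finally show ?thesis
    using unit_ball_vol_pos[of "real ?d"]
    by (simp add: comb_def ennreal_mult_cancel_left mult.commute[of _ "ennreal (unit_ball_vol _)"] less_le)
qed

lemma nn_integral_PL_split:
  fixes f :: "(nat \<Rightarrow> 'a::euclidean_space) \<Rightarrow> ennreal"
  assumes "k \<le> d" and f: "f \<in> borel_measurable (Pi\<^sub>M {..<d} (\<lambda>_. lborel))"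
    and fg: "\<And>x. x \<in> space (Pi\<^sub>M {..<d} (\<lambda>_. lborel)) \<Longrightarrow> f x = g (restrict x {..<k}) * (\<Prod>i=k..<d. h i (x i))"
    and g: "g \<in> borel_measurable (Pi\<^sub>M {..<k} (\<lambda>_. lborel))"
    and h: "\<And>i. h i \<in> borel_measurable borel"
  shows "(\<integral>\<^sup>+x. f x \<partial>Pi\<^sub>M {..<d} (\<lambda>_. lborel))
    = (\<integral>\<^sup>+x. g x \<partial>Pi\<^sub>M {..<k} (\<lambda>_. lborel)) * (\<Prod>i=k..<d. \<integral>\<^sup>+x. h i x \<partial>lborel)"
proof -
  let ?I = "{..<k}" and ?J = "{k..<d}" and ?P = "\<lambda>I. Pi\<^sub>M I (\<lambda>_. lborel :: 'a measure)"
  have IJ: "?I \<union> ?J = {..<d}" "?I \<inter> ?J = {}" using assms(1) by auto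
  have "(\<integral>\<^sup>+x. f x \<partial>?P {..<d}) = (\<integral>\<^sup>+x. \<integral>\<^sup>+y. f (merge ?I ?J (x, y)) \<partial>?P ?J \<partial>?P ?I)"
    using lb.product_nn_integral_fold[of ?I ?J f] f IJ by simp
  also have "\<dots> = (\<integral>\<^sup>+x. \<integral>\<^sup>+y. g x * (\<Prod>i\<in>?J. h i (y i)) \<partial>?P ?J \<partial>?P ?I)"
  proof (intro nn_integral_cong)
    fix x y assume xy: "x \<in> space (?P ?I)" "y \<in> space (?P ?J)"
    have "merge ?I ?J (x, y) \<in> space (?P {..<d})"
      using xy assms(1) by (auto simp: space_PiM merge_def PiE_iff extensional_def)
    moreover have "restrict (merge ?I ?J (x, y)) ?I = x"
      using xy by (auto simp: space_PiM merge_def restrict_def PiE_iff extensional_def fun_eq_iff)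
    moreover have "(\<Prod>i\<in>?J. h i (merge ?I ?J (x, y) i)) = (\<Prod>i\<in>?J. h i (y i))"
      by (intro prod.cong) (auto simp: merge_def)
    ultimately show "f (merge ?I ?J (x, y)) = g x * (\<Prod>i\<in>?J. h i (y i))"
      by (simp add: fg)
  qed
  also have "\<dots> = (\<integral>\<^sup>+x. g x * (\<integral>\<^sup>+y. (\<Prod>i\<in>?J. h i (y i)) \<partial>?P ?J) \<partial>?P ?I)"
    using h by (intro nn_integral_cong nn_integral_cmult borel_measurable_prod_ennreal
        measurable_compose[OF measurable_component_singleton]) auto
  also have "\<dots> = (\<integral>\<^sup>+x. g x \<partial>?P ?I) * (\<integral>\<^sup>+y. (\<Prod>i\<in>?J. h i (y i)) \<partial>?P ?J)"
    using g by (intro nn_integral_multc) auto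
  also have "(\<integral>\<^sup>+y. (\<Prod>i\<in>?J. h i (y i)) \<partial>?P ?J) = (\<Prod>i\<in>?J. \<integral>\<^sup>+x. h i x \<partial>lborel)"
    using h by (intro lb.product_nn_integral_prod) auto
  finally show ?thesis .
qed

text \<open>Invariance in full dimension is brought down to a subspace. Both families are completed
  by the same vectors, and \<open>F\<close> of the projection is multiplied by the indicator of a
  unit cube in the complementary coordinates, which integrates to 1.\<close>

lemma nn_integral_orthonormal_span:
  fixes b b' :: "nat \<Rightarrow> 'a::euclidean_space"
  assumes b: "orthonormal_family k b" and b': "orthonormal_family k b'"
    and sp: "span (b ` {..<k}) = span (b' ` {..<k})"
    and F [measurable]: "F \<in> borel_measurable borel"
  shows "(\<integral>\<^sup>+c. F (\<Sum>i<k. c i *\<^sub>R b i) \<partial>Pi\<^sub>M {..<k} (\<lambda>_. lborel))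
    = (\<integral>\<^sup>+c. F (\<Sum>i<k. c i *\<^sub>R b' i) \<partial>Pi\<^sub>M {..<k} (\<lambda>_. lborel))"
proof -
  let ?d = "DIM('a)" and ?L = "span (b ` {..<k})"
  have k: "k \<le> ?d"
    using orthonormal_family_dim[OF b] dim_subset_UNIV[of ?L] by simp
  obtain e where e: "orthonormal_family ?d e" "\<forall>i<k. e i = b i"
    by (rule orthonormal_family_extend[OF b k])
  define e' where "e' i = (if i < k then b' i else e i)" for i
  have z: "x \<bullet> e i = 0" if "x \<in> ?L" "k \<le> i" "i < ?d" for x i
  proof -
    have "e i \<bullet> y = 0" if "y \<in> b ` {..<k}" for y
    proof -
      obtain j where "j < k" "y = b j"
        using \<open>y \<in> b ` {..<k}\<close> by auto
      then show ?thesis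
        using orthonormal_familyD[OF e(1), of i j] e(2) \<open>i < ?d\<close> \<open>k \<le> i\<close> by auto
    qed
    then have "e i \<bullet> x = 0"
      using \<open>x \<in> ?L\<close> by (rule inner_span_eq_0)
    then show ?thesis by (simp add: inner_commute)
  qed
  have b'L: "b' i \<in> ?L" if "i < k" for i
    using that by (auto simp: sp intro: span_base)
  have e': "orthonormal_family ?d e'"
    unfolding orthonormal_family_def
  proof (intro allI impI)
    fix i j assume "i < ?d" "j < ?d"
    then show "e' i \<bullet> e' j = (if i = j then 1 else 0)"
      using orthonormal_familyD[OF e(1), of i j] orthonormal_familyD[OF b', of i j]
        z[OF b'L, of i j] z[OF b'L, of j i] by (auto simp: e'_def inner_commute)
  qed
  define W where "W x = (\<Prod>i=k..<?d. indicator {0<..<1::real} (x \<bullet> e i) :: ennreal)" for x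
  have [measurable]: "W \<in> borel_measurable borel"
    unfolding W_def by measurable
  have [measurable]: "orth_proj ?L \<in> borel_measurable borel"
    using linear_orth_proj[OF subspace_span, of "b ` {..<k}"]
    by (intro borel_measurable_continuous_onI linear_continuous_on) (simp add: linear_linear)
  \<comment> \<open>The left side involves only the subspace and the common completion, so it is the
    same for \<open>e\<close> and \<open>e'\<close>.\<close>
  have main: "(\<integral>\<^sup>+x. F (orth_proj ?L x) * W x \<partial>lborel)
      = (\<integral>\<^sup>+c. F (\<Sum>i<k. c i *\<^sub>R a i) \<partial>Pi\<^sub>M {..<k} (\<lambda>_. lborel))"
    if a: "orthonormal_family ?d a" "\<And>i. k \<le> i \<Longrightarrow> a i = e i" "span (a ` {..<k}) = ?L" for a
  proof -
    have ak: "orthonormal_family k a" using a(1) k by (rule orthonormal_family_mono)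
    have P: "orth_proj ?L x = (\<Sum>i<k. (x \<bullet> a i) *\<^sub>R a i)" for x
      using orth_proj_orthonormal[OF ak] a(3) by simp
    have "(\<integral>\<^sup>+x. F (orth_proj ?L x) * W x \<partial>lborel)
      = (\<integral>\<^sup>+c. F (orth_proj ?L (\<Sum>i<?d. c i *\<^sub>R a i)) * W (\<Sum>i<?d. c i *\<^sub>R a i) \<partial>Pi\<^sub>M {..<?d} (\<lambda>_. lborel))"
      by (rule nn_integral_orthonormal[OF a(1)]) measurable
    also have "\<dots> = (\<integral>\<^sup>+c. F (\<Sum>i<k. c i *\<^sub>R a i) \<partial>Pi\<^sub>M {..<k} (\<lambda>_. lborel))
       * (\<Prod>i=k..<?d. \<integral>\<^sup>+x. indicator {0<..<1::real} x \<partial>lborel)"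
    proof (rule nn_integral_PL_split[OF k])
      fix c :: "nat \<Rightarrow> real"
      have 1: "orth_proj ?L (\<Sum>i<?d. c i *\<^sub>R a i) = (\<Sum>i<k. restrict c {..<k} i *\<^sub>R a i)"
        unfolding P restrict_comb using k by (intro sum.cong) (auto simp: orthonormal_sum_inner[OF a(1)])
      have 2: "W (\<Sum>i<?d. c i *\<^sub>R a i) = (\<Prod>i=k..<?d. indicator {0<..<1} (c i))"
        unfolding W_def by (intro prod.cong) (auto simp: orthonormal_sum_inner[OF a(1)] simp flip: a(2))
      show "F (orth_proj ?L (\<Sum>i<?d. c i *\<^sub>R a i)) * W (\<Sum>i<?d. c i *\<^sub>R a i)
         = F (\<Sum>i<k. restrict c {..<k} i *\<^sub>R a i) * (\<Prod>i=k..<?d. indicator {0<..<1} (c i))"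
        unfolding 1 2 ..
    qed measurable
    finally show ?thesis by simp
  qed
  have "(\<integral>\<^sup>+c. F (\<Sum>i<k. c i *\<^sub>R e i) \<partial>Pi\<^sub>M {..<k} (\<lambda>_. lborel))
    = (\<integral>\<^sup>+c. F (\<Sum>i<k. c i *\<^sub>R e' i) \<partial>Pi\<^sub>M {..<k} (\<lambda>_. lborel))"
  proof (subst (1 2) main[symmetric])
    show "span (e' ` {..<k}) = ?L" "span (e ` {..<k}) = ?L"
    proof -
      have "e' ` {..<k} = b' ` {..<k}" "e ` {..<k} = b ` {..<k}"
        using e(2) by (auto simp: e'_def intro!: image_cong)
      then show "span (e' ` {..<k}) = ?L" "span (e ` {..<k}) = ?L"
        using sp by simp_all
    qed
  qed (use e(1) e' in \<open>auto simp: e'_def\<close>)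
  moreover have "(\<Sum>i<k. c i *\<^sub>R e' i) = (\<Sum>i<k. c i *\<^sub>R b' i)" "(\<Sum>i<k. c i *\<^sub>R e i) = (\<Sum>i<k. c i *\<^sub>R b i)" for c
    using e(2) by (auto simp: e'_def intro!: sum.cong)
  ultimately show ?thesis
    by simp
qed

section \<open>Volume in flats\<close>

lemma gs_inner_self: "gs v i \<bullet> v i = (norm (gs v i))\<^sup>2"
proof -
  have "gs v i \<bullet> (v i - gs v i) = 0"
    by (rule gs_perp[OF diff_gs_in_span])
  then show ?thesis by (simp add: inner_diff_right dot_square_norm)
qed

text \<open>Pairing with the last residual annihilates all vectors but the last, so the last
  coefficient is 0 and the others follow by induction.\<close>

lemma pvol_independent:
  assumes "pvol k v \<noteq> 0" "(\<Sum>i<k. c i *\<^sub>R v i) = 0" "i < k"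
  shows "c i = 0"
  using assms
proof (induction k arbitrary: i)
  case (Suc k)
  have "gs v k \<bullet> (\<Sum>i<k. c i *\<^sub>R v i) = 0"
    by (intro gs_perp span_sum span_scale span_base) auto
  moreover have "gs v k \<bullet> ((\<Sum>i<k. c i *\<^sub>R v i) + c k *\<^sub>R v k) = 0"
    using Suc.prems(2) by simp
  ultimately have "c k * (norm (gs v k))\<^sup>2 = 0"
    by (simp only: inner_add_right inner_scaleR_right gs_inner_self)
  moreover have "gs v k \<noteq> 0"
    using Suc.prems(1) by (simp add: pvol_nonzero_iff)
  ultimately have ck: "c k = 0" by simp
  have "pvol k v \<noteq> 0" "(\<Sum>i<k. c i *\<^sub>R v i) = 0"
    using Suc.prems(1,2) ck by (simp_all add: pvol_Suc)
  from Suc.IH[OF this] show ?case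
    using Suc.prems(3) ck by (auto simp: less_Suc_eq)
qed simp

lemma pvol_coeff_unique:
  assumes "pvol k v \<noteq> 0" "(\<Sum>i<k. c i *\<^sub>R v i) = (\<Sum>i<k. c' i *\<^sub>R v i)" "i < k"
  shows "c i = c' i"
proof -
  have "(\<Sum>i<k. (c i - c' i) *\<^sub>R v i) = 0"
    using assms(2) by (simp add: scaleR_diff_left sum_subtractf)
  from pvol_independent[OF assms(1) this assms(3)] show ?thesis by simp
qed

lemma in_span_imageD:
  fixes v :: "nat \<Rightarrow> 'a::real_vector"
  assumes "x \<in> span (v ` {..<k})"
  obtains c where "x = (\<Sum>i<k. c i *\<^sub>R v i)"
proof -
  have "\<exists>c. x = (\<Sum>i<k. c i *\<^sub>R v i)"
    using assms
  proof (induction rule: span_induct_alt)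
    case base
    show ?case by (rule exI[of _ "\<lambda>_. 0"]) simp
  next
    case (step r x y)
    then obtain c i where c: "y = (\<Sum>i<k. c i *\<^sub>R v i)" and i: "i < k" "x = v i"
      by auto
    have "r *\<^sub>R x + y = (\<Sum>j<k. (if j = i then r else 0) *\<^sub>R v j) + y"
      using i by (simp add: if_distrib[of "\<lambda>a. a *\<^sub>R _"] cong: if_cong)
    also have "\<dots> = (\<Sum>j<k. ((if j = i then r else 0) + c j) *\<^sub>R v j)"
      by (simp add: c scaleR_add_left sum.distrib)
    finally show ?case by (rule exI[of _ "\<lambda>j. (if j = i then r else 0) + c j"])
  qed
  then show ?thesis using that by blast
qed

lemma borel_measurable_linear [measurable_dest]:
  fixes T :: "'a::euclidean_space \<Rightarrow> 'b::euclidean_space"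
  assumes "linear T"
  shows "T \<in> borel_measurable borel"
  using assms by (intro borel_measurable_continuous_onI linear_continuous_on) (simp add: linear_linear)

lemma compact_linear_image:
  fixes T :: "'a::euclidean_space \<Rightarrow> 'b::euclidean_space"
  assumes "linear T" "compact S"
  shows "compact (T ` S)"
  using assms by (intro compact_continuous_image linear_continuous_on) (simp_all add: linear_linear)

lemma linear_comb:
  assumes "linear T"
  shows "(\<Sum>i<k. t i *\<^sub>R T (e i)) = T (\<Sum>i<(k::nat). t i *\<^sub>R e i)"
  using assms by (simp add: linear_sum linear_scale)

lemma sum_sq_le_1_iff:
  assumes "orthonormal_family k e"
  shows "(\<Sum>i<k. (t i)\<^sup>2) \<le> 1 \<longleftrightarrow> norm (\<Sum>i<k. t i *\<^sub>R e i) \<le> 1"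
  unfolding orthonormal_sum_norm[OF assms, symmetric] by (simp add: abs_square_le_1)

text \<open>Each side is the volume of the image of the unit ball of the common span, divided by the
  volume of the unit ball. The former is measured in orthonormal coordinates of the image space and
  does not depend on their choice. If one side is 0, the image space has too small a dimension and
  the other side is 0 as well.\<close>

lemma pvol_image_orthonormal:
  fixes T :: "'a::euclidean_space \<Rightarrow> 'b::euclidean_space"
  assumes T: "linear T" and e: "orthonormal_family k e" and e': "orthonormal_family k e'"
    and sp: "span (e ` {..<k}) = span (e' ` {..<k})"
  shows "pvol k (\<lambda>i. T (e i)) = pvol k (\<lambda>i. T (e' i))"
proof (cases "pvol k (\<lambda>i. T (e i)) = 0")
  have spT: "span ((\<lambda>i. T (e i)) ` {..<k}) = span ((\<lambda>i. T (e' i)) ` {..<k})"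
    using sp by (simp add: span_linear_image_lessThan[OF T])
  {
    case True
    then show ?thesis
      using spT by (metis pvol_nonzero_iff_dim)
  next
    case False
    then have nz: "pvol k (\<lambda>i. T (e i)) \<noteq> 0" "pvol k (\<lambda>i. T (e' i)) \<noteq> 0"
      using spT by (metis pvol_nonzero_iff_dim)+
    let ?L = "span (e ` {..<k})" and ?M = "Pi\<^sub>M {..<k} (\<lambda>_. lborel :: real measure)"
    \<comment> \<open>In coordinates along \<open>T (a i)\<close> this set is the unit ball, for
      every orthonormal basis \<open>a\<close> of the span.\<close>
    define F :: "'b \<Rightarrow> ennreal" where "F = indicator (T ` (cball 0 1 \<inter> ?L))"
    have "compact (T ` (cball 0 1 \<inter> ?L))"
      using T by (intro compact_linear_image compact_Int_closed closed_subspace) auto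
    then have F: "F \<in> borel_measurable borel"
      unfolding F_def by (intro borel_measurable_indicator borel_closed compact_imp_closed)
    have vol: "(\<integral>\<^sup>+t. F (\<Sum>i<k. t i *\<^sub>R T (a i)) \<partial>?M) = ennreal (unit_ball_vol k)"
      if a: "orthonormal_family k a" "span (a ` {..<k}) = ?L" and nz: "pvol k (\<lambda>i. T (a i)) \<noteq> 0" for a
    proof -
      have "(\<Sum>i<k. t i *\<^sub>R T (a i)) \<in> T ` (cball 0 1 \<inter> ?L) \<longleftrightarrow> (\<Sum>i<k. (t i)\<^sup>2) \<le> 1" for t
      proof
        assume "(\<Sum>i<k. (t i)\<^sup>2) \<le> 1"
        moreover have "(\<Sum>i<k. t i *\<^sub>R a i) \<in> ?L"
          unfolding a(2)[symmetric] by (intro span_sum span_scale span_base) auto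
        ultimately show "(\<Sum>i<k. t i *\<^sub>R T (a i)) \<in> T ` (cball 0 1 \<inter> ?L)"
          unfolding linear_comb[OF T] sum_sq_le_1_iff[OF a(1)] by auto
      next
        assume "(\<Sum>i<k. t i *\<^sub>R T (a i)) \<in> T ` (cball 0 1 \<inter> ?L)"
        then obtain x where x: "x \<in> ?L" "norm x \<le> 1" "(\<Sum>i<k. t i *\<^sub>R T (a i)) = T x"
          by auto
        then obtain s where s: "x = (\<Sum>i<k. s i *\<^sub>R a i)"
          using a(2) by (metis in_span_imageD)
        have "t i = s i" if "i < k" for i
          using x(3) that unfolding s linear_comb[OF T, symmetric] by (rule pvol_coeff_unique[OF nz])
        then have "(\<Sum>i<k. (t i)\<^sup>2) = (\<Sum>i<k. (s i)\<^sup>2)" by simp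
        then show "(\<Sum>i<k. (t i)\<^sup>2) \<le> 1"
          using x(2) by (simp add: s flip: sum_sq_le_1_iff[OF a(1)])
      qed
      then have "F (\<Sum>i<k. t i *\<^sub>R T (a i)) = indicator {x. x \<le> 1} (\<Sum>i<k. (t i)\<^sup>2)" for t
        by (simp add: F_def indicator_def)
      then show ?thesis by (simp add: emeasure_PL_ball)
    qed
    have J: "(\<integral>\<^sup>+c. F (\<Sum>i<k. c i *\<^sub>R gs_unit (\<lambda>i. T (a i)) i) \<partial>?M) = ennreal (pvol k (\<lambda>i. T (a i)) * unit_ball_vol k)"
      if a: "orthonormal_family k a" "span (a ` {..<k}) = ?L" and nz: "pvol k (\<lambda>i. T (a i)) \<noteq> 0" for a
      by (simp add: nn_integral_comb_gs[OF nz F] vol[OF that] ennreal_mult pvol_nonneg)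
    have "ennreal (pvol k (\<lambda>i. T (e i)) * unit_ball_vol k) = ennreal (pvol k (\<lambda>i. T (e' i)) * unit_ball_vol k)"
      unfolding J[OF e refl nz(1), symmetric] J[OF e' sp[symmetric] nz(2), symmetric]
      by (rule nn_integral_orthonormal_span[OF orthonormal_gs_unit[OF nz(1)] orthonormal_gs_unit[OF nz(2)] _ F])
        (simp add: span_gs_unit[OF nz(1) order_refl] span_gs_unit[OF nz(2) order_refl] spT)
    then show ?thesis
      using unit_ball_vol_pos[of "real k"] by (simp add: pvol_nonneg less_le)
  }
qed

text \<open>The chart in \<open>flat_volume\<close> is an arbitrary choice, so the value is
  accessible only if all admissible charts agree; that some chart is admissible makes the chosen one
  admissible.\<close>

lemma flat_volume_eqI:
  assumes "orthonormal_family k a0" "S \<subseteq> range (flat_chart k x0 a0)"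
    and "\<And>a b. orthonormal_family k b \<Longrightarrow> S \<subseteq> range (flat_chart k a b) \<Longrightarrow>
      measure (\<Pi>\<^sub>M i\<in>{..<k}. lborel)
        {c \<in> space (\<Pi>\<^sub>M i\<in>{..<k}. (lborel :: real measure)). flat_chart k a b c \<in> S} = m"
  shows "flat_volume k S = m"
proof -
  define P where "P = (\<lambda>(a, b). orthonormal_family k b \<and> S \<subseteq> range (flat_chart k a b))"
  have "P (x0, a0)" using assms(1,2) by (simp add: P_def)
  then have "P (Eps P)" by (rule someI)
  moreover obtain a b where ab: "Eps P = (a, b)" by fastforce
  ultimately have "orthonormal_family k b \<and> S \<subseteq> range (flat_chart k a b)"
    by (simp add: P_def)
  then show ?thesis
    using assms(3)[of b a] ab by (simp add: flat_volume_def P_def)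
qed

lemma range_flat_chart: "range (flat_chart k a b) = (+) a ` span (b ` {..<k})"
proof (intro subset_antisym subsetI)
  fix x assume "x \<in> range (flat_chart k a b)"
  then show "x \<in> (+) a ` span (b ` {..<k})"
    by (auto simp: flat_chart_def intro!: imageI span_sum span_scale intro: span_base)
next
  fix x assume "x \<in> (+) a ` span (b ` {..<k})"
  then obtain y where "x = a + y" "y \<in> span (b ` {..<k})" by auto
  then show "x \<in> range (flat_chart k a b)"
    by (elim in_span_imageD) (auto simp: flat_chart_def)
qed

lemma measurable_flat_chart [measurable]: "flat_chart k a b \<in> borel_measurable (Pi\<^sub>M {..<k} (\<lambda>_. lborel))"
  unfolding flat_chart_def by measurable

text \<open>As \<open>S\<close> contains \<open>x0\<close> and the points \<open>x0 + v i\<close>,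
  the direction space of any chart contains all \<open>v i\<close> and equals their span by
  dimension. Up to translation, charts then differ by an orthonormal change of basis of that
  span.\<close>

lemma flat_volume_span:
  fixes v :: "nat \<Rightarrow> 'a::euclidean_space"
  assumes nz: "pvol k v \<noteq> 0" and S [measurable]: "S \<in> sets borel"
    and x0: "x0 \<in> S" "\<And>i. i < k \<Longrightarrow> x0 + v i \<in> S" and sub: "S \<subseteq> (+) x0 ` span (v ` {..<k})"
  shows "flat_volume k S = pvol k v * enn2real (\<integral>\<^sup>+t. indicator S (x0 + (\<Sum>i<k. t i *\<^sub>R v i)) \<partial>Pi\<^sub>M {..<k} (\<lambda>_. lborel))"
proof (rule flat_volume_eqI)
  let ?M = "Pi\<^sub>M {..<k} (\<lambda>_. lborel :: real measure)"
  show "orthonormal_family k (gs_unit v)"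
    using nz by (rule orthonormal_gs_unit)
  show "S \<subseteq> range (flat_chart k x0 (gs_unit v))"
    using sub by (simp add: range_flat_chart span_gs_unit[OF nz])
  fix a b assume b: "orthonormal_family k b" and Sab: "S \<subseteq> range (flat_chart k a b)"
  obtain y where y: "x0 = a + y" "y \<in> span (b ` {..<k})"
    using x0(1) Sab unfolding range_flat_chart by auto
  obtain c0 where c0: "y = (\<Sum>i<k. c0 i *\<^sub>R b i)"
    using y(2) by (rule in_span_imageD)
  have "v i \<in> span (b ` {..<k})" if i: "i < k" for i
  proof -
    obtain z where z: "x0 + v i = a + z" "z \<in> span (b ` {..<k})"
      using x0(2)[OF i] Sab unfolding range_flat_chart by auto
    have "v i = z - y" using z(1) y(1) by (simp add: algebra_simps)
    then show ?thesis using z(2) y(2) by (simp add: span_diff)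
  qed
  then have "span (v ` {..<k}) \<subseteq> span (b ` {..<k})"
    by (intro span_minimal) auto
  then have sp: "span (v ` {..<k}) = span (b ` {..<k})"
    using pvol_nonzero_dim[OF nz] orthonormal_family_dim[OF b] by (intro subspace_dim_equal) auto
  have ind [measurable]: "(\<lambda>x. indicator S (x + x1) :: ennreal) \<in> borel_measurable borel" for x1
    by measurable
  have "emeasure ?M {c \<in> space ?M. flat_chart k a b c \<in> S} = (\<integral>\<^sup>+c. indicator {c \<in> space ?M. flat_chart k a b c \<in> S} c \<partial>?M)"
    by (rule nn_integral_indicator[symmetric]) measurable
  also have "\<dots> = (\<integral>\<^sup>+c. indicator S ((\<Sum>i<k. c i *\<^sub>R b i) + a) \<partial>?M)"
    by (intro nn_integral_cong) (simp add: indicator_def flat_chart_def add.commute)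
  also have "\<dots> = (\<integral>\<^sup>+c. indicator S ((\<Sum>i<k. (\<lambda>i\<in>{..<k}. c i + c0 i) i *\<^sub>R b i) + a) \<partial>?M)"
    by (rule nn_integral_PiM_translate[symmetric]) (simp_all, measurable)
  also have "\<dots> = (\<integral>\<^sup>+c. indicator S ((\<Sum>i<k. c i *\<^sub>R b i) + x0) \<partial>?M)"
    unfolding restrict_comb by (simp add: y(1) c0 scaleR_add_left sum.distrib add_ac)
  also have "\<dots> = (\<integral>\<^sup>+c. indicator S ((\<Sum>i<k. c i *\<^sub>R gs_unit v i) + x0) \<partial>?M)"
    by (rule nn_integral_orthonormal_span[OF b orthonormal_gs_unit[OF nz] _ ind]) (simp add: span_gs_unit[OF nz] sp)
  also have "\<dots> = ennreal (pvol k v) * (\<integral>\<^sup>+t. indicator S ((\<Sum>i<k. t i *\<^sub>R v i) + x0) \<partial>?M)"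
    by (rule nn_integral_comb_gs[OF nz ind])
  finally show "measure ?M {c \<in> space ?M. flat_chart k a b c \<in> S} =
      pvol k v * enn2real (\<integral>\<^sup>+t. indicator S (x0 + (\<Sum>i<k. t i *\<^sub>R v i)) \<partial>?M)"
    by (simp add: measure_def enn2real_mult pvol_nonneg add.commute)
qed

lemma null_hyperplane_PL:
  fixes j k :: nat
  assumes "j < k" "\<alpha> j \<noteq> 0"
  shows "emeasure (Pi\<^sub>M {..<k} (\<lambda>_. lborel)) {c \<in> space (Pi\<^sub>M {..<k} (\<lambda>_. lborel)). (\<Sum>i<k. c i * \<alpha> i) = (r::real)} = 0"
proof -
  let ?I = "{..<k} - {j}" and ?M = "\<lambda>I. Pi\<^sub>M I (\<lambda>_. lborel :: real measure)"
  have I: "{..<k} = insert j ?I" using assms(1) by auto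
  let ?f = "\<lambda>c. indicator {r} (\<Sum>i<k. c i * \<alpha> i) :: ennreal"
  have sm: "(\<lambda>c. \<Sum>i<k. c i * \<alpha> i) \<in> borel_measurable (?M {..<k})"
    by (intro borel_measurable_sum borel_measurable_times) auto
  have fm: "?f \<in> borel_measurable (?M {..<k})"
    by (rule measurable_compose[OF sm]) simp
  have "emeasure (?M {..<k}) {c \<in> space (?M {..<k}). (\<Sum>i<k. c i * \<alpha> i) = r}
    = (\<integral>\<^sup>+c. indicator {c \<in> space (?M {..<k}). (\<Sum>i<k. c i * \<alpha> i) = r} c \<partial>?M {..<k})"
    using sm by (intro nn_integral_indicator[symmetric]) measurable
  also have "\<dots> = (\<integral>\<^sup>+c. ?f c \<partial>?M {..<k})"
    by (intro nn_integral_cong) (simp add: indicator_def)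
  also have "\<dots> = (\<integral>\<^sup>+c. \<integral>\<^sup>+y. ?f (c(j := y)) \<partial>lborel \<partial>?M ?I)"
    by (rule lb.product_nn_integral_insert[of ?I j ?f, folded I]) (use fm in simp_all)
  also have "\<dots> = (\<integral>\<^sup>+c. 0 \<partial>?M ?I)"
  proof (rule nn_integral_cong)
    fix c :: "nat \<Rightarrow> real"
    have "(\<Sum>i<k. (c(j := y)) i * \<alpha> i) = y * \<alpha> j + (\<Sum>i\<in>?I. c i * \<alpha> i)" for y
      using assms(1) by (subst sum.remove[of _ j]) (auto intro!: sum.cong)
    then have "?f (c(j := y)) = indicator {(r - (\<Sum>i\<in>?I. c i * \<alpha> i)) / \<alpha> j} y" for y
      using assms(2) by (auto simp: indicator_def field_simps)
    then show "(\<integral>\<^sup>+y. ?f (c(j := y)) \<partial>lborel) = 0"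
      by simp
  qed
  finally show ?thesis by simp
qed

text \<open>Different flats of dimension \<open>k\<close> may contain \<open>S\<close>. In the
  coordinates of each of them \<open>S\<close> lies in an affine hyperplane, because the direction
  space is too large to be contained in \<open>W\<close>.\<close>

lemma flat_volume_degenerate:
  fixes S :: "'a::euclidean_space set"
  assumes W: "subspace W" "dim W < k" and k: "k \<le> DIM('a)" and sub: "S \<subseteq> (+) x0 ` W"
  shows "flat_volume k S = 0"
proof -
  obtain w where w: "orthonormal_family (dim W) w" "span (w ` {..<dim W}) = W"
    using W(1) by (rule subspace_orthonormal_family)
  have "dim W \<le> DIM('a)" by (rule dim_subset_UNIV)
  then obtain e where e: "orthonormal_family DIM('a) e" "\<forall>i<dim W. e i = w i"
    by (rule orthonormal_family_extend[OF w(1)])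
  have "w ` {..<dim W} \<subseteq> e ` {..<k}"
  proof (intro image_subsetI)
    fix j assume "j \<in> {..<dim W}"
    then have "w j = e j" "j \<in> {..<k}" using e(2) W(2) by auto
    then show "w j \<in> e ` {..<k}" by (rule image_eqI)
  qed
  then have "W \<subseteq> span (e ` {..<k})"
    using span_mono w(2) by blast
  then have ex: "orthonormal_family k e" "S \<subseteq> range (flat_chart k x0 e)"
    using orthonormal_family_mono[OF e(1) k] sub unfolding range_flat_chart by blast+
  show ?thesis
  proof (rule flat_volume_eqI[OF ex])
    let ?M = "Pi\<^sub>M {..<k} (\<lambda>_. lborel :: real measure)"
    fix a b assume b: "orthonormal_family k b" and Sab: "S \<subseteq> range (flat_chart k a b)"
    show "measure ?M {c \<in> space ?M. flat_chart k a b c \<in> S} = 0"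
    proof (cases "S = {}")
      case False
      then obtain s0 where s0: "s0 \<in> S" by auto
      have sW: "s - s0 \<in> W" if s: "s \<in> S" for s
      proof -
        obtain y z where "s = x0 + y" "s0 = x0 + z" "y \<in> W" "z \<in> W"
          using sub s s0 by blast
        then show ?thesis using W(1) by (simp add: subspace_diff)
      qed
      let ?L = "span (b ` {..<k})"
      have "\<not> ?L \<subseteq> W"
        using dim_subset[of ?L W] orthonormal_family_dim[OF b] W(2) by auto
      then obtain u where u: "u \<in> ?L" "u \<notin> W" by auto
      \<comment> \<open>A normal to \<open>W\<close> that is not orthogonal to the direction space
        \<open>?L\<close>; it supplies the equation of the hyperplane.\<close>
      define n where "n = u - orth_proj W u"
      have n: "n \<bullet> y = 0" if "y \<in> W" for y
        using orth_proj_orthogonal[OF W(1) that, of u] by (simp add: n_def)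
      have "n \<noteq> 0"
      proof
        assume "n = 0"
        then have "orth_proj W u = u" by (simp add: n_def)
        then show False using u(2) orth_proj_in[OF W(1), of u] by simp
      qed
      have "\<exists>j<k. b j \<bullet> n \<noteq> 0"
      proof (rule ccontr)
        assume "\<not> (\<exists>j<k. b j \<bullet> n \<noteq> 0)"
        then have "n \<bullet> y = 0" if "y \<in> b ` {..<k}" for y
          using that by (auto simp: inner_commute[of n])
        then have "n \<bullet> u = 0"
          using u(1) by (rule inner_span_eq_0)
        moreover have "n \<bullet> orth_proj W u = 0"
          by (rule n[OF orth_proj_in[OF W(1)]])
        ultimately have "n \<bullet> n = 0" by (simp add: n_def inner_diff_right)
        then show False using \<open>n \<noteq> 0\<close> by simp
      qed
      then obtain j where j: "j < k" "b j \<bullet> n \<noteq> 0" by auto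
      let ?H = "{c \<in> space ?M. (\<Sum>i<k. c i * (b i \<bullet> n)) = (s0 - a) \<bullet> n}"
      have sub': "{c \<in> space ?M. flat_chart k a b c \<in> S} \<subseteq> ?H"
      proof safe
        fix c assume "flat_chart k a b c \<in> S"
        then have "n \<bullet> (flat_chart k a b c - s0) = 0"
          by (intro n sW)
        then show "(\<Sum>i<k. c i * (b i \<bullet> n)) = (s0 - a) \<bullet> n"
          by (simp add: flat_chart_def inner_diff_right inner_add_right inner_sum_right inner_diff_left inner_commute)
      qed
      have sm: "(\<lambda>c. \<Sum>i<k. c i * (b i \<bullet> n)) \<in> borel_measurable ?M"
        by (intro borel_measurable_sum borel_measurable_times) auto
      have "emeasure ?M {c \<in> space ?M. flat_chart k a b c \<in> S} \<le> emeasure ?M ?H"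
        using sm by (intro emeasure_mono sub') measurable
      also have "\<dots> = 0"
        using j by (rule null_hyperplane_PL)
      finally show ?thesis by (simp add: measure_def)
    qed simp
  qed
qed

text \<open>With \<open>X k\<close> as origin, the hull is the standard simplex in coordinates along
  \<open>X i - X k\<close>, of volume \<open>1 / fact k\<close>. Affinely dependent points give 0 on
  both sides.\<close>

lemma flat_volume_convex_hull:
  fixes X :: "nat \<Rightarrow> 'a::euclidean_space"
  assumes k: "k \<le> DIM('a)"
  shows "flat_volume k (convex hull (X ` {0..k})) = pvol k (\<lambda>i. X i - X k) / fact k"
proof -
  define v where "v i = X i - X k" for i
  define D where "D = {X k + (\<Sum>i<k. t i *\<^sub>R v i) | t. (\<forall>i<k. 0 \<le> t i) \<and> (\<Sum>i<k. t i) \<le> 1}"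
  let ?S = "convex hull (X ` {0..k})" and ?M = "Pi\<^sub>M {..<k} (\<lambda>_. lborel :: real measure)"
  have "convex D"
  proof (rule convexI)
    fix x y and p q :: real assume xy: "x \<in> D" "y \<in> D" and pq: "0 \<le> p" "0 \<le> q" "p + q = 1"
    then obtain t s where t: "x = X k + (\<Sum>i<k. t i *\<^sub>R v i)" "\<forall>i<k. 0 \<le> t i" "(\<Sum>i<k. t i) \<le> 1"
      and s: "y = X k + (\<Sum>i<k. s i *\<^sub>R v i)" "\<forall>i<k. 0 \<le> s i" "(\<Sum>i<k. s i) \<le> 1"
      unfolding D_def by blast
    have "p *\<^sub>R x + q *\<^sub>R y = (p + q) *\<^sub>R X k + (\<Sum>i<k. (p * t i + q * s i) *\<^sub>R v i)"
      by (simp add: t(1) s(1) scaleR_add_left scaleR_add_right scaleR_sum_right sum.distrib)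
    moreover have "\<forall>i<k. 0 \<le> p * t i + q * s i"
      using t(2) s(2) pq by simp
    moreover have "(\<Sum>i<k. p * t i + q * s i) \<le> 1"
    proof -
      have "(\<Sum>i<k. p * t i + q * s i) = p * (\<Sum>i<k. t i) + q * (\<Sum>i<k. s i)"
        by (simp add: sum.distrib sum_distrib_left)
      also have "\<dots> \<le> p * 1 + q * 1"
        using t(3) s(3) pq by (intro add_mono mult_left_mono) auto
      finally show ?thesis using pq(3) by simp
    qed
    ultimately show "p *\<^sub>R x + q *\<^sub>R y \<in> D"
      unfolding D_def using pq(3) by auto
  qed
  moreover have "X ` {0..k} \<subseteq> D"
  proof (intro image_subsetI)
    fix i assume i: "i \<in> {0..k}"
    show "X i \<in> D"
    proof (cases "i = k")
      case True
      then show ?thesis unfolding D_def by (auto intro!: exI[of _ "\<lambda>_. 0"])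
    next
      case False
      then have "i < k" using i by auto
      then have "X i = X k + (\<Sum>j<k. (if j = i then 1 else 0) *\<^sub>R v j)"
        by (simp add: v_def if_distrib[of "\<lambda>a. a *\<^sub>R _"] cong: if_cong)
      then show ?thesis
        unfolding D_def using \<open>i < k\<close> by (intro CollectI exI[of _ "\<lambda>j. if j = i then 1 else 0"]) auto
    qed
  qed
  ultimately have SD: "?S \<subseteq> D"
    by (rule hull_minimal[rotated])
  have DS: "D \<subseteq> ?S"
  proof
    fix x assume "x \<in> D"
    then obtain t where t: "x = X k + (\<Sum>i<k. t i *\<^sub>R v i)" "\<forall>i<k. 0 \<le> t i" "(\<Sum>i<k. t i) \<le> 1"
      unfolding D_def by blast
    \<comment> \<open>Barycentric coordinates: the vertex \<open>X k\<close> takes the remaining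
      weight.\<close>
    let ?u = "\<lambda>i. if i < k then t i else 1 - (\<Sum>i<k. t i)"
    have "(\<Sum>i\<le>k. ?u i *\<^sub>R X i) \<in> ?S"
      using t(2,3) by (intro convex_sum) (auto simp: lessThan_Suc_atMost[symmetric] intro: hull_inc)
    also have "(\<Sum>i\<le>k. ?u i *\<^sub>R X i) = x"
      by (simp add: lessThan_Suc_atMost[symmetric] t(1) v_def algebra_simps sum_subtractf scaleR_sum_left)
    finally show "x \<in> ?S" .
  qed
  have sub: "?S \<subseteq> (+) (X k) ` span (v ` {..<k})"
    using SD by (auto simp: D_def intro!: imageI span_sum span_scale intro: span_base)
  show ?thesis
  proof (cases "pvol k v = 0")
    case True
    then have "flat_volume k ?S = 0"
      using pvol_zero_dim[OF True] k sub by (intro flat_volume_degenerate[of "span (v ` {..<k})"]) auto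
    then show ?thesis using True by (simp add: v_def[abs_def])
  next
    case False
    have S: "?S \<in> sets borel"
      by (intro borel_closed compact_imp_closed finite_imp_compact_convex_hull) auto
    have iff: "X k + (\<Sum>i<k. t i *\<^sub>R v i) \<in> ?S \<longleftrightarrow> (\<forall>i<k. 0 \<le> t i) \<and> (\<Sum>i<k. t i) \<le> 1" for t
    proof
      assume "X k + (\<Sum>i<k. t i *\<^sub>R v i) \<in> ?S"
      then obtain s where s: "(\<Sum>i<k. t i *\<^sub>R v i) = (\<Sum>i<k. s i *\<^sub>R v i)" "\<forall>i<k. 0 \<le> s i" "(\<Sum>i<k. s i) \<le> 1"
        using SD unfolding D_def by auto
      have "t i = s i" if "i < k" for i
        using False s(1) that by (rule pvol_coeff_unique)
      then show "(\<forall>i<k. 0 \<le> t i) \<and> (\<Sum>i<k. t i) \<le> 1" using s by simp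
    next
      assume "(\<forall>i<k. 0 \<le> t i) \<and> (\<Sum>i<k. t i) \<le> 1"
      then show "X k + (\<Sum>i<k. t i *\<^sub>R v i) \<in> ?S"
        using DS unfolding D_def by blast
    qed
    let ?A = "{x. (\<forall>i\<in>{..<k}. 0 \<le> x i) \<and> sum x {..<k} \<le> (1::real)} \<inter> space ?M"
    have "{x \<in> space ?M. (\<forall>i\<in>{..<k}. 0 \<le> x i) \<and> (\<Sum>i<k. x i) \<le> 1} \<in> sets ?M"
      by measurable
    then have A: "?A \<in> sets ?M" by (simp add: Int_def conj_commute)
    have "(\<integral>\<^sup>+t. indicator ?S (X k + (\<Sum>i<k. t i *\<^sub>R v i)) \<partial>?M) = (\<integral>\<^sup>+t. indicator ?A t \<partial>?M)"
      using iff by (intro nn_integral_cong) (auto simp: indicator_def)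
    also have "\<dots> = emeasure ?M ?A"
      using A by (rule nn_integral_indicator)
    also have "\<dots> = ennreal (1 / fact k)"
      using emeasure_std_simplex_aux[of "{..<k}" 1] by simp
    finally have "(\<integral>\<^sup>+t. indicator ?S (X k + (\<Sum>i<k. t i *\<^sub>R v i)) \<partial>?M) = ennreal (1 / fact k)" .
    moreover have "X k + v i \<in> ?S" if "i < k" for i
      using that by (auto simp: v_def intro: hull_inc)
    ultimately show ?thesis
      using flat_volume_span[OF False S _ _ sub] by (simp add: hull_inc v_def[abs_def])
  qed
qed

lemma norm_orth_proj_le:
  fixes L :: "'a::euclidean_space set"
  assumes "subspace L"
  shows "norm (orth_proj L x) \<le> norm x"
proof -
  have "orthogonal (orth_proj L x) (x - orth_proj L x)"
    using orth_proj_orthogonal[OF assms orth_proj_in[OF assms], of x] by (simp add: orthogonal_def inner_commute)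
  from norm_add_Pythagorean[OF this] have "(norm x)\<^sup>2 \<ge> (norm (orth_proj L x))\<^sup>2"
    by simp
  then show ?thesis by (rule power2_le_imp_le) simp
qed

text \<open>As \<open>T\<close> factors through the projection onto the span of \<open>e\<close>,
  and projections do not increase norms, the image of the ball is that of the unit ball of this
  span. The rank condition makes coordinates along \<open>T (e i)\<close> unique, so in them the
  image is again a unit ball.\<close>

lemma flat_volume_linear_image_ball:
  fixes T :: "'a::euclidean_space \<Rightarrow> 'b::euclidean_space"
  assumes T: "linear T" and e: "orthonormal_family k e"
    and TP: "\<And>x. T (orth_proj (span (e ` {..<k})) x) = T x" and rk: "dim (range T) = k"
  shows "flat_volume k ((\<lambda>x. c + T x) ` cball 0 1) = unit_ball_vol k * pvol k (\<lambda>i. T (e i))"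
    and "pvol k (\<lambda>i. T (e i)) \<noteq> 0"
proof -
  let ?L = "span (e ` {..<k})" and ?v = "\<lambda>i. T (e i)" and ?S = "(\<lambda>x. c + T x) ` cball 0 1"
  have sp: "span (?v ` {..<k}) = range T"
    using TP orth_proj_in[OF subspace_span, of "e ` {..<k}"]
    by (auto simp: span_linear_image_lessThan[OF T] image_iff) metis
  then show nz: "pvol k ?v \<noteq> 0"
    using rk by (simp add: pvol_nonzero_iff_dim)
  have S: "?S \<in> sets borel"
  proof -
    have "compact ((+) c ` T ` cball 0 1)"
      using T by (intro compact_translation compact_linear_image) auto
    then show ?thesis
      by (intro borel_closed compact_imp_closed) (simp add: image_image)
  qed
  have iff: "c + (\<Sum>i<k. t i *\<^sub>R ?v i) \<in> ?S \<longleftrightarrow> (\<Sum>i<k. (t i)\<^sup>2) \<le> 1" for t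
  proof
    assume "(\<Sum>i<k. (t i)\<^sup>2) \<le> 1"
    then show "c + (\<Sum>i<k. t i *\<^sub>R ?v i) \<in> ?S"
      unfolding linear_comb[OF T] sum_sq_le_1_iff[OF e] by auto
  next
    assume "c + (\<Sum>i<k. t i *\<^sub>R ?v i) \<in> ?S"
    then obtain x where x: "norm x \<le> 1" "(\<Sum>i<k. t i *\<^sub>R ?v i) = T (orth_proj ?L x)"
      by (auto simp: TP)
    obtain s where s: "orth_proj ?L x = (\<Sum>i<k. s i *\<^sub>R e i)"
      using orth_proj_in[OF subspace_span] by (rule in_span_imageD)
    have "t i = s i" if "i < k" for i
      using x(2) that unfolding s linear_comb[OF T, symmetric] by (rule pvol_coeff_unique[OF nz])
    then have "(\<Sum>i<k. (t i)\<^sup>2) = (\<Sum>i<k. (s i)\<^sup>2)" by simp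
    moreover have "(\<Sum>i<k. (s i)\<^sup>2) \<le> 1"
      unfolding sum_sq_le_1_iff[OF e] s[symmetric]
      using norm_orth_proj_le[OF subspace_span, of "e ` {..<k}" x] x(1) by simp
    ultimately show "(\<Sum>i<k. (t i)\<^sup>2) \<le> 1" by simp
  qed
  have "(\<integral>\<^sup>+t. indicator ?S (c + (\<Sum>i<k. t i *\<^sub>R ?v i)) \<partial>Pi\<^sub>M {..<k} (\<lambda>_. lborel))
    = (\<integral>\<^sup>+t. indicator {x::real. x \<le> 1} (\<Sum>i<k. (t i)\<^sup>2) \<partial>Pi\<^sub>M {..<k} (\<lambda>_. lborel))"
    by (intro nn_integral_cong) (simp only: indicator_def iff mem_Collect_eq)
  also have "\<dots> = ennreal (unit_ball_vol k)"
    by (rule emeasure_PL_ball)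
  finally have I: "(\<integral>\<^sup>+t. indicator ?S (c + (\<Sum>i<k. t i *\<^sub>R ?v i)) \<partial>Pi\<^sub>M {..<k} (\<lambda>_. lborel)) = ennreal (unit_ball_vol k)" .
  have "flat_volume k ?S = pvol k ?v * enn2real (ennreal (unit_ball_vol k))"
    unfolding I[symmetric]
  proof (rule flat_volume_span[OF nz S])
    show "c \<in> ?S" using linear_0[OF T] by (auto intro!: image_eqI[of _ _ 0])
    show "c + T (e i) \<in> ?S" if "i < k" for i
      using orthonormal_family_norm[OF e that] by auto
    show "?S \<subseteq> (+) c ` span (?v ` {..<k})"
      unfolding sp by auto
  qed
  then show "flat_volume k ?S = unit_ball_vol k * pvol k ?v"
    by simp
qed

section \<open>Gaussian moments of projected parallelotopes\<close>

lemma borel_measurable_gs: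
  assumes "\<And>j. j \<le> i \<Longrightarrow> (\<lambda>\<omega>. V \<omega> j :: 'a::euclidean_space) \<in> borel_measurable N"
  shows "(\<lambda>\<omega>. gs (V \<omega>) i) \<in> borel_measurable N"
  using assms
proof (induction i rule: less_induct)
  case (less i)
  have gm: "(\<lambda>\<omega>. gs (V \<omega>) j) \<in> borel_measurable N" if "j < i" for j
    using that less.prems by (intro less.IH) auto
  have vm: "(\<lambda>\<omega>. V \<omega> i) \<in> borel_measurable N"
    by (rule less.prems) simp
  show ?case
    by (subst gs.simps)
      (intro borel_measurable_diff borel_measurable_sum borel_measurable_scaleR borel_measurable_divide
        borel_measurable_inner vm gm; simp)
qed

lemma borel_measurable_pvol:
  assumes "\<And>j. j < k \<Longrightarrow> (\<lambda>\<omega>. V \<omega> j :: 'a::euclidean_space) \<in> borel_measurable N"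
  shows "(\<lambda>\<omega>. pvol k (V \<omega>)) \<in> borel_measurable N"
  unfolding pvol_def using assms
  by (intro borel_measurable_prod borel_measurable_norm[THEN measurable_compose[rotated]] borel_measurable_gs) auto

section \<open>Radial Gaussian integrals and Gamma functions\<close>

lemma nn_integral_powr_0:
  assumes "a > 0" "r \<ge> 0"
  shows "(\<integral>\<^sup>+t. ennreal (t powr (a - 1)) * indicator {0..r} t \<partial>lborel) = ennreal (r powr a / a)"
proof -
  have "((\<lambda>t. t powr (a - 1)) has_integral (r powr a / a)) {0..r}"
    using has_integral_powr_from_0[of "a - 1" r] assms by simp
  from nn_integral_has_integral_lebesgue[OF _ this] show ?thesis
    by (simp add: ennreal_mult' ennreal_indicator mult.commute)
qed

lemma nn_integral_Gamma:
  assumes "a > 0" "s > 0"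
  shows "(\<integral>\<^sup>+t. ennreal (exp (- (s * t)) * t powr (a - 1)) * indicator {0..} t \<partial>lborel) = ennreal (Gamma a / s powr a)"
proof -
  have "ennreal (Gamma a) = (\<integral>\<^sup>+t. ennreal (indicator {0..} t * t powr (a - 1) / exp t) \<partial>lborel)"
    using assms(1) by (rule Gamma_conv_nn_integral_real)
  also have "\<dots> = ennreal s * (\<integral>\<^sup>+t. ennreal (indicator {0..} (s * t) * (s * t) powr (a - 1) / exp (s * t)) \<partial>lborel)"
    using assms(2) by (subst nn_integral_lborel_affine[where c = s and t = 0]) simp_all
  also have "(\<lambda>t. ennreal (indicator {0..} (s * t) * (s * t) powr (a - 1) / exp (s * t)))
    = (\<lambda>t. ennreal (s powr (a - 1)) * (ennreal (exp (- (s * t)) * t powr (a - 1)) * indicator {0..} t))"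
    using assms(2) by (auto simp: fun_eq_iff indicator_def powr_mult exp_minus divide_simps
        zero_le_mult_iff simp flip: ennreal_mult)
  also have "(\<integral>\<^sup>+t. ennreal (s powr (a - 1)) * (ennreal (exp (- (s * t)) * t powr (a - 1)) * indicator {0..} t) \<partial>lborel)
    = ennreal (s powr (a - 1)) * (\<integral>\<^sup>+t. ennreal (exp (- (s * t)) * t powr (a - 1)) * indicator {0..} t \<partial>lborel)"
    by (rule nn_integral_cmult) measurable
  finally have "ennreal (Gamma a) = ennreal (s powr a) * (\<integral>\<^sup>+t. ennreal (exp (- (s * t)) * t powr (a - 1)) * indicator {0..} t \<partial>lborel)"
    using assms(2) by (simp add: powr_diff flip: ennreal_mult mult.assoc)
  then have "ennreal (1 / s powr a) * ennreal (Gamma a)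
    = (ennreal (1 / s powr a) * ennreal (s powr a)) * (\<integral>\<^sup>+t. ennreal (exp (- (s * t)) * t powr (a - 1)) * indicator {0..} t \<partial>lborel)"
    by (simp only: mult.assoc)
  then show ?thesis
    using assms by (simp add: Gamma_real_nonneg flip: ennreal_mult)
qed

text \<open>Only balls have to be measured: \<open>{..r}\<close> pulls back to the ball of radius
  \<open>sqrt r\<close>, of volume \<open>unit_ball_vol m * r powr (m / 2)\<close>, and the density
  is the derivative of this function of r.\<close>

lemma nn_integral_radial:
  fixes m :: nat
  assumes m: "m > 0" and F [measurable]: "F \<in> borel_measurable borel"
  shows "(\<integral>\<^sup>+c. F (\<Sum>i<m. (c i)\<^sup>2) \<partial>Pi\<^sub>M {..<m} (\<lambda>_. lborel :: real measure))
    = (\<integral>\<^sup>+r. F r * (ennreal (pi powr (m / 2) / Gamma (m / 2) * r powr (m / 2 - 1)) * indicator {0..} r) \<partial>lborel)"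
proof -
  let ?M = "Pi\<^sub>M {..<m} (\<lambda>_. lborel :: real measure)" and ?a = "real m / 2"
  define C where "C = pi powr ?a / Gamma ?a"
  define \<rho> where "\<rho> r = ennreal (C * r powr (?a - 1)) * indicator {0..} r" for r
  have C: "C > 0" using m by (simp add: C_def Gamma_real_pos)
  have [measurable]: "\<rho> \<in> borel_measurable borel"
    unfolding \<rho>_def by measurable
  have [measurable]: "(\<lambda>c. \<Sum>i<m. (c i)\<^sup>2) \<in> borel_measurable ?M"
    by (intro borel_measurable_sum borel_measurable_power) auto
  have I: "(\<integral>\<^sup>+t. \<rho> t * indicator {..r} t \<partial>lborel) = ennreal (unit_ball_vol m * r powr ?a)" if "r \<ge> 0" for r
  proof -
    have "(\<integral>\<^sup>+t. \<rho> t * indicator {..r} t \<partial>lborel) = (\<integral>\<^sup>+t. ennreal C * (ennreal (t powr (?a - 1)) * indicator {0..r} t) \<partial>lborel)"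
      using C by (intro nn_integral_cong) (auto simp: \<rho>_def indicator_def ennreal_mult)
    also have "\<dots> = ennreal C * ennreal (r powr ?a / ?a)"
      using m that by (subst nn_integral_cmult) (simp_all add: nn_integral_powr_0)
    also have "\<dots> = ennreal (unit_ball_vol m * r powr ?a)"
    proof -
      have G: "Gamma (?a + 1) = ?a * Gamma ?a"
        using m by (intro Gamma_plus1) (auto elim!: nonpos_Ints_cases)
      have "C * (r powr ?a / ?a) = unit_ball_vol m * r powr ?a"
        unfolding C_def unit_ball_vol_def G using m by (simp add: field_simps)
      then show ?thesis
        using m C by (simp flip: ennreal_mult)
    qed
    finally show ?thesis .
  qed
  have "distr ?M borel (\<lambda>c. \<Sum>i<m. (c i)\<^sup>2) = density lborel \<rho>" (is "?\<mu> = ?\<nu>")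
  proof (rule measure_eqI_generator_eq[where \<Omega> = UNIV and E = "range atMost" and A = "\<lambda>n. {..real n}"])
    show "Int_stable (range (atMost :: real \<Rightarrow> _))"
      by (auto simp: Int_stable_def)
    fix X :: "real set" assume "X \<in> range atMost"
    then obtain r where X: "X = {..r}" by auto
    have 1: "emeasure ?\<nu> X = (\<integral>\<^sup>+t. \<rho> t * indicator {..r} t \<partial>lborel)"
      by (simp add: X emeasure_density)
    have 2: "emeasure ?\<mu> X = emeasure ?M {c \<in> space ?M. (\<Sum>i<m. (c i)\<^sup>2) \<le> r}"
      unfolding X by (subst emeasure_distr) (auto intro!: arg_cong[where f = "emeasure ?M"])
    show "emeasure ?\<mu> X = emeasure ?\<nu> X"
    proof (cases "r > 0")
      case True
      have "{c \<in> space ?M. (\<Sum>i<m. (c i)\<^sup>2) \<le> r} = {f. sqrt (\<Sum>i<m. (f i)\<^sup>2) \<le> sqrt r} \<inter> space ?M"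
        by auto
      then have "emeasure ?\<mu> X = ennreal (unit_ball_vol m * sqrt r ^ m)"
        using emeasure_cball_aux[of "{..<m}" "sqrt r"] True unfolding 2 by simp
      also have "sqrt r ^ m = r powr ?a"
        using True by (simp add: powr_half_sqrt[symmetric] powr_powr flip: powr_realpow)
      finally show ?thesis using I[of r] True unfolding 1 by simp
    next
      \<comment> \<open>For r \<le> 0 the set lies in the null hyperplane \<open>c 0 = 0\<close>, a
        proper equation because \<open>m > 0\<close>.\<close>
      case False
      have "emeasure ?M {c \<in> space ?M. (\<Sum>i<m. (c i)\<^sup>2) \<le> r} \<le> emeasure ?M {c \<in> space ?M. (\<Sum>i<m. c i * (if i = 0 then 1 else 0)) = 0}"
      proof (rule emeasure_mono)
        have "c 0 = 0" if "(\<Sum>i<m. (c i)\<^sup>2) \<le> r" for c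
        proof -
          have "(c 0)\<^sup>2 \<le> (\<Sum>i<m. (c i)\<^sup>2)"
            using m by (intro member_le_sum) auto
          then have "(c 0)\<^sup>2 \<le> 0" using that False by linarith
          then show ?thesis by simp
        qed
        then show "{c \<in> space ?M. (\<Sum>i<m. (c i)\<^sup>2) \<le> r} \<subseteq> {c \<in> space ?M. (\<Sum>i<m. c i * (if i = 0 then 1 else 0)) = 0}"
          using m by (auto simp: if_distrib[of "\<lambda>a. _ * a"] cong: if_cong)
        have "(\<lambda>c. \<Sum>i<m. c i * (if i = 0 then 1 else 0)) \<in> borel_measurable ?M"
          by (intro borel_measurable_sum borel_measurable_times) auto
        then show "{c \<in> space ?M. (\<Sum>i<m. c i * (if i = 0 then 1 else 0)) = 0} \<in> sets ?M"
          by measurable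
      qed
      also have "\<dots> = 0"
        using m by (intro null_hyperplane_PL[of 0]) auto
      finally have "emeasure ?\<mu> X = 0" unfolding 2 by simp
      moreover have "emeasure ?\<nu> X \<le> (\<integral>\<^sup>+t. \<rho> t * indicator {..0} t \<partial>lborel)"
        unfolding 1 using False by (intro nn_integral_mono) (auto simp: indicator_def)
      ultimately show ?thesis using I[of 0] by simp
    qed
  next
    show "sets ?\<mu> = sigma_sets UNIV (range atMost)" "sets ?\<nu> = sigma_sets UNIV (range atMost)"
      by (simp_all add: borel_eq_atMost)
    show "(\<Union>n. {..real n}) = UNIV"
      by (auto simp: real_arch_simple)
    fix n
    have "emeasure ?\<mu> {..real n} \<le> emeasure ?M ({f. sqrt (\<Sum>i<m. (f i)\<^sup>2) \<le> sqrt (real n + 1)} \<inter> space ?M)"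
      by (subst emeasure_distr) (auto intro!: emeasure_mono)
    also have "\<dots> < \<infinity>"
      by (subst emeasure_cball_aux) auto
    finally show "emeasure ?\<mu> {..real n} \<noteq> \<infinity>" by simp
  qed auto
  then have "(\<integral>\<^sup>+r. F r \<partial>?\<mu>) = (\<integral>\<^sup>+r. F r \<partial>?\<nu>)" by simp
  then show ?thesis
    by (simp add: nn_integral_distr nn_integral_density mult.commute \<rho>_def C_def)
qed

text \<open>The Gaussian integral of \<open>exp (- |z|^2) * |P z|^p\<close> in dimension
  \<open>d\<close>, where \<open>P\<close> is the orthogonal projection onto a subspace of dimension
  \<open>l\<close>; see \<open>nn_integral_gauss_orth_proj\<close>.\<close>

definition gauss_moment :: "nat \<Rightarrow> nat \<Rightarrow> real \<Rightarrow> real"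
  where "gauss_moment d l p = pi powr (d / 2) * Gamma ((l + p) / 2) / Gamma (l / 2)"

lemma gauss_moment_pos: "l > 0 \<Longrightarrow> real l + p > 0 \<Longrightarrow> gauss_moment d l p > 0"
  by (simp add: gauss_moment_def Gamma_real_pos)

lemma nn_integral_PL_gauss_moment:
  assumes "m > 0" "real m + p > 0"
  shows "(\<integral>\<^sup>+c. ennreal (exp (- (\<Sum>i<m. (c i)\<^sup>2)) * sqrt (\<Sum>i<m. (c i)\<^sup>2) powr p) \<partial>Pi\<^sub>M {..<m} (\<lambda>_. lborel :: real measure))
    = ennreal (gauss_moment m m p)"
proof -
  define C where "C = pi powr (m / 2) / Gamma (m / 2)"
  have C: "C \<ge> 0" using assms(1) by (simp add: C_def Gamma_real_nonneg)
  have "(\<integral>\<^sup>+c. ennreal (exp (- (\<Sum>i<m. (c i)\<^sup>2)) * sqrt (\<Sum>i<m. (c i)\<^sup>2) powr p) \<partial>Pi\<^sub>M {..<m} (\<lambda>_. lborel :: real measure))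
    = (\<integral>\<^sup>+r. ennreal (exp (- r) * sqrt r powr p) * (ennreal (C * r powr (m / 2 - 1)) * indicator {0..} r) \<partial>lborel)"
    unfolding C_def using assms(1) by (rule nn_integral_radial) measurable
  also have "\<dots> = (\<integral>\<^sup>+r. ennreal C * (ennreal (exp (- (1 * r)) * r powr ((m + p) / 2 - 1)) * indicator {0..} r) \<partial>lborel)"
  proof (intro nn_integral_cong)
    fix r :: real
    show "ennreal (exp (- r) * sqrt r powr p) * (ennreal (C * r powr (m / 2 - 1)) * indicator {0..} r)
      = ennreal C * (ennreal (exp (- (1 * r)) * r powr ((m + p) / 2 - 1)) * indicator {0..} r)"
    proof (cases "r > 0")
      case True
      then have "sqrt r powr p * r powr (m / 2 - 1) = r powr ((m + p) / 2 - 1)"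
        by (simp add: powr_half_sqrt[symmetric] powr_powr add_divide_distrib flip: powr_add) (simp add: algebra_simps)
      then have "exp (- r) * sqrt r powr p * (C * r powr (m / 2 - 1)) = C * (exp (- (1 * r)) * r powr ((m + p) / 2 - 1))"
        by (simp add: mult_ac)
      then show ?thesis using True C by (simp flip: ennreal_mult)
    qed (auto simp: indicator_def)
  qed
  also have "\<dots> = ennreal C * ennreal (Gamma ((m + p) / 2))"
    using assms nn_integral_Gamma[of "(m + p) / 2" 1] by (subst nn_integral_cmult) simp_all
  also have "\<dots> = ennreal (gauss_moment m m p)"
    using C assms by (simp add: gauss_moment_def C_def Gamma_real_nonneg flip: ennreal_mult)
  finally show ?thesis .
qed

lemma nn_integral_gauss_real: "(\<integral>\<^sup>+x. ennreal (exp (- x\<^sup>2)) \<partial>lborel) = ennreal (pi powr (1 / 2))"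
proof -
  have "(\<integral>\<^sup>+c. ennreal (exp (- (c 0)\<^sup>2) * sqrt ((c 0)\<^sup>2) powr 0) \<partial>Pi\<^sub>M {0::nat} (\<lambda>_. lborel :: real measure)) = ennreal (pi powr (1 / 2))"
    using nn_integral_PL_gauss_moment[of 1 0] by (simp add: gauss_moment_def lessThan_Suc Gamma_one_half_real)
  moreover have "(\<integral>\<^sup>+c. ennreal (exp (- (c 0)\<^sup>2) * sqrt ((c 0)\<^sup>2) powr 0) \<partial>Pi\<^sub>M {0::nat} (\<lambda>_. lborel :: real measure))
    = (\<integral>\<^sup>+x. ennreal (exp (- x\<^sup>2) * sqrt (x\<^sup>2) powr 0) \<partial>lborel)"
    by (rule lb.product_nn_integral_singleton) measurable
  \<comment> \<open>As \<open>0 powr 0 = 0\<close>, the two integrands differ at the origin, a null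
    set.\<close>
  moreover have "\<dots> = (\<integral>\<^sup>+x. ennreal (exp (- x\<^sup>2)) \<partial>lborel)"
    by (intro nn_integral_cong_AE) (use AE_lborel_singleton[of "0::real"] in \<open>auto elim!: eventually_mono\<close>)
  ultimately show ?thesis by simp
qed

text \<open>In an orthonormal basis adapted to \<open>L\<close> the projection sees only the first
  \<open>dim L\<close> coordinates. Every other coordinate contributes a factor
  \<open>pi powr (1 / 2)\<close>, which raises the exponent of \<open>pi\<close> from
  \<open>dim L / 2\<close> to half the full dimension.\<close>

lemma nn_integral_gauss_orth_proj:
  fixes L :: "'a::euclidean_space set" and p :: real
  assumes L: "subspace L" "dim L > 0" and p: "dim L + p > 0"
  shows "(\<integral>\<^sup>+z. ennreal (exp (- (norm z)\<^sup>2) * norm (orth_proj L z) powr p) \<partial>lborel) = ennreal (gauss_moment DIM('a) (dim L) p)"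
proof -
  let ?d = "DIM('a)" and ?l = "dim L"
  have l: "?l \<le> ?d" by (rule dim_subset_UNIV)
  obtain b where b: "orthonormal_family ?l b" "span (b ` {..<?l}) = L"
    using L(1) by (rule subspace_orthonormal_family)
  obtain e where e: "orthonormal_family ?d e" "\<forall>i<?l. e i = b i"
    by (rule orthonormal_family_extend[OF b(1) l])
  have lin: "linear (orth_proj L)" using L(1) by (rule linear_orth_proj)
  note [measurable] = borel_measurable_linear[OF lin]
  have P: "orth_proj L x = (\<Sum>i<?l. (x \<bullet> b i) *\<^sub>R b i)" for x
    using orth_proj_orthonormal[OF b(1)] b(2) by simp
  have nP: "norm (orth_proj L (\<Sum>i<?d. c i *\<^sub>R e i)) = sqrt (\<Sum>i<?l. (c i)\<^sup>2)" for c
  proof -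
    have "orth_proj L (\<Sum>i<?d. c i *\<^sub>R e i) = (\<Sum>i<?l. c i *\<^sub>R b i)"
      unfolding P using e(2) l by (intro sum.cong refl) (auto simp: orthonormal_sum_inner[OF e(1)] simp flip: e(2)[rule_format])
    then show ?thesis
      using orthonormal_sum_norm[OF b(1), of c] by (metis norm_ge_zero real_sqrt_unique)
  qed
  have "(\<integral>\<^sup>+z. ennreal (exp (- (norm z)\<^sup>2) * norm (orth_proj L z) powr p) \<partial>lborel)
    = (\<integral>\<^sup>+c. ennreal (exp (- (\<Sum>i<?d. (c i)\<^sup>2)) * sqrt (\<Sum>i<?l. (c i)\<^sup>2) powr p) \<partial>Pi\<^sub>M {..<?d} (\<lambda>_. lborel))"
    by (subst nn_integral_orthonormal[OF e(1)]) (simp_all add: nP orthonormal_sum_norm[OF e(1)])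
  also have "\<dots> = (\<integral>\<^sup>+c. ennreal (exp (- (\<Sum>i<?l. (c i)\<^sup>2)) * sqrt (\<Sum>i<?l. (c i)\<^sup>2) powr p) \<partial>Pi\<^sub>M {..<?l} (\<lambda>_. lborel))
      * (\<Prod>i=?l..<?d. \<integral>\<^sup>+x. ennreal (exp (- x\<^sup>2)) \<partial>lborel)"
  proof (rule nn_integral_PL_split[OF l])
    show "(\<lambda>c. ennreal (exp (- (\<Sum>i<?d. (c i)\<^sup>2)) * sqrt (\<Sum>i<?l. (c i)\<^sup>2) powr p)) \<in> borel_measurable (Pi\<^sub>M {..<?d} (\<lambda>_. lborel))"
    proof -
      have "(\<lambda>c. \<Sum>i<n. (c i)\<^sup>2) \<in> borel_measurable (Pi\<^sub>M {..<?d} (\<lambda>_. lborel :: real measure))" if "n \<le> ?d" for n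
        using that by (intro borel_measurable_sum borel_measurable_power) auto
      from this[OF l] this[OF order_refl] show ?thesis by measurable
    qed
    show "(\<lambda>c. ennreal (exp (- (\<Sum>i<?l. (c i)\<^sup>2)) * sqrt (\<Sum>i<?l. (c i)\<^sup>2) powr p)) \<in> borel_measurable (Pi\<^sub>M {..<?l} (\<lambda>_. lborel))"
    proof -
      have [measurable]: "(\<lambda>c. \<Sum>i<?l. (c i)\<^sup>2) \<in> borel_measurable (Pi\<^sub>M {..<?l} (\<lambda>_. lborel :: real measure))"
        by (intro borel_measurable_sum borel_measurable_power) auto
      show ?thesis by measurable
    qed
    fix c :: "nat \<Rightarrow> real"
    have "{..<?d} = {..<?l} \<union> {?l..<?d}" using l by auto
    then have "(\<Sum>i<?d. (c i)\<^sup>2) = (\<Sum>i<?l. (c i)\<^sup>2) + (\<Sum>i=?l..<?d. (c i)\<^sup>2)"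
      by (simp add: sum.union_disjoint ivl_disj_int)
    then have "exp (- (\<Sum>i<?d. (c i)\<^sup>2)) = exp (- (\<Sum>i<?l. (c i)\<^sup>2)) * (\<Prod>i=?l..<?d. exp (- (c i)\<^sup>2))"
      by (simp add: exp_add exp_minus exp_sum divide_inverse prod_inversef flip: sum_negf)
    moreover have "(\<Sum>i<?l. (restrict c {..<?l} i)\<^sup>2) = (\<Sum>i<?l. (c i)\<^sup>2)"
      by (intro sum.cong) auto
    ultimately show "ennreal (exp (- (\<Sum>i<?d. (c i)\<^sup>2)) * sqrt (\<Sum>i<?l. (c i)\<^sup>2) powr p)
      = ennreal (exp (- (\<Sum>i<?l. (restrict c {..<?l} i)\<^sup>2)) * sqrt (\<Sum>i<?l. (restrict c {..<?l} i)\<^sup>2) powr p)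
        * (\<Prod>i=?l..<?d. ennreal (exp (- (c i)\<^sup>2)))"
      by (simp only:) (simp add: prod_ennreal prod_nonneg mult_ac flip: ennreal_mult)
  qed measurable
  also have "\<dots> = ennreal (gauss_moment ?d ?l p)"
  proof -
    have "pi powr (?l / 2) * (pi powr (1 / 2)) ^ (?d - ?l) = pi powr (?d / 2)"
      using l by (simp add: of_nat_diff powr_powr field_simps flip: powr_realpow powr_add)
    then have "gauss_moment ?l ?l p * (pi powr (1 / 2)) ^ (?d - ?l) = gauss_moment ?d ?l p"
      by (simp add: gauss_moment_def field_simps)
    moreover have "(\<Prod>i=?l..<?d. \<integral>\<^sup>+x. ennreal (exp (- x\<^sup>2)) \<partial>lborel) = ennreal ((pi powr (1 / 2)) ^ (?d - ?l))"
      by (simp add: nn_integral_gauss_real ennreal_power)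
    ultimately show ?thesis
      using L(2) p gauss_moment_pos[of ?l p ?l]
      by (simp add: nn_integral_PL_gauss_moment less_imp_le flip: ennreal_mult)
  qed
  finally show ?thesis .
qed

text \<open>For an invertible linear map this is the number \<open>C\<^sub>A\<close> of the
  overview. It is also evaluated at projections and at projections composed with \<open>A\<close>;
  values in \<open>ennreal\<close> leave finiteness as a separate question.\<close>

definition gauss_pvol :: "nat \<Rightarrow> ('a::euclidean_space \<Rightarrow> 'b::euclidean_space) \<Rightarrow> real \<Rightarrow> ennreal"
  where "gauss_pvol k T p = (\<integral>\<^sup>+W. (\<Prod>i<k. ennreal (exp (- (norm (W i))\<^sup>2))) * ennreal (pvol k (\<lambda>i. T (W i)) powr p)
    \<partial>Pi\<^sub>M {..<k} (\<lambda>_. lborel))"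

lemma measurable_gauss_weight:
  assumes "{..<k} \<subseteq> I"
  shows "(\<lambda>W. \<Prod>i<k. ennreal (exp (- (norm (W i :: 'a::euclidean_space))\<^sup>2))) \<in> borel_measurable (Pi\<^sub>M I (\<lambda>_. lborel))"
proof (intro borel_measurable_prod_ennreal)
  fix i assume "i \<in> {..<k}"
  then have [measurable]: "(\<lambda>W. W i) \<in> borel_measurable (Pi\<^sub>M I (\<lambda>_. lborel :: 'a measure))"
    using assms by (auto intro: measurable_component_singleton simp: measurable_lborel1[symmetric] simp del: measurable_lborel1)
  show "(\<lambda>W. ennreal (exp (- (norm (W i))\<^sup>2))) \<in> borel_measurable (Pi\<^sub>M I (\<lambda>_. lborel :: 'a measure))"
    by measurable
qed

lemma measurable_pvol_linear:
  fixes T :: "'a::euclidean_space \<Rightarrow> 'b::euclidean_space"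
  assumes "linear T"
  shows "(\<lambda>W. pvol k (\<lambda>i. T (W i))) \<in> borel_measurable (Pi\<^sub>M {..<k} (\<lambda>_. lborel))"
  by (intro borel_measurable_pvol measurable_compose[OF _ borel_measurable_linear[OF assms]]) auto

lemma pvol_fun_upd_Suc:
  fixes T :: "'a::euclidean_space \<Rightarrow> 'b::euclidean_space"
  shows "pvol (Suc k) (\<lambda>i. T ((W(k := y)) i)) = pvol k (\<lambda>i. T (W i)) * norm (gs ((\<lambda>i. T (W i))(k := T y)) k)"
proof -
  have "(\<lambda>i. T ((W(k := y)) i)) = (\<lambda>i. T (W i))(k := T y)" by auto
  moreover have "pvol k ((\<lambda>i. T (W i))(k := T y)) = pvol k (\<lambda>i. T (W i))"
    by (rule pvol_cong) simp
  ultimately show ?thesis by (simp add: pvol_Suc)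
qed

text \<open>Removing from \<open>y\<close> its part orthogonal to \<open>L\<close> and then its part
  along given vectors of \<open>L\<close> is a single projection, onto \<open>M\<close>. So the
  height of a projected vector over other projected vectors is again the norm of an orthogonal
  projection of the original vector.\<close>

lemma gs_orth_proj:
  fixes L :: "'a::euclidean_space set"
  assumes L: "subspace L" and u: "\<And>i. i < k \<Longrightarrow> u i \<in> L"
  defines "M \<equiv> {z \<in> L. \<forall>x\<in>span (u ` {..<k}). orthogonal x z}"
  shows "gs (u(k := orth_proj L y)) k = orth_proj M y" and "subspace M"
proof -
  let ?v = "u(k := orth_proj L y)"
  define r where "r = gs ?v k"
  show sM: "subspace M"
    using L unfolding M_def
    by (auto simp: subspace_def orthogonal_def inner_add_right)
  have im: "?v ` {..<k} = u ` {..<k}" by (intro image_cong) auto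
  have spL: "span (u ` {..<k}) \<subseteq> L"
    using u L by (intro span_minimal) auto
  have rp: "r \<bullet> w = 0" if "w \<in> span (u ` {..<k})" for w
    unfolding r_def using that im by (intro gs_perp) simp
  have d: "orth_proj L y - r \<in> span (u ` {..<k})"
    using diff_gs_in_span[of ?v k] unfolding im r_def by simp
  have "orth_proj L y - r \<in> L"
    using d spL by auto
  from subspace_diff[OF L orth_proj_in[OF L, of y] this] have rM: "r \<in> M"
    using rp by (auto simp: M_def orthogonal_def inner_commute)
  have "orth_proj M y = r"
  proof (rule orth_proj_unique[OF sM rM])
    fix z assume z: "z \<in> M"
    have "(y - orth_proj L y) \<bullet> z = 0"
      using z by (intro orth_proj_orthogonal[OF L]) (simp add: M_def)
    moreover have "(orth_proj L y - r) \<bullet> z = 0"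
      using z d by (auto simp: M_def orthogonal_def)
    ultimately show "orthogonal (y - r) z"
      by (simp add: orthogonal_def inner_diff_left)
  qed
  then show "gs ?v k = orth_proj M y" by (simp add: r_def)
qed

text \<open>The last vector is integrated out with the others fixed: its height is the norm of its
  projection onto the part of \<open>L\<close> orthogonal to them, of dimension
  \<open>dim L - k\<close> in the step to \<open>Suc k\<close>. This dimension is at least 1, so p >
  -1 gives convergence.\<close>

lemma gauss_pvol_orth_proj:
  fixes L :: "'a::euclidean_space set"
  assumes L: "subspace L" and k: "k \<le> dim L" and p: "p > -1"
  shows "gauss_pvol k (orth_proj L) p = ennreal (\<Prod>i<k. gauss_moment DIM('a) (dim L - i) p)"
  using k
proof (induction k)
  case 0
  then show ?case by (simp add: gauss_pvol_def PiM_empty)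
next
  case (Suc k)
  let ?P = "orth_proj L" and ?w = "\<lambda>k W. \<Prod>i<k. ennreal (exp (- (norm (W i :: 'a))\<^sup>2))"
    and ?g = "gauss_moment DIM('a) (dim L - k) p"
  have lin: "linear ?P" using L by (rule linear_orth_proj)
  note [measurable] = measurable_gauss_weight[OF order_refl] measurable_pvol_linear[OF lin]
  have g: "?g > 0" using Suc.prems p by (intro gauss_moment_pos) auto
  have "gauss_pvol (Suc k) ?P p = (\<integral>\<^sup>+W. \<integral>\<^sup>+y. ?w (Suc k) (W(k := y)) * ennreal (pvol (Suc k) (\<lambda>i. ?P ((W(k := y)) i)) powr p)
      \<partial>lborel \<partial>Pi\<^sub>M {..<k} (\<lambda>_. lborel))"
    unfolding gauss_pvol_def by (rule nn_integral_PL_Suc(1)) measurable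
  also have "\<dots> = (\<integral>\<^sup>+W. (?w k W * ennreal (pvol k (\<lambda>i. ?P (W i)) powr p)) * ennreal ?g \<partial>Pi\<^sub>M {..<k} (\<lambda>_. lborel))"
  proof (rule nn_integral_cong)
    fix W :: "nat \<Rightarrow> 'a"
    let ?u = "\<lambda>i. ?P (W i)"
    define M where "M = {z \<in> L. \<forall>x\<in>span (?u ` {..<k}). orthogonal x z}"
    have gsM: "gs (?u(k := ?P y)) k = orth_proj M y" for y
      unfolding M_def by (rule gs_orth_proj[OF L orth_proj_in[OF L]])
    have sM: "subspace M"
      unfolding M_def by (rule gs_orth_proj(2)[OF L orth_proj_in[OF L]])
    have [measurable]: "orth_proj M \<in> borel_measurable borel"
      by (rule borel_measurable_linear[OF linear_orth_proj[OF sM]])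
    have "(\<integral>\<^sup>+y. ?w (Suc k) (W(k := y)) * ennreal (pvol (Suc k) (\<lambda>i. ?P ((W(k := y)) i)) powr p) \<partial>lborel)
      = (\<integral>\<^sup>+y. (?w k W * ennreal (pvol k ?u powr p)) * ennreal (exp (- (norm y)\<^sup>2) * norm (orth_proj M y) powr p) \<partial>lborel)"
    proof (rule nn_integral_cong)
      fix y
      have "?w (Suc k) (W(k := y)) = ?w k W * ennreal (exp (- (norm y)\<^sup>2))"
        by simp
      then show "?w (Suc k) (W(k := y)) * ennreal (pvol (Suc k) (\<lambda>i. ?P ((W(k := y)) i)) powr p)
         = (?w k W * ennreal (pvol k ?u powr p)) * ennreal (exp (- (norm y)\<^sup>2) * norm (orth_proj M y) powr p)"
        by (simp only: pvol_fun_upd_Suc gsM powr_mult pvol_nonneg norm_ge_zero)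
          (simp add: ennreal_mult pvol_nonneg mult_ac)
    qed
    also have "\<dots> = (?w k W * ennreal (pvol k ?u powr p)) * (\<integral>\<^sup>+y. ennreal (exp (- (norm y)\<^sup>2) * norm (orth_proj M y) powr p) \<partial>lborel)"
      by (rule nn_integral_cmult) measurable
    also have "\<dots> = (?w k W * ennreal (pvol k ?u powr p)) * ennreal ?g"
    \<comment> \<open>If the first \<open>k\<close> projections are dependent, both sides are 0,
      because \<open>0 powr p = 0\<close> for negative \<open>p\<close> too.\<close>
    proof (cases "pvol k ?u = 0")
      case False
      have "span (?u ` {..<k}) \<subseteq> L"
        using orth_proj_in[OF L] L by (intro span_minimal) auto
      then have "dim M + dim (span (?u ` {..<k})) = dim L"
        unfolding M_def by (intro dim_subspace_orthogonal_to_vectors subspace_span L)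
      then have "dim M = dim L - k"
        using pvol_nonzero_dim[OF False] by simp
      then show ?thesis
        using nn_integral_gauss_orth_proj[OF sM, of p] Suc.prems p by simp
    qed simp
    finally show "(\<integral>\<^sup>+y. ?w (Suc k) (W(k := y)) * ennreal (pvol (Suc k) (\<lambda>i. ?P ((W(k := y)) i)) powr p) \<partial>lborel)
      = (?w k W * ennreal (pvol k ?u powr p)) * ennreal ?g" .
  qed
  also have "\<dots> = gauss_pvol k ?P p * ennreal ?g"
    unfolding gauss_pvol_def by (rule nn_integral_multc) measurable
  also have "\<dots> = ennreal (\<Prod>i<Suc k. gauss_moment DIM('a) (dim L - i) p)"
  proof -
    have "0 \<le> (\<Prod>i<k. gauss_moment DIM('a) (dim L - i) p)"
      using Suc.prems p by (intro prod_nonneg less_imp_le gauss_moment_pos) auto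
    then show ?thesis
      using Suc.IH Suc.prems g by (simp add: ennreal_mult less_imp_le)
  qed
  finally show ?case .
qed

text \<open>The vectors \<open>T (W i)\<close> depend only on the projections of the
  \<open>W i\<close>, and on the \<open>k\<close>-dimensional span of \<open>e\<close> the map
  \<open>T\<close> multiplies all volumes by the same constant.\<close>

lemma gauss_pvol_rank:
  fixes T :: "'a::euclidean_space \<Rightarrow> 'b::euclidean_space"
  assumes T: "linear T" and e: "orthonormal_family k e"
    and TP: "\<And>x. T (orth_proj (span (e ` {..<k})) x) = T x"
  shows "gauss_pvol k T p = ennreal (pvol k (\<lambda>i. T (e i)) powr p) * gauss_pvol k (orth_proj (span (e ` {..<k}))) p"
proof -
  let ?L = "span (e ` {..<k})"
  let ?P = "orth_proj ?L"
  have lin: "linear ?P" by (rule linear_orth_proj) simp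
  note [measurable] = measurable_gauss_weight[OF order_refl] measurable_pvol_linear[OF lin]
  have eq: "pvol k (\<lambda>i. T (W i)) = pvol k (\<lambda>i. T (e i)) * pvol k (\<lambda>i. ?P (W i))" for W
  proof (cases "pvol k (\<lambda>i. ?P (W i)) = 0")
    case True
    then show ?thesis
      using pvol_linear_image_zero[OF T True] by (simp add: TP)
  next
    case False
    let ?u = "gs_unit (\<lambda>i. ?P (W i))"
    have sp: "span (?u ` {..<k}) = span ((\<lambda>i. ?P (W i)) ` {..<k})"
      by (rule span_gs_unit[OF False order_refl])
    have "span ((\<lambda>i. ?P (W i)) ` {..<k}) \<subseteq> ?L"
      using orth_proj_in[OF subspace_span] by (intro span_minimal) auto
    then have "span (?u ` {..<k}) = ?L"
      unfolding sp using pvol_nonzero_dim[OF False] orthonormal_family_dim[OF e] by (intro subspace_dim_equal) auto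
    then have "pvol k (\<lambda>i. T (?u i)) = pvol k (\<lambda>i. T (e i))"
      by (intro pvol_image_orthonormal[OF T orthonormal_gs_unit[OF False] e])
    then show ?thesis
      using pvol_linear_image[OF T False] by (simp add: TP mult.commute)
  qed
  have "gauss_pvol k T p = (\<integral>\<^sup>+W. ennreal (pvol k (\<lambda>i. T (e i)) powr p) *
     ((\<Prod>i<k. ennreal (exp (- (norm (W i))\<^sup>2))) * ennreal (pvol k (\<lambda>i. ?P (W i)) powr p)) \<partial>Pi\<^sub>M {..<k} (\<lambda>_. lborel))"
    unfolding gauss_pvol_def
  proof (rule nn_integral_cong)
    fix W :: "nat \<Rightarrow> 'a"
    show "(\<Prod>i<k. ennreal (exp (- (norm (W i))\<^sup>2))) * ennreal (pvol k (\<lambda>i. T (W i)) powr p)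
      = ennreal (pvol k (\<lambda>i. T (e i)) powr p) *
        ((\<Prod>i<k. ennreal (exp (- (norm (W i))\<^sup>2))) * ennreal (pvol k (\<lambda>i. ?P (W i)) powr p))"
      unfolding eq[of W] by (simp add: powr_mult pvol_nonneg ennreal_mult mult_ac)
  qed
  also have "\<dots> = ennreal (pvol k (\<lambda>i. T (e i)) powr p) * gauss_pvol k ?P p"
    unfolding gauss_pvol_def by (rule nn_integral_cmult) measurable
  finally show ?thesis .
qed

section \<open>Rotation-invariant random subspaces\<close>

text \<open>If \<open>k\<close> is the full dimension, the two families determine the determinant of \<open>Q\<close>, hence the sign.\<close>

lemma rotation_between_orthonormal:
  fixes e0 e :: "nat \<Rightarrow> real ^ 'n"
  assumes e0: "orthonormal_family k e0" and e: "orthonormal_family k e"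
  obtains Q \<epsilon> where "rotation_matrix Q" "\<bar>\<epsilon>\<bar> = 1" "\<forall>i<k. Q *v e0 i = (e(0 := \<epsilon> *\<^sub>R e 0)) i"
proof -
  let ?d = "CARD('n)"
  obtain h where h: "bij_betw h (UNIV :: 'n set) {..<?d}"
    using ex_bij_betw_finite_nat[of "UNIV :: 'n set"] by (auto simp: atLeast0LessThan)
  \<comment> \<open>The matrix whose rows are the vectors of \<open>f\<close>, for an arbitrary
    enumeration of the index type.\<close>
  define R :: "(nat \<Rightarrow> real ^ 'n) \<Rightarrow> real ^ 'n ^ 'n" where "R f = (\<chi> j. f (h j))" for f
  have hd: "h j < ?d" for j using h by (auto simp: bij_betw_def)
  have orth: "orthogonal_matrix (transpose (R f))" if "orthonormal_family ?d f" for f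
  proof -
    have "(R f ** transpose (R f)) $ i $ j = (mat 1 :: real ^ 'n ^ 'n) $ i $ j" for i j
    proof -
      have "(R f ** transpose (R f)) $ i $ j = f (h i) \<bullet> f (h j)"
        by (simp add: R_def matrix_matrix_mult_def transpose_def inner_vec_def)
      moreover have "h i = h j \<longleftrightarrow> i = j"
        using h by (auto simp: bij_betw_def inj_on_def)
      ultimately show ?thesis
        using orthonormal_familyD[OF that hd hd] by (simp add: mat_def)
    qed
    then have "R f ** transpose (R f) = mat 1" by (simp add: vec_eq_iff)
    then show ?thesis by (simp add: orthogonal_matrix)
  qed
  have dR: "det (R f) = 1 \<or> det (R f) = -1" if "orthonormal_family ?d f" for f
    using det_orthogonal_matrix[OF orth[OF that]] by (simp add: det_transpose)
  have k: "k \<le> ?d"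
    using orthonormal_family_dim[OF e] dim_subset_UNIV[of "span (e ` {..<k})"] by simp
  then have k': "k \<le> DIM(real ^ 'n)" by simp
  obtain f0 where f0': "orthonormal_family DIM(real ^ 'n) f0" "\<forall>i<k. f0 i = e0 i"
    by (rule orthonormal_family_extend[OF e0 k'])
  obtain f where f': "orthonormal_family DIM(real ^ 'n) f" "\<forall>i<k. f i = e i"
    by (rule orthonormal_family_extend[OF e k'])
  have f0: "orthonormal_family ?d f0" and f: "orthonormal_family ?d f"
    using f0'(1) f'(1) by simp_all
  \<comment> \<open>With this sign \<open>det (R g) * det (R f0)\<close> is the square of
    \<epsilon>, hence 1.\<close>
  define \<epsilon> where "\<epsilon> = det (R f) * det (R f0)"
  define g where "g = f(0 := \<epsilon> *\<^sub>R f 0)"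
  have eps: "\<epsilon> = 1 \<or> \<epsilon> = -1" using dR[OF f] dR[OF f0] by (auto simp: \<epsilon>_def)
  have g: "orthonormal_family ?d g"
    using f eps by (auto simp: orthonormal_family_def g_def)
  have "0 \<in> {..<?d}" by simp
  then obtain j0 where j0: "h j0 = 0" using h by (metis bij_betw_def imageE)
  have hj: "h j = 0 \<longleftrightarrow> j = j0" for j
    using h j0 by (auto simp: bij_betw_def inj_on_def)
  have "R g = (\<chi> j. if j = j0 then \<epsilon> *s f (h j) else f (h j))"
    by (simp add: R_def g_def vec_eq_iff hj j0 scalar_mult_eq_scaleR)
  then have "det (R g) = \<epsilon> * det (\<chi> j. if j = j0 then f (h j) else f (h j))"
    by (simp only: det_row_mul)
  then have dg: "det (R g) = \<epsilon> * det (R f)"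
    by (simp add: R_def)
  \<comment> \<open>\<open>R f0\<close> sends \<open>f0 i\<close> to a standard unit vector, and
    \<open>transpose (R g)\<close> sends that vector to \<open>g i\<close>.\<close>
  define Q where "Q = transpose (R g) ** R f0"
  have "det Q = 1"
    using dR[OF f] dR[OF f0] by (auto simp: Q_def det_mul det_transpose dg \<epsilon>_def)
  moreover have "orthogonal_matrix Q"
    unfolding Q_def using orth[OF g] orth[OF f0] orthogonal_matrix_transpose[of "transpose (R f0)"]
    by (intro orthogonal_matrix_mul) simp_all
  ultimately have "rotation_matrix Q" by (simp add: rotation_matrix_def)
  moreover have "Q *v f0 i = g i" if "i < ?d" for i
  proof -
    have "i \<in> range h" using h that unfolding bij_betw_def by blast
    then obtain j where j: "h j = i" by blast
    have "R f0 *v f0 i = axis j 1"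
    proof -
      have "(R f0 *v f0 i) $ l = axis j 1 $ l" for l
      proof -
        have "(R f0 *v f0 i) $ l = f0 (h l) \<bullet> f0 i"
          by (simp add: R_def matrix_vector_mul_component)
        moreover have "h l = i \<longleftrightarrow> l = j"
          using h j by (auto simp: bij_betw_def inj_on_def)
        ultimately show ?thesis
          using orthonormal_familyD[OF f0 hd that] by (auto simp: axis_def)
      qed
      then show ?thesis by (simp add: vec_eq_iff)
    qed
    then have "Q *v f0 i = transpose (R g) *v axis j 1"
      by (simp add: Q_def flip: matrix_vector_mul_assoc)
    also have "\<dots> = g i"
    proof -
      have "(transpose (R g) *v axis j 1) $ l = g (h j) $ l" for l
        unfolding matrix_vector_mult_def transpose_def axis_def R_def
        by (simp add: if_distrib[of "\<lambda>a. _ * a"] cong: if_cong)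
      then show ?thesis by (simp add: vec_eq_iff j)
    qed
    finally show ?thesis .
  qed
  moreover have "f0 i = e0 i" "g i = (e(0 := \<epsilon> *\<^sub>R e 0)) i" if "i < k" for i
    using f0'(2) f'(2) that by (auto simp: g_def)
  ultimately have rot: "rotation_matrix Q" and Qf: "\<And>i. i < ?d \<Longrightarrow> Q *v f0 i = g i"
    and fg: "\<And>i. i < k \<Longrightarrow> f0 i = e0 i" "\<And>i. i < k \<Longrightarrow> g i = (e(0 := \<epsilon> *\<^sub>R e 0)) i"
    by blast+
  have "\<forall>i<k. Q *v e0 i = (e(0 := \<epsilon> *\<^sub>R e 0)) i"
  proof (intro allI impI)
    fix i assume i: "i < k"
    with k have "i < ?d" by simp
    from Qf[OF this] show "Q *v e0 i = (e(0 := \<epsilon> *\<^sub>R e 0)) i"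
      using i by (simp only: fg)
  qed
  with rot show ?thesis
    using eps by (intro that[of Q \<epsilon>]) (auto simp del: fun_upd_apply)
qed

section \<open>Isometries and measurability on the Grassmannian\<close>

lemma
  fixes L :: "'a::euclidean_space set"
  assumes T: "linear T" "\<And>x y. T x \<bullet> T y = x \<bullet> y" and L: "subspace L"
  shows orth_proj_isometry_image: "orth_proj (T ` L) (T x) = T (orth_proj L x)"
    and dim_isometry_image: "dim (T ` L) = dim L"
proof -
  show "orth_proj (T ` L) (T x) = T (orth_proj L x)"
  proof (rule orth_proj_unique)
    show "subspace (T ` L)" using T(1) L by (rule linear_subspace_image)
    show "T (orth_proj L x) \<in> T ` L" using orth_proj_in[OF L] by blast
    show "orthogonal (T x - T (orth_proj L x)) z" if "z \<in> T ` L" for z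
      using that orth_proj_orthogonal[OF L] by (auto simp: orthogonal_def T(2) simp flip: linear_diff[OF T(1)])
  qed
  have "inj T"
  proof (rule injI)
    fix x y assume "T x = T y"
    then have "(x - y) \<bullet> (x - y) = 0"
      using T(2)[of "x - y" "x - y"] by (simp add: linear_diff[OF T(1)])
    then show "x = y" by simp
  qed
  then show "dim (T ` L) = dim L"
    using T(1) by (intro dim_image_eq) (auto intro: inj_on_subset)
qed

lemma space_grassmannian [simp]: "space (grassmannian k) = {L. subspace L \<and> dim L = k}"
  by (simp add: grassmannian_def)

lemma measurable_matrix_orth_proj: "(\<lambda>L. matrix (orth_proj L)) \<in> borel_measurable (grassmannian k)"
  unfolding grassmannian_def by (rule measurable_vimage_algebra1) simp

lemma matrix_orth_proj_works:
  fixes L :: "(real ^ 'n) set"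
  assumes "subspace L"
  shows "matrix (orth_proj L) *v x = orth_proj L x"
  using linear_orth_proj[OF assms] by (simp add: matrix_works linear_matrix_vector_mul_eq)

lemma borel_measurable_matrix_vector:
  fixes M :: "'w \<Rightarrow> real ^ 'n ^ 'm"
  assumes [measurable]: "M \<in> borel_measurable N" "X \<in> borel_measurable N"
  shows "(\<lambda>\<omega>. M \<omega> *v X \<omega>) \<in> borel_measurable N"
proof -
  have "continuous_on UNIV (\<lambda>p :: (real ^ 'n ^ 'm) \<times> (real ^ 'n). fst p *v snd p)"
    unfolding matrix_vector_mult_def by (intro continuous_intros continuous_on_vec_lambda)
  then have mv: "(\<lambda>p :: (real ^ 'n ^ 'm) \<times> (real ^ 'n). fst p *v snd p) \<in> borel_measurable (borel \<Otimes>\<^sub>M borel)"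
    unfolding borel_prod by (rule borel_measurable_continuous_onI)
  have "(\<lambda>\<omega>. (M \<omega>, X \<omega>)) \<in> N \<rightarrow>\<^sub>M borel \<Otimes>\<^sub>M borel"
    by measurable
  from measurable_compose[OF this mv] show ?thesis by simp
qed

text \<open>The projection matrix is a measurable function of the subspace by the choice of the
  sigma-algebra, and the product of a matrix and a vector is jointly continuous.\<close>

lemma borel_measurable_orth_proj:
  fixes X :: "'w \<Rightarrow> real ^ 'n"
  assumes G: "G \<in> N \<rightarrow>\<^sub>M grassmannian k" and X: "X \<in> borel_measurable N"
  shows "(\<lambda>\<omega>. orth_proj (G \<omega>) (X \<omega>)) \<in> borel_measurable N"
proof -
  have "(\<lambda>\<omega>. matrix (orth_proj (G \<omega>)) *v X \<omega>) \<in> borel_measurable N"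
    by (intro borel_measurable_matrix_vector measurable_compose[OF G measurable_matrix_orth_proj] X)
  moreover have "matrix (orth_proj (G \<omega>)) *v X \<omega> = orth_proj (G \<omega>) (X \<omega>)" if "\<omega> \<in> space N" for \<omega>
    using measurable_space[OF G that] by (intro matrix_orth_proj_works) simp
  ultimately show ?thesis
    by (subst (asm) measurable_cong)
qed

text \<open>Measurability into the Grassmannian is tested on projection matrices, and the projection
  onto the rotated subspace has the matrix Q P Q^T, a continuous function of the matrix P of the
  projection onto \<open>L\<close>.\<close>

lemma
  fixes Q :: "real ^ 'n ^ 'n"
  assumes "rotation_matrix Q"
  shows rotation_matrix_inner: "(Q *v x) \<bullet> (Q *v y) = x \<bullet> y"
    and measurable_rotation_grassmannian: "(\<lambda>L. (\<lambda>x. Q *v x) ` L) \<in> grassmannian k \<rightarrow>\<^sub>M grassmannian k"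
proof -
  have Q: "orthogonal_matrix Q" using assms by (simp add: rotation_matrix_def)
  show inner: "(Q *v x) \<bullet> (Q *v y) = x \<bullet> y" for x y
  proof -
    have "orthogonal_transformation (\<lambda>x. Q *v x)"
      using Q by (simp add: orthogonal_transformation_matrix)
    then show ?thesis by (simp add: orthogonal_transformation_def)
  qed
  have lin: "linear (\<lambda>x. Q *v x)" by (rule matrix_vector_mul_linear)
  show "(\<lambda>L. (\<lambda>x. Q *v x) ` L) \<in> grassmannian k \<rightarrow>\<^sub>M grassmannian k"
    unfolding grassmannian_def[of k]
  proof (rule measurable_vimage_algebra2)
    show "(\<lambda>L. (*v) Q ` L) \<in> space (vimage_algebra {L. subspace L \<and> dim L = k} (\<lambda>L. matrix (orth_proj L)) borel)
        \<rightarrow> {L. subspace L \<and> dim L = k}"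
      using dim_isometry_image[OF lin inner] linear_subspace_image[OF lin] by auto
    have "(\<lambda>L. matrix (orth_proj ((*v) Q ` L))) \<in> borel_measurable (grassmannian k)"
    proof -
      have "matrix (orth_proj ((*v) Q ` L)) = Q ** matrix (orth_proj L) ** transpose Q" if "subspace L" for L
      proof -
        have "matrix (orth_proj ((*v) Q ` L)) *v y = (Q ** matrix (orth_proj L) ** transpose Q) *v y" for y
        proof -
          define x where "x = transpose Q *v y"
          have y: "y = Q *v x"
            using Q by (simp only: x_def matrix_vector_mul_assoc orthogonal_matrix_def matrix_vector_mul_lid)
          have "matrix (orth_proj ((*v) Q ` L)) *v y = orth_proj ((*v) Q ` L) (Q *v x)"
            unfolding y by (intro matrix_orth_proj_works linear_subspace_image lin that)
          also have "\<dots> = Q *v (orth_proj L x)"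
            by (rule orth_proj_isometry_image[OF lin inner that])
          also have "orth_proj L x = matrix (orth_proj L) *v x"
            by (rule matrix_orth_proj_works[OF that, symmetric])
          also have "Q *v (matrix (orth_proj L) *v x) = (Q ** matrix (orth_proj L) ** transpose Q) *v y"
            by (simp only: x_def matrix_vector_mul_assoc matrix_mul_assoc)
          finally show ?thesis .
        qed
        then show ?thesis by (simp add: matrix_eq)
      qed
      then have *: "matrix (orth_proj ((*v) Q ` L)) = Q ** matrix (orth_proj L) ** transpose Q" if "L \<in> space (grassmannian k)" for L
        using that by simp
      have "continuous_on UNIV (\<lambda>M :: real ^ 'n ^ 'n. Q ** M ** transpose Q)"
        unfolding matrix_matrix_mult_def by (intro continuous_intros continuous_on_vec_lambda)
      then have "(\<lambda>L. Q ** matrix (orth_proj L) ** transpose Q) \<in> borel_measurable (grassmannian k)"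
        by (intro measurable_compose[OF measurable_matrix_orth_proj borel_measurable_continuous_onI])
      then show ?thesis
        by (subst measurable_cong[OF *])
    qed
    then show "(\<lambda>L. matrix (orth_proj ((*v) Q ` L))) \<in> vimage_algebra {L. subspace L \<and> dim L = k} (\<lambda>L. matrix (orth_proj L)) borel \<rightarrow>\<^sub>M borel"
      by (simp add: grassmannian_def)
  qed
qed

text \<open>Rotating the subspace and the frame together changes no volume, and a rotation carries
  \<open>e0\<close> to \<open>e\<close> up to the sign of one vector, which the volume
  ignores.\<close>

lemma nn_integral_proj_orthonormal_invariant:
  fixes e0 e :: "nat \<Rightarrow> real ^ 'n"
  assumes \<nu>: "rotation_invariant_prob k \<nu>"
    and e0: "orthonormal_family k e0" and e: "orthonormal_family k e"
  shows "(\<integral>\<^sup>+L. ennreal (pvol k (\<lambda>i. orth_proj L (e i)) powr p) \<partial>\<nu>)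
    = (\<integral>\<^sup>+L. ennreal (pvol k (\<lambda>i. orth_proj L (e0 i)) powr p) \<partial>\<nu>)"
proof -
  have sets: "sets \<nu> = sets (grassmannian k)"
    and inv: "\<And>Q :: real ^ 'n ^ 'n. rotation_matrix Q \<Longrightarrow> distr \<nu> (grassmannian k) (\<lambda>L. (\<lambda>x. Q *v x) ` L) = \<nu>"
    using \<nu> by (auto simp: rotation_invariant_prob_def)
  have sp: "space \<nu> = {L. subspace L \<and> dim L = k}"
    using sets_eq_imp_space_eq[OF sets] by simp
  obtain Q \<epsilon> where Q: "rotation_matrix Q" "\<bar>\<epsilon>\<bar> = 1" "\<forall>i<k. Q *v e0 i = (e(0 := \<epsilon> *\<^sub>R e 0)) i"
    by (rule rotation_between_orthonormal[OF e0 e])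
  have lin: "linear (\<lambda>x. Q *v x)" by (rule matrix_vector_mul_linear)
  define \<phi> where "\<phi> L = ennreal (pvol k (\<lambda>i. orth_proj L (e i)) powr p)" for L
  have mphi: "\<phi> \<in> borel_measurable (grassmannian k)"
  proof -
    have "(\<lambda>L. pvol k (\<lambda>i. orth_proj L (e i))) \<in> borel_measurable (grassmannian k)"
      by (intro borel_measurable_pvol borel_measurable_orth_proj[where k = k]) auto
    then show ?thesis unfolding \<phi>_def by measurable
  qed
  have mQ: "(\<lambda>L. (\<lambda>x. Q *v x) ` L) \<in> \<nu> \<rightarrow>\<^sub>M grassmannian k"
    using measurable_rotation_grassmannian[OF Q(1), of k] sets by (simp cong: measurable_cong_sets)
  have "(\<integral>\<^sup>+L. \<phi> L \<partial>\<nu>) = (\<integral>\<^sup>+L. \<phi> L \<partial>distr \<nu> (grassmannian k) (\<lambda>L. (\<lambda>x. Q *v x) ` L))"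
    by (simp add: inv[OF Q(1)])
  also have "\<dots> = (\<integral>\<^sup>+L. \<phi> ((\<lambda>x. Q *v x) ` L) \<partial>\<nu>)"
    by (rule nn_integral_distr[OF mQ]) (simp add: mphi)
  also have "\<dots> = (\<integral>\<^sup>+L. ennreal (pvol k (\<lambda>i. orth_proj L (e0 i)) powr p) \<partial>\<nu>)"
  proof (rule nn_integral_cong)
    fix L assume "L \<in> space \<nu>"
    then have L: "subspace L" by (simp add: sp)
    let ?P = "orth_proj ((\<lambda>x. Q *v x) ` L)"
    have linP: "linear ?P"
      by (intro linear_orth_proj linear_subspace_image lin L)
    have "pvol k (\<lambda>i. ?P (Q *v e0 i)) = pvol k (\<lambda>i. Q *v (orth_proj L (e0 i)))"
      by (simp add: orth_proj_isometry_image[OF lin rotation_matrix_inner[OF Q(1)] L])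
    also have "\<dots> = pvol k (\<lambda>i. orth_proj L (e0 i))"
      by (rule pvol_isometry[OF lin rotation_matrix_inner[OF Q(1)]])
    finally have 1: "pvol k (\<lambda>i. ?P (Q *v e0 i)) = pvol k (\<lambda>i. orth_proj L (e0 i))" .
    have 2: "pvol k (\<lambda>i. ?P (Q *v e0 i)) = pvol k (\<lambda>i. ?P (e i))"
    proof (cases "k = 0")
      case False
      have "pvol k (\<lambda>i. ?P (Q *v e0 i)) = pvol k ((\<lambda>i. ?P (e i))(0 := \<epsilon> *\<^sub>R ?P (e 0) + 0))"
        using Q(3) by (intro pvol_cong) (auto simp: linear_scale[OF linP])
      also have "\<dots> = \<bar>\<epsilon>\<bar> * pvol k (\<lambda>i. ?P (e i))"
        using Q(2) False pvol_update_scale[of \<epsilon> 0 "\<lambda>i. ?P (e i)" 0 k] by (auto simp: span_zero)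
      finally show ?thesis using Q(2) by simp
    qed simp
    show "\<phi> ((\<lambda>x. Q *v x) ` L) = ennreal (pvol k (\<lambda>i. orth_proj L (e0 i)) powr p)"
      unfolding \<phi>_def 1[symmetric] 2 ..
  qed
  finally show ?thesis by (simp add: \<phi>_def)
qed

lemma measurable_gauss_pvol_orth_proj:
  fixes A :: "real ^ 'n \<Rightarrow> real ^ 'n"
  assumes A: "linear A" and sets: "sets \<nu> = sets (grassmannian k)" and "prob_space \<nu>"
  shows "(\<lambda>(L, W). (\<Prod>i<k. ennreal (exp (- (norm (W i))\<^sup>2))) * ennreal (pvol k (\<lambda>i. orth_proj L (A (W i))) powr p))
      \<in> borel_measurable (\<nu> \<Otimes>\<^sub>M Pi\<^sub>M {..<k} (\<lambda>_. lborel))" (is "case_prod ?f \<in> _")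
    and "(\<lambda>L. gauss_pvol k (\<lambda>x. orth_proj L (A x)) p) \<in> borel_measurable \<nu>"
proof -
  let ?M = "Pi\<^sub>M {..<k} (\<lambda>_. lborel :: (real ^ 'n) measure)"
  have fstm: "fst \<in> \<nu> \<Otimes>\<^sub>M ?M \<rightarrow>\<^sub>M grassmannian k"
    using measurable_fst[of \<nu> ?M] sets by (simp cong: measurable_cong_sets)
  have Wm: "(\<lambda>p. snd p i) \<in> borel_measurable (\<nu> \<Otimes>\<^sub>M ?M)" if "i < k" for i
    using that measurable_compose[OF measurable_snd measurable_component_singleton[of i "{..<k}" "\<lambda>_. lborel :: (real ^ 'n) measure"]]
    by simp
  have [measurable]: "(\<lambda>p. pvol k (\<lambda>i. orth_proj (fst p) (A (snd p i)))) \<in> borel_measurable (\<nu> \<Otimes>\<^sub>M ?M)"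
    by (intro borel_measurable_pvol borel_measurable_orth_proj[OF fstm] measurable_compose[OF Wm borel_measurable_linear[OF A]])
  have [measurable]: "(\<lambda>p. \<Prod>i<k. ennreal (exp (- (norm (snd p i))\<^sup>2))) \<in> borel_measurable (\<nu> \<Otimes>\<^sub>M ?M)"
    by (rule measurable_compose[OF measurable_snd measurable_gauss_weight]) simp
  show *: "case_prod ?f \<in> borel_measurable (\<nu> \<Otimes>\<^sub>M ?M)"
    unfolding case_prod_beta' by measurable
  show "(\<lambda>L. gauss_pvol k (\<lambda>x. orth_proj L (A x)) p) \<in> borel_measurable \<nu>"
    unfolding gauss_pvol_def
    by (rule sigma_finite_measure.borel_measurable_nn_integral[OF lb.sigma_finite]) (use * in simp_all)
qed

text \<open>
  Fubini: for fixed \<open>W\<close>, projecting the vectors \<open>A (W i)\<close> to \<open>L\<close> multiplies their volume by that of the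
  projection of an orthonormal basis of their span, whose mean over \<open>L\<close> does not depend on the span.
\<close>

lemma nn_integral_gauss_pvol_orth_proj:
  fixes A :: "real ^ 'n \<Rightarrow> real ^ 'n"
  assumes \<nu>: "rotation_invariant_prob k \<nu>" and e0: "orthonormal_family k e0" and A: "linear A"
  shows "(\<integral>\<^sup>+L. gauss_pvol k (\<lambda>x. orth_proj L (A x)) p \<partial>\<nu>)
    = (\<integral>\<^sup>+L. ennreal (pvol k (\<lambda>i. orth_proj L (e0 i)) powr p) \<partial>\<nu>) * gauss_pvol k A p"
proof -
  let ?M = "Pi\<^sub>M {..<k} (\<lambda>_. lborel :: (real ^ 'n) measure)" and ?w = "\<lambda>W. \<Prod>i<k. ennreal (exp (- (norm (W i :: real ^ 'n))\<^sup>2))"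
  define \<tau> where "\<tau> = (\<integral>\<^sup>+L. ennreal (pvol k (\<lambda>i. orth_proj L (e0 i)) powr p) \<partial>\<nu>)"
  have sets: "sets \<nu> = sets (grassmannian k)" and "prob_space \<nu>"
    using \<nu> by (auto simp: rotation_invariant_prob_def)
  have sp: "space \<nu> = {L. subspace L \<and> dim L = k}"
    using sets_eq_imp_space_eq[OF sets] by simp
  interpret prob_space \<nu> by fact
  interpret pair_sigma_finite \<nu> ?M
    by (intro pair_sigma_finite.intro lb.sigma_finite sigma_finite_measure_axioms) simp
  note [measurable] = measurable_gauss_weight[OF order_refl] measurable_pvol_linear[OF A]
  have "(\<integral>\<^sup>+L. gauss_pvol k (\<lambda>x. orth_proj L (A x)) p \<partial>\<nu>)
    = (\<integral>\<^sup>+W. \<integral>\<^sup>+L. ?w W * ennreal (pvol k (\<lambda>i. orth_proj L (A (W i))) powr p) \<partial>\<nu> \<partial>?M)"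
    unfolding gauss_pvol_def
    by (rule Fubini'[symmetric, OF measurable_gauss_pvol_orth_proj(1)[OF A sets \<open>prob_space \<nu>\<close>]])
  also have "\<dots> = (\<integral>\<^sup>+W. \<tau> * (?w W * ennreal (pvol k (\<lambda>i. A (W i)) powr p)) \<partial>?M)"
  proof (rule nn_integral_cong)
    fix W :: "nat \<Rightarrow> real ^ 'n"
    let ?u = "\<lambda>i. A (W i)"
    have idm: "(\<lambda>L. L) \<in> \<nu> \<rightarrow>\<^sub>M grassmannian k"
      using measurable_ident_sets[OF sets] by simp
    have [measurable]: "(\<lambda>L. pvol k (\<lambda>i. orth_proj L (u i))) \<in> borel_measurable \<nu>" for u :: "nat \<Rightarrow> real ^ 'n"
      by (intro borel_measurable_pvol borel_measurable_orth_proj[OF idm]) auto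
    have "(\<integral>\<^sup>+L. ?w W * ennreal (pvol k (\<lambda>i. orth_proj L (?u i)) powr p) \<partial>\<nu>)
       = ?w W * (\<integral>\<^sup>+L. ennreal (pvol k (\<lambda>i. orth_proj L (?u i)) powr p) \<partial>\<nu>)"
      by (rule nn_integral_cmult) measurable
    also have "(\<integral>\<^sup>+L. ennreal (pvol k (\<lambda>i. orth_proj L (?u i)) powr p) \<partial>\<nu>) = ennreal (pvol k ?u powr p) * \<tau>"
    proof (cases "pvol k ?u = 0")
      case True
      have "(\<integral>\<^sup>+L. ennreal (pvol k (\<lambda>i. orth_proj L (?u i)) powr p) \<partial>\<nu>) = (\<integral>\<^sup>+L. 0 \<partial>\<nu>)"
        by (intro nn_integral_cong) (simp add: sp pvol_linear_image_zero[OF linear_orth_proj True])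
      then show ?thesis using True by simp
    next
      case False
      let ?e = "gs_unit ?u"
      have "(\<integral>\<^sup>+L. ennreal (pvol k (\<lambda>i. orth_proj L (?u i)) powr p) \<partial>\<nu>)
        = (\<integral>\<^sup>+L. ennreal (pvol k ?u powr p) * ennreal (pvol k (\<lambda>i. orth_proj L (?e i)) powr p) \<partial>\<nu>)"
      proof (rule nn_integral_cong)
        fix L assume "L \<in> space \<nu>"
        then have "linear (orth_proj L)" by (intro linear_orth_proj) (simp add: sp)
        from pvol_linear_image[OF this False]
        show "ennreal (pvol k (\<lambda>i. orth_proj L (?u i)) powr p)
          = ennreal (pvol k ?u powr p) * ennreal (pvol k (\<lambda>i. orth_proj L (?e i)) powr p)"
          by (simp add: powr_mult pvol_nonneg flip: ennreal_mult)
      qed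
      also have "\<dots> = ennreal (pvol k ?u powr p) * (\<integral>\<^sup>+L. ennreal (pvol k (\<lambda>i. orth_proj L (?e i)) powr p) \<partial>\<nu>)"
        by (rule nn_integral_cmult) measurable
      also have "(\<integral>\<^sup>+L. ennreal (pvol k (\<lambda>i. orth_proj L (?e i)) powr p) \<partial>\<nu>) = \<tau>"
        unfolding \<tau>_def by (rule nn_integral_proj_orthonormal_invariant[OF \<nu> e0 orthonormal_gs_unit[OF False]])
      finally show ?thesis .
    qed
    finally show "(\<integral>\<^sup>+L. ?w W * ennreal (pvol k (\<lambda>i. orth_proj L (?u i)) powr p) \<partial>\<nu>)
       = \<tau> * (?w W * ennreal (pvol k ?u powr p))"
      by (simp add: mult_ac)
  qed
  also have "\<dots> = \<tau> * gauss_pvol k A p"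
    unfolding gauss_pvol_def by (rule nn_integral_cmult) measurable
  finally show ?thesis by (simp add: \<tau>_def)
qed

text \<open>Consider \<open>A\<close> followed by the projection to \<open>L\<close>. The projected
  ellipsoid has volume \<open>unit_ball_vol k\<close> times the distortion of this map on the
  orthogonal complement of its kernel. Its Gaussian integral is the p-th power of the same
  distortion times the integral for a projection of rank \<open>k\<close>. Eliminating the
  distortion gives the identity.\<close>

lemma flat_volume_projected_ball:
  fixes A :: "'a::euclidean_space \<Rightarrow> 'a"
  assumes A: "linear A" "surj A" and L: "subspace L" "dim L = k" and p: "p > -1"
  shows "ennreal (flat_volume k (orth_proj L ` ((\<lambda>x. c + A x) ` cball 0 1)) powr p) * ennreal (\<Prod>i<k. gauss_moment DIM('a) (k - i) p)
    = ennreal (unit_ball_vol k powr p) * gauss_pvol k (\<lambda>x. orth_proj L (A x)) p"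
proof -
  let ?P = "orth_proj L" and ?T = "\<lambda>x. orth_proj L (A x)"
  have linP: "linear ?P" using L(1) by (rule linear_orth_proj)
  have linT: "linear ?T" using linear_compose[OF A(1) linP] by (simp add: o_def)
  obtain b where b: "orthonormal_family k b" "span (b ` {..<k}) = L"
    using subspace_orthonormal_family[OF L(1)] L(2) by auto
  \<comment> \<open>The coordinates of \<open>orth_proj L (A x)\<close> are
    \<open>x \<bullet> w i\<close>, so the \<open>w i\<close> span the orthogonal complement of the
    kernel; \<open>e\<close> is an orthonormal basis of it.\<close>
  define w where "w i = adjoint A (b i)" for i
  have adj: "linear (adjoint A)" using A(1) by (rule adjoint_linear)
  have "inj (adjoint A)"
  proof (rule linear_injective_0[THEN iffD2, OF adj], intro allI impI)
    fix y assume y: "adjoint A y = 0"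
    obtain x where "y = A x" using A(2) by (metis surjD)
    then have "y \<bullet> y = x \<bullet> adjoint A y" by (simp add: adjoint_works[OF A(1)])
    then show "y = 0" using y by simp
  qed
  then have "dim (adjoint A ` L) = k"
    using dim_image_eq[OF adj, of L] L by (simp add: inj_on_subset)
  moreover have "span (w ` {..<k}) = adjoint A ` L"
    using span_linear_image_lessThan[OF adj, of b "{..<k}"] b(2) by (simp add: w_def)
  ultimately have nz: "pvol k w \<noteq> 0" by (simp add: pvol_nonzero_iff_dim)
  define e where "e = gs_unit w"
  have e: "orthonormal_family k e" unfolding e_def using nz by (rule orthonormal_gs_unit)
  have spe: "span (e ` {..<k}) = span (w ` {..<k})" unfolding e_def by (rule span_gs_unit[OF nz order_refl])
  have T: "?T x = (\<Sum>i<k. (x \<bullet> w i) *\<^sub>R b i)" for x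
    using orth_proj_orthonormal[OF b(1), of "A x"] b(2) by (simp add: w_def adjoint_works[OF A(1)])
  have TP: "?T (orth_proj (span (e ` {..<k})) x) = ?T x" for x
    unfolding T spe by (intro sum.cong refl) (simp add: orth_proj_inner span_base)
  have "range ?T = ?P ` range A" by auto
  also have "\<dots> = L"
    using A(2) orth_proj_in[OF L(1)] orth_proj_id[OF L(1)] by (auto simp: image_iff) metis
  finally have rk: "dim (range ?T) = k" using L(2) by simp
  have img: "orth_proj L ` ((\<lambda>x. c + A x) ` cball 0 1) = (\<lambda>x. ?P c + ?T x) ` cball 0 1"
    by (simp add: image_image linear_add[OF linP])
  have fv: "flat_volume k (orth_proj L ` ((\<lambda>x. c + A x) ` cball 0 1)) = unit_ball_vol k * pvol k (\<lambda>i. ?T (e i))"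
    unfolding img by (rule flat_volume_linear_image_ball(1)[OF linT e TP rk])
  have de: "dim (span (e ` {..<k})) = k" by (rule orthonormal_family_dim[OF e])
  have "gauss_pvol k ?T p = ennreal (pvol k (\<lambda>i. ?T (e i)) powr p) * gauss_pvol k (orth_proj (span (e ` {..<k}))) p"
    by (rule gauss_pvol_rank[OF linT e TP])
  also have "gauss_pvol k (orth_proj (span (e ` {..<k}))) p = ennreal (\<Prod>i<k. gauss_moment DIM('a) (k - i) p)"
    using gauss_pvol_orth_proj[OF subspace_span, of k "e ` {..<k}" p] p de by (simp only: order_refl)
  finally show ?thesis
    by (simp add: fv powr_mult pvol_nonneg ennreal_mult mult_ac)
qed

lemma gauss_moment_prod_pos:
  assumes "k \<le> l" "p > -1"
  shows "(\<Prod>i<k. gauss_moment d (l - i) p) > 0"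
  using assms by (intro prod_pos gauss_moment_pos) auto

text \<open>Averaging the identity for a fixed subspace gives: mean of \<open>f\<close> times
  \<open>c1\<close> equals \<open>unit_ball_vol k powr p\<close> times \<tau> times the Gaussian
  integral of \<open>A\<close>, where \<tau> is the p-th moment of the volume of a projected
  orthonormal frame. The identity map in place of \<open>A\<close> gives \<open>c1\<close> = \<tau>
  \<open>c2\<close>, with \<open>c1\<close> from projections of rank \<open>k\<close> and
  \<open>c2\<close> from the full space. As both are positive and finite, so is \<tau>, and it
  cancels.\<close>

lemma projected_ellipsoid_moment:
  fixes A :: "real ^ 'n \<Rightarrow> real ^ 'n" and c :: "real ^ 'n"
  assumes \<nu>: "rotation_invariant_prob k \<nu>" and A: "linear A" "surj A" and k: "k \<le> CARD('n)" and p: "p > -1"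
  defines "f \<equiv> \<lambda>L. ennreal (flat_volume k (orth_proj L ` ((\<lambda>x. c + A x) ` cball 0 1)) powr p)"
  shows "(\<integral>\<^sup>+L. f L \<partial>\<nu>) * ennreal (\<Prod>i<k. gauss_moment CARD('n) (CARD('n) - i) p)
      = ennreal (unit_ball_vol k powr p) * gauss_pvol k A p"
    and "f \<in> borel_measurable \<nu>"
proof -
  define c1 where "c1 = (\<Prod>i<k. gauss_moment CARD('n) (k - i) p)"
  define c2 where "c2 = (\<Prod>i<k. gauss_moment CARD('n) (CARD('n) - i) p)"
  have c1: "c1 > 0" and c2: "c2 > 0"
    unfolding c1_def c2_def using k p by (auto intro: gauss_moment_prod_pos)
  have sets: "sets \<nu> = sets (grassmannian k)" and ps: "prob_space \<nu>"
    using \<nu> by (auto simp: rotation_invariant_prob_def)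
  interpret prob_space \<nu> by (rule ps)
  have sp: "space \<nu> = {L. subspace L \<and> dim L = k}"
    using sets_eq_imp_space_eq[OF sets] by simp
  have k': "k \<le> DIM(real ^ 'n)" using k by simp
  have "orthonormal_family 0 (\<lambda>_. 0 :: real ^ 'n)" by (simp add: orthonormal_family_def)
  then obtain e0 :: "nat \<Rightarrow> real ^ 'n" where "orthonormal_family DIM(real ^ 'n) e0"
    by (rule orthonormal_family_extend) simp
  then have e0: "orthonormal_family k e0" using k' by (rule orthonormal_family_mono)
  define \<tau> where "\<tau> = (\<integral>\<^sup>+L. ennreal (pvol k (\<lambda>i. orth_proj L (e0 i)) powr p) \<partial>\<nu>)"
  note dual = nn_integral_gauss_pvol_orth_proj[OF \<nu> e0, of _ p, folded \<tau>_def]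
  have "(\<integral>\<^sup>+L. gauss_pvol k (orth_proj L) p \<partial>\<nu>) = (\<integral>\<^sup>+L. ennreal c1 \<partial>\<nu>)"
    using p by (intro nn_integral_cong) (auto simp: sp gauss_pvol_orth_proj c1_def)
  then have "ennreal c1 = (\<integral>\<^sup>+L. gauss_pvol k (orth_proj L) p \<partial>\<nu>)"
    by (simp add: emeasure_space_1)
  also have "\<dots> = \<tau> * gauss_pvol k (\<lambda>x :: real ^ 'n. x) p"
    using dual[OF linear_ident] by simp
  \<comment> \<open>The identity is viewed as the projection onto the whole space, whose Gaussian
    integral is known.\<close>
  also have "(\<lambda>x :: real ^ 'n. x) = orth_proj UNIV"
    by (rule ext) (simp add: orth_proj_id)
  also have "gauss_pvol k (orth_proj (UNIV :: (real ^ 'n) set)) p = ennreal c2"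
    using gauss_pvol_orth_proj[of "UNIV :: (real ^ 'n) set" k p] k p by (simp add: c2_def)
  finally have tau: "ennreal c1 = \<tau> * ennreal c2" .
  have tau0: "\<tau> \<noteq> 0" "\<tau> \<noteq> top"
    using tau c1 c2 by (auto simp: ennreal_top_mult)
  have ptw: "f L * ennreal c1 = ennreal (unit_ball_vol k powr p) * gauss_pvol k (\<lambda>x. orth_proj L (A x)) p"
    if "L \<in> space \<nu>" for L
    using flat_volume_projected_ball[OF A, of L k p c] that p by (simp add: f_def sp c1_def)
  have [measurable]: "(\<lambda>L. gauss_pvol k (\<lambda>x. orth_proj L (A x)) p) \<in> borel_measurable \<nu>"
    by (rule measurable_gauss_pvol_orth_proj(2)[OF A(1) sets ps])
  have f_eq: "f L = ennreal (1 / c1) * (ennreal (unit_ball_vol k powr p) * gauss_pvol k (\<lambda>x. orth_proj L (A x)) p)"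
    if "L \<in> space \<nu>" for L
  proof -
    have "ennreal (1 / c1) * (f L * ennreal c1) = f L * (ennreal (1 / c1) * ennreal c1)"
      by (simp add: mult_ac)
    also have "ennreal (1 / c1) * ennreal c1 = 1"
      using c1 by (simp flip: ennreal_mult)
    finally show ?thesis using ptw[OF that] by simp
  qed
  show "f \<in> borel_measurable \<nu>"
    by (subst measurable_cong[OF f_eq]) measurable
  have "(\<integral>\<^sup>+L. f L \<partial>\<nu>) * ennreal c1 = (\<integral>\<^sup>+L. f L * ennreal c1 \<partial>\<nu>)"
    using \<open>f \<in> borel_measurable \<nu>\<close> by (rule nn_integral_multc[symmetric])
  also have "\<dots> = (\<integral>\<^sup>+L. ennreal (unit_ball_vol k powr p) * gauss_pvol k (\<lambda>x. orth_proj L (A x)) p \<partial>\<nu>)"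
    by (intro nn_integral_cong ptw)
  also have "\<dots> = ennreal (unit_ball_vol k powr p) * (\<tau> * gauss_pvol k A p)"
    by (subst nn_integral_cmult) (simp_all add: dual[OF A(1)])
  finally have "\<tau> * ((\<integral>\<^sup>+L. f L \<partial>\<nu>) * ennreal c2) = \<tau> * (ennreal (unit_ball_vol k powr p) * gauss_pvol k A p)"
    unfolding tau by (simp add: mult_ac)
  then show "(\<integral>\<^sup>+L. f L \<partial>\<nu>) * ennreal (\<Prod>i<k. gauss_moment CARD('n) (CARD('n) - i) p)
      = ennreal (unit_ball_vol k powr p) * gauss_pvol k A p"
    using tau0 by (simp only: ennreal_mult_cancel_left c2_def) auto
qed

section \<open>Uniqueness of Laplace transforms\<close>

lemma laplace_integrable:
  fixes M :: "real measure"
  assumes M: "sets M = sets borel" and fin: "(\<integral>\<^sup>+x. ennreal (exp (- (s * x))) \<partial>M) < \<infinity>"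
  shows "integrable M (\<lambda>x. exp (- (s * x)))"
proof (rule integrableI_nonneg)
  have "(\<lambda>x :: real. exp (- (s * x))) \<in> borel_measurable borel" by measurable
  then show "(\<lambda>x. exp (- (s * x))) \<in> borel_measurable M"
    using M by (simp cong: measurable_cong_sets)
qed (use fin in auto)

text \<open>
  The Laplace transform at the positive integers gives the integrals of polynomials in \<open>exp (- x)\<close> against
  the finite measures with densities \<open>exp (- x)\<close>; continuous functions follow by Weierstrass approximation.
\<close>

lemma laplace_uniqueness:
  fixes M N :: "real measure"
  assumes sets: "sets M = sets borel" "sets N = sets borel"
    and nonneg: "AE x in M. 0 \<le> x" "AE x in N. 0 \<le> x"
    and eq: "\<And>s. s > 0 \<Longrightarrow> (\<integral>\<^sup>+x. ennreal (exp (- (s * x))) \<partial>M) = (\<integral>\<^sup>+x. ennreal (exp (- (s * x))) \<partial>N)"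
    and fin: "\<And>s. s > 0 \<Longrightarrow> (\<integral>\<^sup>+x. ennreal (exp (- (s * x))) \<partial>M) < \<infinity>"
  shows "(\<integral>\<^sup>+x. indicator {..1} x \<partial>M) = (\<integral>\<^sup>+x. indicator {..1} x \<partial>N)"
    and "(\<integral>\<^sup>+x. indicator {..1} x \<partial>M) < \<infinity>"
proof -
  have fin': "s > 0 \<Longrightarrow> (\<integral>\<^sup>+x. ennreal (exp (- (s * x))) \<partial>N) < \<infinity>" for s
    using eq fin by simp
  note int = laplace_integrable[OF sets(1) fin] laplace_integrable[OF sets(2) fin']
  have lap: "(\<integral>x. exp (- (s * x)) \<partial>M) = (\<integral>x. exp (- (s * x)) \<partial>N)" if "s > 0" for s
    using eq[OF that] int[OF that] by (simp add: nn_integral_eq_integral)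
  have poly: "(\<integral>x. exp (- x) * (\<Sum>i\<le>n. a i * exp (- x) ^ i) \<partial>M) = (\<integral>x. exp (- x) * (\<Sum>i\<le>n. a i * exp (- x) ^ i) \<partial>N)"
    "integrable M (\<lambda>x. exp (- x) * (\<Sum>i\<le>n. a i * exp (- x) ^ i))"
    "integrable N (\<lambda>x. exp (- x) * (\<Sum>i\<le>n. a i * exp (- x) ^ i))" for a :: "nat \<Rightarrow> real" and n
  proof -
    \<comment> \<open>The extra factor \<open>exp (- x)\<close> moves the exponents to 1, 2, ..., so
      that the constant term falls under \<open>s > 0\<close> as well; the measures themselves may
      be infinite.\<close>
    have *: "(\<lambda>x :: real. exp (- x) * (\<Sum>i\<le>n. a i * exp (- x) ^ i)) = (\<lambda>x. \<Sum>i\<le>n. a i * exp (- ((real i + 1) * x)))"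
    proof
      fix x :: real
      have t: "exp (- x) * exp (- x) ^ i = exp (- ((real i + 1) * x))" for i
        by (simp add: algebra_simps flip: exp_of_nat_mult exp_add)
      have "exp (- x) * (a i * exp (- x) ^ i) = a i * exp (- ((real i + 1) * x))" for i
        unfolding t[symmetric] by simp
      then show "exp (- x) * (\<Sum>i\<le>n. a i * exp (- x) ^ i) = (\<Sum>i\<le>n. a i * exp (- ((real i + 1) * x)))"
        by (simp only: sum_distrib_left)
    qed
    show "integrable M (\<lambda>x. exp (- x) * (\<Sum>i\<le>n. a i * exp (- x) ^ i))"
      "integrable N (\<lambda>x. exp (- x) * (\<Sum>i\<le>n. a i * exp (- x) ^ i))"
      unfolding * using int by (auto intro!: Bochner_Integration.integrable_sum integrable_mult_right)
    show "(\<integral>x. exp (- x) * (\<Sum>i\<le>n. a i * exp (- x) ^ i) \<partial>M) = (\<integral>x. exp (- x) * (\<Sum>i\<le>n. a i * exp (- x) ^ i) \<partial>N)"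
      unfolding * using int
      by (subst (1 2) Bochner_Integration.integral_sum) (auto intro!: sum.cong integrable_mult_right simp: lap)
  qed
  have int1: "integrable M (\<lambda>x. exp (- x))" "integrable N (\<lambda>x. exp (- x))"
    using int[of 1] by simp_all
  have cont: "(\<integral>x. exp (- x) * \<phi> (exp (- x)) \<partial>M) = (\<integral>x. exp (- x) * \<phi> (exp (- x)) \<partial>N)"
    if \<phi>: "continuous_on UNIV \<phi>" and bd: "\<And>t. \<bar>\<phi> t\<bar> \<le> B" for \<phi> :: "real \<Rightarrow> real" and B
  proof -
    let ?I = "\<lambda>M. (\<integral>x. exp (- x) * \<phi> (exp (- x)) \<partial>M)" and ?m = "(\<integral>x. exp (- x) \<partial>M) + (\<integral>x. exp (- x) \<partial>N)"
    have [measurable]: "\<phi> \<in> borel_measurable borel"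
      using \<phi> by (rule borel_measurable_continuous_onI)
    have ip: "integrable P (\<lambda>x. exp (- x) * \<phi> (exp (- x)))"
      if "integrable P (\<lambda>x. exp (- x))" "sets P = sets borel" for P :: "real measure"
    proof (rule Bochner_Integration.integrable_bound[OF integrable_mult_left[OF that(1), of B]])
      have "(\<lambda>x. exp (- x) * \<phi> (exp (- x))) \<in> borel_measurable borel" by measurable
      then show "(\<lambda>x. exp (- x) * \<phi> (exp (- x))) \<in> borel_measurable P"
        using that(2) by (simp cong: measurable_cong_sets)
      have "\<bar>\<phi> t\<bar> \<le> \<bar>B\<bar>" for t using bd[of t] by linarith
      then show "AE x in P. norm (exp (- x) * \<phi> (exp (- x))) \<le> norm (exp (- x) * B)"
        by (simp add: abs_mult)
    qed
    \<comment> \<open>For x \<ge> 0 the argument \<open>exp (- x)\<close> lies in the unit interval,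
      where the polynomial is uniformly close; the error is weighted by the total masses
      \<open>?m\<close>.\<close>
    have close: "\<bar>?I M - ?I N\<bar> \<le> e * ?m" if e: "e > 0" for e
    proof -
      have c01: "continuous_on {0..1} \<phi>"
        using \<phi> by (rule continuous_on_subset) simp
      obtain g where g: "real_polynomial_function g" "\<forall>t\<in>{0..1}. \<bar>\<phi> t - g t\<bar> < e"
        using Stone_Weierstrass_real_polynomial_function[OF compact_Icc c01 e] by metis
      obtain a n where an: "g = (\<lambda>t. \<Sum>i\<le>n. a i * t ^ i)"
        using g(1) by (auto simp: real_polynomial_function_iff_sum)
      have dist: "\<bar>?I P - (\<integral>x. exp (- x) * g (exp (- x)) \<partial>P)\<bar> \<le> e * (\<integral>x. exp (- x) \<partial>P)"
        if P: "integrable P (\<lambda>x. exp (- x))" "sets P = sets borel" "AE x in P. 0 \<le> x"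
          "integrable P (\<lambda>x. exp (- x) * g (exp (- x)))" for P :: "real measure"
      proof -
        have "\<bar>?I P - (\<integral>x. exp (- x) * g (exp (- x)) \<partial>P)\<bar> = \<bar>\<integral>x. exp (- x) * \<phi> (exp (- x)) - exp (- x) * g (exp (- x)) \<partial>P\<bar>"
          by (subst Bochner_Integration.integral_diff[OF ip[OF P(1,2)] P(4)]) simp
        also have "\<dots> \<le> (\<integral>x. \<bar>exp (- x) * \<phi> (exp (- x)) - exp (- x) * g (exp (- x))\<bar> \<partial>P)"
          by (rule integral_abs_bound)
        also have "\<dots> \<le> (\<integral>x. e * exp (- x) \<partial>P)"
        proof (rule integral_mono_AE)
          show "integrable P (\<lambda>x. \<bar>exp (- x) * \<phi> (exp (- x)) - exp (- x) * g (exp (- x))\<bar>)"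
            by (intro integrable_abs Bochner_Integration.integrable_diff ip P)
          show "integrable P (\<lambda>x. e * exp (- x))"
            using P(1) by simp
          show "AE x in P. \<bar>exp (- x) * \<phi> (exp (- x)) - exp (- x) * g (exp (- x))\<bar> \<le> e * exp (- x)"
            using P(3)
          proof (rule eventually_mono)
            fix x :: real assume "0 \<le> x"
            then have "\<bar>\<phi> (exp (- x)) - g (exp (- x))\<bar> \<le> e"
              by (intro less_imp_le g(2)[rule_format]) simp
            then have "exp (- x) * \<bar>\<phi> (exp (- x)) - g (exp (- x))\<bar> \<le> exp (- x) * e"
              by (rule mult_left_mono) simp
            then show "\<bar>exp (- x) * \<phi> (exp (- x)) - exp (- x) * g (exp (- x))\<bar> \<le> e * exp (- x)"
              by (simp add: abs_mult mult.commute flip: right_diff_distrib)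
          qed
        qed
        finally show ?thesis by simp
      qed
      have "\<bar>?I M - ?I N\<bar> \<le> e * (\<integral>x. exp (- x) \<partial>M) + e * (\<integral>x. exp (- x) \<partial>N)"
        using dist[OF int1(1) sets(1) nonneg(1)] dist[OF int1(2) sets(2) nonneg(2)] poly[of a n]
        unfolding an by fastforce
      then show ?thesis by (simp add: distrib_left)
    qed
    define m where "m = ?m"
    have m: "0 \<le> m"
      unfolding m_def by (intro add_nonneg_nonneg Bochner_Integration.integral_nonneg) auto
    have "\<bar>?I M - ?I N\<bar> \<le> 0 + \<delta>" if "\<delta> > 0" for \<delta>
    proof -
      have "\<bar>?I M - ?I N\<bar> \<le> (\<delta> / (m + 1)) * m"
        using m that unfolding m_def[symmetric] by (intro close[folded m_def]) simp
      also have "\<dots> \<le> \<delta>"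
        using m that by (simp add: field_simps)
      finally show ?thesis by simp
    qed
    then have "\<bar>?I M - ?I N\<bar> \<le> 0"
      by (rule field_le_epsilon)
    then show ?thesis by simp
  qed
  \<comment> \<open>A continuous approximation of the function that is \<open>1 / t\<close> from
    \<open>exp (- 1)\<close> on and 0 below, so that \<open>exp (- x) * \<psi> n (exp (- x))\<close>
    tends to the indicator of \<open>{..1}\<close>. The numerator drops from 1 to 0 just below
    \<open>exp (- 1)\<close>; the cut-off at half that value keeps the quotient bounded.\<close>
  define \<psi> where "\<psi> n t = min 1 (max 0 (1 + real n * (t - exp (- 1)))) / max t (exp (- 1) / 2)" for n :: nat and t :: real
  have \<psi>_cont: "continuous_on UNIV (\<psi> n)" for n
    unfolding \<psi>_def by (intro continuous_intros) (auto simp: max_def)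
  have \<psi>_bd: "\<bar>\<psi> n t\<bar> \<le> 2 * exp 1" for n t
  proof -
    have e: "(0::real) < exp (- 1) / 2" by simp
    have "\<bar>\<psi> n t\<bar> = \<bar>min 1 (max 0 (1 + real n * (t - exp (- 1))))\<bar> / max t (exp (- 1) / 2)"
      using e unfolding \<psi>_def abs_divide by (simp add: less_max_iff_disj abs_of_pos)
    also have "\<dots> \<le> 1 / (exp (- 1) / 2)"
      using e by (intro frac_le) auto
    finally show ?thesis by (simp add: exp_minus field_simps)
  qed
  have lim: "(\<lambda>n. \<integral>x. exp (- x) * \<psi> n (exp (- x)) \<partial>P) \<longlonglongrightarrow> (\<integral>x. indicator {..1} x \<partial>P)"
    and ind: "integrable P (indicator {..1} :: real \<Rightarrow> real)"
    if P: "integrable P (\<lambda>x. exp (- x))" "sets P = sets borel" "AE x in P. 0 \<le> x" for P :: "real measure"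
  proof -
    have mP: "f \<in> borel_measurable P" if "f \<in> borel_measurable borel" for f :: "real \<Rightarrow> real"
      using that P(2) by (simp cong: measurable_cong_sets)
    show "(\<lambda>n. \<integral>x. exp (- x) * \<psi> n (exp (- x)) \<partial>P) \<longlonglongrightarrow> (\<integral>x. indicator {..1} x \<partial>P)"
    proof (rule integral_dominated_convergence[where w = "\<lambda>x. exp (- x) * (2 * exp 1)"])
      show "(indicator {..1} :: real \<Rightarrow> real) \<in> borel_measurable P"
        by (rule mP) simp
      have [measurable]: "\<psi> n \<in> borel_measurable borel" for n
        using \<psi>_cont by (rule borel_measurable_continuous_onI)
      show "(\<lambda>x. exp (- x) * \<psi> n (exp (- x))) \<in> borel_measurable P" for n
        by (rule mP) measurable
      show "integrable P (\<lambda>x. exp (- x) * (2 * exp 1))"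
        using P(1) by simp
      show "AE x in P. norm (exp (- x) * \<psi> n (exp (- x))) \<le> exp (- x) * (2 * exp 1)" for n
        using \<psi>_bd by (simp add: abs_mult)
      show "AE x in P. (\<lambda>n. exp (- x) * \<psi> n (exp (- x))) \<longlonglongrightarrow> indicator {..1} x"
      proof (rule AE_I2)
        fix x :: real
        show "(\<lambda>n. exp (- x) * \<psi> n (exp (- x))) \<longlonglongrightarrow> indicator {..1} x"
        proof (cases "x \<le> 1")
          case True
          have e1: "exp (- 1) / 2 \<le> exp (- 1 :: real)" by simp
          have e2: "exp (- 1) \<le> exp (- x)" using True by simp
          have "exp (- 1) / 2 \<le> exp (- x)" using e1 e2 by linarith
          then have "\<psi> n (exp (- x)) = 1 / exp (- x)" for n
            using e2 by (simp add: \<psi>_def max_absorb1 max_absorb2 min_absorb1)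
          then show ?thesis using True by simp
        next
          case False
          then have d: "exp (- x) - exp (- 1) < 0" by simp
          obtain m :: nat where m: "1 / (exp (- 1) - exp (- x)) < real m"
            using reals_Archimedean2 by blast
          have "exp (- x) * \<psi> n (exp (- x)) = 0" if "n \<ge> m" for n
          proof -
            have "1 / (exp (- 1) - exp (- x)) < real n" using m that by linarith
            then have "1 + real n * (exp (- x) - exp (- 1)) < 0"
              using d by (simp add: field_simps)
            then show ?thesis by (simp add: \<psi>_def)
          qed
          then have "eventually (\<lambda>n. exp (- x) * \<psi> n (exp (- x)) = 0) sequentially"
            by (auto simp: eventually_sequentially)
          then have "(\<lambda>n. exp (- x) * \<psi> n (exp (- x))) \<longlonglongrightarrow> 0"
            by (rule tendsto_eventually)
          then show ?thesis using False by simp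
        qed
      qed
    qed
    show "integrable P (indicator {..1} :: real \<Rightarrow> real)"
    proof (rule Bochner_Integration.integrable_bound[OF integrable_mult_left[OF P(1), of "exp 1"]])
      show "(indicator {..1} :: real \<Rightarrow> real) \<in> borel_measurable P"
        by (rule mP) simp
      show "AE x in P. norm (indicator {..1} x :: real) \<le> norm (exp (- x) * exp 1)"
        by (auto simp: indicator_def simp flip: exp_add)
    qed
  qed
  have "(\<integral>x. indicator {..1} x \<partial>M) = (\<integral>x. indicator {..1} x \<partial>N :: real)"
    using lim[OF int1(1) sets(1) nonneg(1)] lim[OF int1(2) sets(2) nonneg(2)]
    unfolding cont[OF \<psi>_cont \<psi>_bd] by (rule LIMSEQ_unique)
  moreover have nn: "(\<integral>\<^sup>+x. indicator {..1} x \<partial>P) = ennreal (\<integral>x. indicator {..1} x \<partial>P)"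
    if "integrable P (indicator {..1} :: real \<Rightarrow> real)" for P :: "real measure"
    using nn_integral_eq_integral[OF that] by (simp add: ennreal_indicator)
  ultimately show "(\<integral>\<^sup>+x. indicator {..1} x \<partial>M) = (\<integral>\<^sup>+x. indicator {..1} x \<partial>N)"
    using ind[OF int1(1) sets(1) nonneg(1)] ind[OF int1(2) sets(2) nonneg(2)] by simp
  show "(\<integral>\<^sup>+x. indicator {..1} x \<partial>M) < \<infinity>"
    using nn[OF ind[OF int1(1) sets(1) nonneg(1)]] by simp
qed

text \<open>The image under \<open>X\<close> of the measure with density \<rho> lives on the line,
  where the one-dimensional result applies. In several variables the density holds the factors of
  the other coordinates.\<close>

lemma laplace_uniqueness_weighted:
  fixes X :: "'a \<Rightarrow> real" and Y :: "'b \<Rightarrow> real"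
  assumes [measurable]: "X \<in> borel_measurable M" "Y \<in> borel_measurable N"
    "\<rho> \<in> borel_measurable M" "\<sigma> \<in> borel_measurable N"
    and nonneg: "AE x in M. 0 \<le> X x" "AE x in N. 0 \<le> Y x"
    and eq: "\<And>s. s > 0 \<Longrightarrow> (\<integral>\<^sup>+x. \<rho> x * ennreal (exp (- (s * X x))) \<partial>M) = (\<integral>\<^sup>+x. \<sigma> x * ennreal (exp (- (s * Y x))) \<partial>N)"
    and fin: "\<And>s. s > 0 \<Longrightarrow> (\<integral>\<^sup>+x. \<rho> x * ennreal (exp (- (s * X x))) \<partial>M) < \<infinity>"
  shows "(\<integral>\<^sup>+x. \<rho> x * indicator {..1} (X x) \<partial>M) = (\<integral>\<^sup>+x. \<sigma> x * indicator {..1} (Y x) \<partial>N)"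
    and "(\<integral>\<^sup>+x. \<rho> x * indicator {..1} (X x) \<partial>M) < \<infinity>"
proof -
  let ?M = "distr (density M \<rho>) borel X" and ?N = "distr (density N \<sigma>) borel Y"
  have tr: "(\<integral>\<^sup>+x. g x \<partial>?M) = (\<integral>\<^sup>+x. \<rho> x * g (X x) \<partial>M)" "(\<integral>\<^sup>+x. g x \<partial>?N) = (\<integral>\<^sup>+x. \<sigma> x * g (Y x) \<partial>N)"
    if [measurable]: "g \<in> borel_measurable borel" for g :: "real \<Rightarrow> ennreal"
    by (simp_all add: nn_integral_distr nn_integral_density)
  have "AE x in ?M. 0 \<le> x" "AE x in ?N. 0 \<le> x"
    using nonneg by (simp_all add: AE_distr_iff AE_density) (auto elim: eventually_mono)
  then have ae: "AE x in ?M. 0 \<le> x" "AE x in ?N. 0 \<le> x" .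
  have m: "(\<lambda>x. ennreal (exp (- (s * x)))) \<in> borel_measurable borel" for s :: real
    by measurable
  have i: "indicator {..1} \<in> borel_measurable (borel :: real measure)" by simp
  have fin': "(\<integral>\<^sup>+x. \<sigma> x * ennreal (exp (- (s * Y x))) \<partial>N) < \<infinity>" if "s > 0" for s
    unfolding eq[OF that, symmetric] by (rule fin[OF that])
  have "(\<integral>\<^sup>+x. indicator {..1} x \<partial>?M) = (\<integral>\<^sup>+x. indicator {..1} x \<partial>?N)"
    by (rule laplace_uniqueness(1)[OF _ _ ae]) (simp_all only: tr[OF m] eq fin' sets_distr)
  then show "(\<integral>\<^sup>+x. \<rho> x * indicator {..1} (X x) \<partial>M) = (\<integral>\<^sup>+x. \<sigma> x * indicator {..1} (Y x) \<partial>N)"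
    by (simp only: tr[OF i])
  have "(\<integral>\<^sup>+x. indicator {..1} x \<partial>?M) < \<infinity>"
    by (rule laplace_uniqueness(2)[OF _ _ ae]) (simp_all only: tr[OF m] eq fin' sets_distr)
  then show "(\<integral>\<^sup>+x. \<rho> x * indicator {..1} (X x) \<partial>M) < \<infinity>"
    by (simp only: tr[OF i])
qed

text \<open>Exponentials are exchanged for indicators one coordinate at a time, the others acting as a density.\<close>

lemma laplace_uniqueness_multi:
  fixes X :: "'i \<Rightarrow> 'a \<Rightarrow> real" and Y :: "'i \<Rightarrow> 'b \<Rightarrow> real"
  assumes I: "finite I" and X: "\<And>i. i \<in> I \<Longrightarrow> X i \<in> borel_measurable M" and Y: "\<And>i. i \<in> I \<Longrightarrow> Y i \<in> borel_measurable N"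
    and nonneg: "\<And>i. i \<in> I \<Longrightarrow> AE x in M. 0 \<le> X i x" "\<And>i. i \<in> I \<Longrightarrow> AE x in N. 0 \<le> Y i x"
    and eq: "\<And>s. (\<And>i. i \<in> I \<Longrightarrow> s i > 0) \<Longrightarrow> (\<integral>\<^sup>+x. (\<Prod>i\<in>I. ennreal (exp (- (s i * X i x)))) \<partial>M)
      = (\<integral>\<^sup>+x. (\<Prod>i\<in>I. ennreal (exp (- (s i * Y i x)))) \<partial>N)"
    and fin: "\<And>s. (\<And>i. i \<in> I \<Longrightarrow> s i > 0) \<Longrightarrow> (\<integral>\<^sup>+x. (\<Prod>i\<in>I. ennreal (exp (- (s i * X i x)))) \<partial>M) < \<infinity>"
  shows "(\<integral>\<^sup>+x. (\<Prod>i\<in>I. indicator {..1} (X i x)) \<partial>M) = (\<integral>\<^sup>+x. (\<Prod>i\<in>I. indicator {..1} (Y i x)) \<partial>N)"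
proof -
  \<comment> \<open>Coordinates in \<open>J\<close> already carry the indicator, the others still
    the exponential.\<close>
  define H :: "'i set \<Rightarrow> ('i \<Rightarrow> real) \<Rightarrow> 'i \<Rightarrow> real \<Rightarrow> ennreal"
    where "H J s i r = (if i \<in> J then indicator {..1} r else ennreal (exp (- (s i * r))))" for J s i r
  have [measurable]: "H J s i \<in> borel_measurable borel" for J s i
    unfolding H_def by measurable
  have HX: "(\<lambda>x. \<Prod>i\<in>K. H J s i (X i x)) \<in> borel_measurable M" if "K \<subseteq> I" for K J s
    using that by (intro borel_measurable_prod_ennreal measurable_compose[OF X]) auto
  have HY: "(\<lambda>x. \<Prod>i\<in>K. H J s i (Y i x)) \<in> borel_measurable N" if "K \<subseteq> I" for K J s
    using that by (intro borel_measurable_prod_ennreal measurable_compose[OF Y]) auto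
  \<comment> \<open>All positive parameters and the finiteness are carried through the induction:
    exchanging the next coordinate takes the transform at every positive value of its
    parameter.\<close>
  have "J \<subseteq> I \<Longrightarrow> (\<forall>s. (\<forall>i\<in>I. s i > 0) \<longrightarrow>
      (\<integral>\<^sup>+x. (\<Prod>i\<in>I. H J s i (X i x)) \<partial>M) = (\<integral>\<^sup>+x. (\<Prod>i\<in>I. H J s i (Y i x)) \<partial>N) \<and>
      (\<integral>\<^sup>+x. (\<Prod>i\<in>I. H J s i (X i x)) \<partial>M) < \<infinity>)" if "finite J" for J
    using that
  proof (induction J rule: finite_induct)
    case empty
    then show ?case using eq fin by (simp add: H_def)
  next
    case (insert j J)
    then have j: "j \<in> I" "j \<notin> J" by auto
    show ?case
    proof (intro allI impI)
      fix s :: "'i \<Rightarrow> real" assume s: "\<forall>i\<in>I. s i > 0"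
      let ?R = "\<lambda>Z x. \<Prod>i\<in>I - {j}. H J s i (Z i x)"
      have split1: "(\<Prod>i\<in>I. H J (s(j := t)) i (z i)) = (\<Prod>i\<in>I - {j}. H J s i (z i)) * ennreal (exp (- (t * z j)))" for t z
      proof -
        have "(\<Prod>i\<in>I. H J (s(j := t)) i (z i)) = H J (s(j := t)) j (z j) * (\<Prod>i\<in>I - {j}. H J (s(j := t)) i (z i))"
          using I j(1) by (rule prod.remove)
        also have "(\<Prod>i\<in>I - {j}. H J (s(j := t)) i (z i)) = (\<Prod>i\<in>I - {j}. H J s i (z i))"
          by (intro prod.cong) (auto simp: H_def)
        also have "H J (s(j := t)) j (z j) = ennreal (exp (- (t * z j)))"
          using j(2) by (simp add: H_def)
        finally show ?thesis by (simp only: mult.commute)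
      qed
      have split2: "(\<Prod>i\<in>I. H (insert j J) s i (z i)) = (\<Prod>i\<in>I - {j}. H J s i (z i)) * indicator {..1} (z j)" for z
      proof -
        have "(\<Prod>i\<in>I. H (insert j J) s i (z i)) = H (insert j J) s j (z j) * (\<Prod>i\<in>I - {j}. H (insert j J) s i (z i))"
          using I j(1) by (rule prod.remove)
        also have "(\<Prod>i\<in>I - {j}. H (insert j J) s i (z i)) = (\<Prod>i\<in>I - {j}. H J s i (z i))"
          by (intro prod.cong) (auto simp: H_def)
        also have "H (insert j J) s j (z j) = indicator {..1} (z j)"
          by (simp add: H_def)
        finally show ?thesis by (simp only: mult.commute)
      qed
      have IH: "(\<integral>\<^sup>+x. ?R X x * ennreal (exp (- (t * X j x))) \<partial>M) = (\<integral>\<^sup>+x. ?R Y x * ennreal (exp (- (t * Y j x))) \<partial>N)"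
        "(\<integral>\<^sup>+x. ?R X x * ennreal (exp (- (t * X j x))) \<partial>M) < \<infinity>" if "t > 0" for t
      proof -
        have pos: "\<forall>i\<in>I. (s(j := t)) i > 0" using s that by simp
        have "J \<subseteq> I" using insert.prems by simp
        from insert.IH[OF this, THEN spec, THEN mp, OF pos]
        show "(\<integral>\<^sup>+x. ?R X x * ennreal (exp (- (t * X j x))) \<partial>M) = (\<integral>\<^sup>+x. ?R Y x * ennreal (exp (- (t * Y j x))) \<partial>N)"
          "(\<integral>\<^sup>+x. ?R X x * ennreal (exp (- (t * X j x))) \<partial>M) < \<infinity>"
          unfolding split1 by blast+
      qed
      show "(\<integral>\<^sup>+x. (\<Prod>i\<in>I. H (insert j J) s i (X i x)) \<partial>M) = (\<integral>\<^sup>+x. (\<Prod>i\<in>I. H (insert j J) s i (Y i x)) \<partial>N) \<and>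
        (\<integral>\<^sup>+x. (\<Prod>i\<in>I. H (insert j J) s i (X i x)) \<partial>M) < \<infinity>"
        unfolding split2
        using laplace_uniqueness_weighted[OF X[OF j(1)] Y[OF j(1)] HX HY nonneg(1)[OF j(1)] nonneg(2)[OF j(1)] IH]
        by blast
    qed
  qed
  from this[OF I order_refl, THEN spec, of "\<lambda>_. 1"] show ?thesis
    by (simp add: H_def)
qed

section \<open>Gaussian integrals of triangularly homogeneous functions\<close>

text \<open>Powers of the volume have this property. The abstraction serves the induction:
  integrating out the last vector leaves a function of one vector less, known only through this
  property. The clause on \<open>restrict\<close> admits arguments that are not extensional, such as
  \<open>\<lambda>i. y i - y k\<close>.\<close>

definition tri_homogeneous :: "nat \<Rightarrow> real \<Rightarrow> ((nat \<Rightarrow> 'a::euclidean_space) \<Rightarrow> ennreal) \<Rightarrow> bool"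
  where "tri_homogeneous k p f \<longleftrightarrow> (\<forall>v. f (restrict v {..<k}) = f v) \<and> (\<forall>v i \<beta> z. i < k \<longrightarrow> \<beta> > 0 \<longrightarrow> z \<in> span (v ` {..<i}) \<longrightarrow>
    f (v(i := \<beta> *\<^sub>R v i + z)) = ennreal (\<beta> powr p) * f v)"

lemma tri_homogeneousD:
  "tri_homogeneous k p f \<Longrightarrow> i < k \<Longrightarrow> \<beta> > 0 \<Longrightarrow> z \<in> span (v ` {..<i}) \<Longrightarrow>
    f (v(i := \<beta> *\<^sub>R v i + z)) = ennreal (\<beta> powr p) * f v"
  by (simp add: tri_homogeneous_def)

lemma tri_homogeneous_cong:
  assumes "tri_homogeneous k p f" "\<And>i. i < k \<Longrightarrow> v i = w i"
  shows "f v = f w"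
proof -
  have "restrict v {..<k} = restrict w {..<k}" using assms(2) by (auto simp: restrict_def)
  then show ?thesis using assms(1) unfolding tri_homogeneous_def by metis
qed

lemma tri_homogeneous_pvol:
  fixes A :: "'a::euclidean_space \<Rightarrow> 'b::euclidean_space"
  assumes A: "linear A"
  shows "tri_homogeneous k p (\<lambda>v. ennreal (pvol k (\<lambda>i. A (v i)) powr p))"
  unfolding tri_homogeneous_def
proof (intro conjI allI impI)
  fix v :: "nat \<Rightarrow> 'a"
  have "pvol k (\<lambda>i. A (restrict v {..<k} i)) = pvol k (\<lambda>i. A (v i))"
    by (intro pvol_cong) simp
  then show "ennreal (pvol k (\<lambda>i. A (restrict v {..<k} i)) powr p) = ennreal (pvol k (\<lambda>i. A (v i)) powr p)"
    by (simp only:)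
next
  fix v :: "nat \<Rightarrow> 'a" and i \<beta> z assume i: "i < k" and \<beta>: "(\<beta>::real) > 0" and z: "z \<in> span (v ` {..<i})"
  have "(\<lambda>j. A ((v(i := \<beta> *\<^sub>R v i + z)) j)) = (\<lambda>j. A (v j))(i := \<beta> *\<^sub>R A (v i) + A z)"
    using A by (auto simp: linear_add linear_scale)
  moreover have "A z \<in> span ((\<lambda>j. A (v j)) ` {..<i})"
    using z by (simp add: span_linear_image_lessThan[OF A])
  ultimately have "pvol k (\<lambda>j. A ((v(i := \<beta> *\<^sub>R v i + z)) j)) = \<beta> * pvol k (\<lambda>j. A (v j))"
    using pvol_update_scale[of \<beta> "A z" "\<lambda>j. A (v j)" i k] i \<beta> by simp
  then show "ennreal (pvol k (\<lambda>j. A ((v(i := \<beta> *\<^sub>R v i + z)) j)) powr p)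
      = ennreal (\<beta> powr p) * ennreal (pvol k (\<lambda>j. A (v j)) powr p)"
    using \<beta> by (simp add: powr_mult pvol_nonneg flip: ennreal_mult)
qed

text \<open>In the application \<sigma> is the weight of the vertex moved to the origin; it is kept
  apart from the \<open>s i\<close> because it stays fixed in the induction on
  \<open>k\<close>.\<close>

definition weight_sum :: "(nat \<Rightarrow> real) \<Rightarrow> real \<Rightarrow> nat \<Rightarrow> real"
  where "weight_sum s \<sigma> k = \<sigma> + (\<Sum>i<k. s i)"

text \<open>
  The minimum over \<open>y\<close> of \<open>\<sigma> |y|\<^sup>2 + (\<Sum>i<k. s i |v i + y|\<^sup>2)\<close>.
\<close>

definition inertia :: "(nat \<Rightarrow> real) \<Rightarrow> real \<Rightarrow> nat \<Rightarrow> (nat \<Rightarrow> 'a::euclidean_space) \<Rightarrow> real"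
  where "inertia s \<sigma> k v = (\<Sum>i<k. s i * (norm (v i))\<^sup>2) - (norm (\<Sum>i<k. s i *\<^sub>R v i))\<^sup>2 / weight_sum s \<sigma> k"

lemma weight_sum_pos:
  assumes "\<sigma> > 0" "\<And>i. i < k \<Longrightarrow> s i > 0"
  shows "weight_sum s \<sigma> k > 0"
  unfolding weight_sum_def using assms by (intro add_pos_nonneg sum_nonneg) (auto intro: less_imp_le)

text \<open>In mechanical terms: attaching a mass \<open>q\<close> at \<open>y\<close> to a total
  mass \<open>T\<close> with centroid \<open>w / T\<close> adds the reduced mass
  \<open>q * T / (T + q)\<close> times the squared distance.\<close>

lemma complete_square:
  fixes w y :: "'a::real_inner"
  assumes "T > 0" "q > 0"
  shows "q * (norm y)\<^sup>2 - (norm (w + q *\<^sub>R y))\<^sup>2 / (T + q)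
    = q * T / (T + q) * (norm (y - (1 / T) *\<^sub>R w))\<^sup>2 - (norm w)\<^sup>2 / T"
proof -
  have 1: "(norm (w + q *\<^sub>R y))\<^sup>2 = (norm w)\<^sup>2 + 2 * q * (w \<bullet> y) + q\<^sup>2 * (norm y)\<^sup>2"
    unfolding power2_norm_eq_inner by (simp add: inner_add_left inner_add_right inner_commute power2_eq_square algebra_simps)
  have "(norm (y - u *\<^sub>R w))\<^sup>2 = (norm y)\<^sup>2 - 2 * u * (w \<bullet> y) + u\<^sup>2 * (norm w)\<^sup>2" for u
    unfolding power2_norm_eq_inner by (simp add: inner_diff_left inner_diff_right inner_commute power2_eq_square algebra_simps)
  from this[of "1 / T"] have 2: "(norm (y - (1 / T) *\<^sub>R w))\<^sup>2 = (norm y)\<^sup>2 - 2 * (w \<bullet> y) / T + (norm w)\<^sup>2 / T\<^sup>2"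
    by (simp add: power_divide)
  have alg: "q * c - (a + 2 * q * b + q\<^sup>2 * c) / (T + q) = q * T / (T + q) * (c - 2 * b / T + a / T\<^sup>2) - a / T"
    for a b c :: real
  proof -
    have nz: "T + q \<noteq> 0" "T \<noteq> 0" using assms by simp_all
    have "T * (c - 2 * b / T + a / T\<^sup>2) = T * c - 2 * b + a / T"
      using nz by (simp add: distrib_left right_diff_distrib power2_eq_square)
    then have "q * T / (T + q) * (c - 2 * b / T + a / T\<^sup>2) - a / T = q * (T * c - 2 * b + a / T) / (T + q) - a / T"
      by (metis mult.assoc times_divide_eq_left)
    also have "\<dots> = (q * (T * c - 2 * b + a / T) - (T + q) * (a / T)) / (T + q)"
      using nz by (simp add: diff_divide_distrib)
    also have "q * (T * c - 2 * b + a / T) - (T + q) * (a / T) = q * c * (T + q) - (a + 2 * q * b + q\<^sup>2 * c)"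
      using nz by (simp add: algebra_simps power2_eq_square add_divide_distrib)
    also have "\<dots> / (T + q) = q * c - (a + 2 * q * b + q\<^sup>2 * c) / (T + q)"
      using nz by (simp add: diff_divide_distrib)
    finally show ?thesis ..
  qed
  show ?thesis
    unfolding 1 2 by (rule alg)
qed

lemma inertia_Suc:
  assumes \<sigma>: "\<sigma> > 0" and s: "\<And>i. i < Suc k \<Longrightarrow> s i > 0"
  shows "inertia s \<sigma> (Suc k) (v(k := y)) = inertia s \<sigma> k v
    + s k * weight_sum s \<sigma> k / weight_sum s \<sigma> (Suc k) * (norm (y - (1 / weight_sum s \<sigma> k) *\<^sub>R (\<Sum>i<k. s i *\<^sub>R v i)))\<^sup>2"
proof -
  let ?w = "\<Sum>i<k. s i *\<^sub>R v i" and ?T = "weight_sum s \<sigma> k"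
  have T: "?T > 0" using \<sigma> s by (intro weight_sum_pos) auto
  have S: "weight_sum s \<sigma> (Suc k) = ?T + s k" by (simp add: weight_sum_def)
  have "inertia s \<sigma> (Suc k) (v(k := y)) = (\<Sum>i<k. s i * (norm (v i))\<^sup>2)
      + (s k * (norm y)\<^sup>2 - (norm (?w + s k *\<^sub>R y))\<^sup>2 / (?T + s k))"
    by (simp add: inertia_def S)
  also have "\<dots> = (\<Sum>i<k. s i * (norm (v i))\<^sup>2)
      + (s k * ?T / (?T + s k) * (norm (y - (1 / ?T) *\<^sub>R ?w))\<^sup>2 - (norm ?w)\<^sup>2 / ?T)"
    using T s by (subst complete_square) auto
  finally show ?thesis by (simp add: inertia_def S)
qed

lemma measurable_inertia: "inertia s \<sigma> k \<in> borel_measurable (Pi\<^sub>M {..<k} (\<lambda>_. lborel :: 'a::euclidean_space measure))"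
  unfolding inertia_def
  by (intro borel_measurable_diff borel_measurable_sum borel_measurable_times borel_measurable_divide borel_measurable_power
      borel_measurable_norm[THEN measurable_compose[rotated]] borel_measurable_scaleR borel_measurable_const) auto

text \<open>
  As a function of \<open>v k\<close>, \<open>inertia s \<sigma> (Suc k) v\<close> is \<open>inertia s \<sigma> k v\<close> plus a multiple of the squared
  distance of \<open>v k\<close> to a point in the span of the preceding vectors.
\<close>

lemma nn_integral_inertia:
  fixes f :: "(nat \<Rightarrow> 'a::euclidean_space) \<Rightarrow> ennreal"
  assumes f: "f \<in> borel_measurable (Pi\<^sub>M {..<k} (\<lambda>_. lborel))" and hom: "tri_homogeneous k p f"
    and \<sigma>: "\<sigma> > 0" and s: "\<And>i. i < k \<Longrightarrow> s i > 0"
  shows "(\<integral>\<^sup>+v. f v * ennreal (exp (- inertia s \<sigma> k v)) \<partial>Pi\<^sub>M {..<k} (\<lambda>_. lborel))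
    = ennreal (((\<Prod>i<k. s i) * \<sigma> / weight_sum s \<sigma> k) powr (- (real DIM('a) + p) / 2))
      * (\<integral>\<^sup>+v. f v * (\<Prod>i<k. ennreal (exp (- (norm (v i))\<^sup>2))) \<partial>Pi\<^sub>M {..<k} (\<lambda>_. lborel))"
  using f hom s
proof (induction k arbitrary: f)
  case 0
  then show ?case using \<sigma> by (simp add: inertia_def weight_sum_def)
next
  case (Suc k)
  let ?M = "\<lambda>k. Pi\<^sub>M {..<k} (\<lambda>_. lborel :: 'a measure)" and ?a = "- (real DIM('a) + p) / 2"
    and ?w = "\<lambda>k v. \<Prod>i<k. ennreal (exp (- (norm (v i :: 'a))\<^sup>2))"
  define T where "T = weight_sum s \<sigma> k"
  \<comment> \<open>Over the whole induction these factors telescope to the quotient in the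
    statement, since \<open>weight_sum s \<sigma> 0\<close> is \<sigma>.\<close>
  define \<alpha> where "\<alpha> = s k * T / weight_sum s \<sigma> (Suc k)"
  define m :: "(nat \<Rightarrow> 'a) \<Rightarrow> 'a" where "m v = (1 / T) *\<^sub>R (\<Sum>i<k. s i *\<^sub>R v i)" for v
  have sp: "\<And>i. i < k \<Longrightarrow> s i > 0" using Suc.prems(3) by simp
  have T: "T > 0" unfolding T_def using \<sigma> sp by (rule weight_sum_pos)
  have S: "weight_sum s \<sigma> (Suc k) > 0" using \<sigma> Suc.prems(3) by (rule weight_sum_pos)
  have \<alpha>: "\<alpha> > 0" unfolding \<alpha>_def using T S Suc.prems(3) by simp
  note [measurable] = Suc.prems(1) measurable_inertia measurable_gauss_weight[OF order_refl]
  have upd: "(\<lambda>(v, y). v(k := y)) \<in> ?M k \<Otimes>\<^sub>M lborel \<rightarrow>\<^sub>M ?M (Suc k)"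
    unfolding lessThan_Suc by (rule measurable_add_dim)
  have upd': "(\<lambda>y. v(k := y)) \<in> borel \<rightarrow>\<^sub>M ?M (Suc k)" if "v \<in> space (?M k)" for v
    using measurable_compose[OF measurable_Pair1'[OF that, of lborel] upd] by simp
  have fy: "(\<lambda>y. f (v(k := y))) \<in> borel_measurable borel" if "v \<in> space (?M k)" for v
    by (rule measurable_compose[OF upd'[OF that] Suc.prems(1)])
  have inner: "(\<integral>\<^sup>+y. f (v(k := y)) * ennreal (exp (- inertia s \<sigma> (Suc k) (v(k := y)))) \<partial>lborel)
      = ennreal (exp (- inertia s \<sigma> k v)) * (ennreal (\<alpha> powr ?a) * (\<integral>\<^sup>+y. f (v(k := y)) * ennreal (exp (- (norm y)\<^sup>2)) \<partial>lborel))"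
    if v: "v \<in> space (?M k)" for v
  proof -
    \<comment> \<open>Substituting \<open>m v + ?c *\<^sub>R y\<close> costs the Jacobian
      \<open>?c ^ DIM('a)\<close>, and homogeneity costs \<open>?c powr p\<close>; together they
      make \<open>\<alpha> powr ?a\<close>.\<close>
    let ?c = "1 / sqrt \<alpha>"
    have c: "?c > 0" using \<alpha> by simp
    note [measurable] = fy[OF v]
    have gm: "(\<lambda>y. f (v(k := y)) * ennreal (exp (- (\<alpha> * (norm (y - m v))\<^sup>2)))) \<in> borel_measurable borel"
      by measurable
    have "(\<integral>\<^sup>+y. f (v(k := y)) * ennreal (exp (- inertia s \<sigma> (Suc k) (v(k := y)))) \<partial>lborel)
      = (\<integral>\<^sup>+y. ennreal (exp (- inertia s \<sigma> k v)) * (f (v(k := y)) * ennreal (exp (- (\<alpha> * (norm (y - m v))\<^sup>2)))) \<partial>lborel)"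
    proof (rule nn_integral_cong)
      fix y
      have "inertia s \<sigma> (Suc k) (v(k := y)) = inertia s \<sigma> k v + \<alpha> * (norm (y - m v))\<^sup>2"
        unfolding \<alpha>_def m_def T_def by (rule inertia_Suc[OF \<sigma> Suc.prems(3)])
      then have "exp (- inertia s \<sigma> (Suc k) (v(k := y))) = exp (- inertia s \<sigma> k v) * exp (- (\<alpha> * (norm (y - m v))\<^sup>2))"
        by (simp flip: exp_add)
      then show "f (v(k := y)) * ennreal (exp (- inertia s \<sigma> (Suc k) (v(k := y))))
        = ennreal (exp (- inertia s \<sigma> k v)) * (f (v(k := y)) * ennreal (exp (- (\<alpha> * (norm (y - m v))\<^sup>2))))"
        by (simp only: ennreal_mult exp_ge_zero mult_ac)
    qed
    also have "\<dots> = ennreal (exp (- inertia s \<sigma> k v)) * (\<integral>\<^sup>+y. f (v(k := y)) * ennreal (exp (- (\<alpha> * (norm (y - m v))\<^sup>2))) \<partial>lborel)"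
      by (rule nn_integral_cmult) measurable
    also have "(\<integral>\<^sup>+y. f (v(k := y)) * ennreal (exp (- (\<alpha> * (norm (y - m v))\<^sup>2))) \<partial>lborel)
      = ennreal (\<bar>?c\<bar> ^ DIM('a)) * (\<integral>\<^sup>+y. f (v(k := m v + ?c *\<^sub>R y)) * ennreal (exp (- (\<alpha> * (norm ((m v + ?c *\<^sub>R y) - m v))\<^sup>2))) \<partial>lborel)"
      using c by (intro nn_integral_lborel_affine[OF gm]) simp
    also have "(\<integral>\<^sup>+y. f (v(k := m v + ?c *\<^sub>R y)) * ennreal (exp (- (\<alpha> * (norm ((m v + ?c *\<^sub>R y) - m v))\<^sup>2))) \<partial>lborel)
      = (\<integral>\<^sup>+y. ennreal (?c powr p) * (f (v(k := y)) * ennreal (exp (- (norm y)\<^sup>2))) \<partial>lborel)"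
    proof (rule nn_integral_cong)
      fix y
      let ?v = "v(k := y)"
      have "m v = (1 / T) *\<^sub>R (\<Sum>i<k. s i *\<^sub>R ?v i)" by (simp add: m_def)
      also have "\<dots> \<in> span (?v ` {..<k})"
        by (intro span_scale span_sum span_base imageI)
      finally have "m v \<in> span (?v ` {..<k})" .
      from tri_homogeneousD[OF Suc.prems(2) lessI c this]
      moreover have "?v(k := ?c *\<^sub>R ?v k + m v) = v(k := m v + ?c *\<^sub>R y)"
        by (simp add: add.commute)
      ultimately have "f (v(k := m v + ?c *\<^sub>R y)) = ennreal (?c powr p) * f (v(k := y))"
        by (simp only:)
      moreover have "\<alpha> * (norm ((m v + ?c *\<^sub>R y) - m v))\<^sup>2 = (norm y)\<^sup>2"
        using \<alpha> by (simp add: power_divide)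
      ultimately show "f (v(k := m v + ?c *\<^sub>R y)) * ennreal (exp (- (\<alpha> * (norm ((m v + ?c *\<^sub>R y) - m v))\<^sup>2)))
        = ennreal (?c powr p) * (f (v(k := y)) * ennreal (exp (- (norm y)\<^sup>2)))"
        by (simp only: mult.assoc)
    qed
    also have "\<dots> = ennreal (?c powr p) * (\<integral>\<^sup>+y. f (v(k := y)) * ennreal (exp (- (norm y)\<^sup>2)) \<partial>lborel)"
      by (rule nn_integral_cmult) measurable
    also have "ennreal (\<bar>?c\<bar> ^ DIM('a)) * (ennreal (?c powr p) * (\<integral>\<^sup>+y. f (v(k := y)) * ennreal (exp (- (norm y)\<^sup>2)) \<partial>lborel))
      = ennreal (\<alpha> powr ?a) * (\<integral>\<^sup>+y. f (v(k := y)) * ennreal (exp (- (norm y)\<^sup>2)) \<partial>lborel)"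
    proof -
      have "?c = \<alpha> powr (- 1 / 2)"
        using \<alpha> by (simp add: powr_half_sqrt[symmetric] powr_minus_divide)
      moreover have "\<bar>?c\<bar> ^ DIM('a) = ?c powr real DIM('a)"
        using c by (simp only: powr_realpow abs_of_pos)
      ultimately have "\<bar>?c\<bar> ^ DIM('a) * ?c powr p = \<alpha> powr ?a"
        by (simp only: powr_powr flip: powr_add) (simp add: field_simps)
      then show ?thesis
        using c by (simp only: mult.assoc[symmetric] ennreal_mult[symmetric] zero_le_power abs_ge_zero powr_ge_zero)
    qed
    finally show ?thesis .
  qed
  define f' where "f' v = (\<integral>\<^sup>+y. f (v(k := y)) * ennreal (exp (- (norm y)\<^sup>2)) \<partial>lborel)" for v
  have f'm [measurable]: "f' \<in> borel_measurable (?M k)"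
    unfolding f'_def
  proof (rule lborel.borel_measurable_nn_integral)
    have [measurable]: "(\<lambda>x. f ((fst x)(k := snd x))) \<in> borel_measurable (?M k \<Otimes>\<^sub>M lborel)"
      using measurable_compose[OF upd Suc.prems(1)] by (simp only: case_prod_beta')
    show "(\<lambda>(v, y). f (v(k := y)) * ennreal (exp (- (norm y)\<^sup>2))) \<in> borel_measurable (?M k \<Otimes>\<^sub>M lborel)"
      unfolding case_prod_beta' by measurable
  qed
  \<comment> \<open>A change of an earlier vector commutes with appending \<open>y\<close>, and
    \<open>z\<close> still lies in the span of the vectors before position \<open>i\<close>, so
    homogeneity survives the integration.\<close>
  have f'h: "tri_homogeneous k p f'"
    unfolding tri_homogeneous_def
  proof (intro conjI allI impI)
    fix v :: "nat \<Rightarrow> 'a"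
    have "f ((restrict v {..<k})(k := y)) = f (v(k := y))" for y
      by (rule tri_homogeneous_cong[OF Suc.prems(2)]) auto
    then show "f' (restrict v {..<k}) = f' v" by (simp only: f'_def)
  next
    fix v :: "nat \<Rightarrow> 'a" and i \<beta> z assume i: "i < k" and \<beta>: "(\<beta>::real) > 0" and z: "z \<in> span (v ` {..<i})"
    have e: "f ((v(i := \<beta> *\<^sub>R v i + z))(k := y)) = ennreal (\<beta> powr p) * f (v(k := y))" for y
    proof -
      have "(v(k := y)) ` {..<i} = v ` {..<i}"
        using i by (intro image_cong) auto
      then have "z \<in> span ((v(k := y)) ` {..<i})" using z by (simp only:)
      from tri_homogeneousD[OF Suc.prems(2) less_SucI[OF i] \<beta> this]
      have "f ((v(k := y))(i := \<beta> *\<^sub>R (v(k := y)) i + z)) = ennreal (\<beta> powr p) * f (v(k := y))" .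
      moreover have "(v(k := y))(i := \<beta> *\<^sub>R (v(k := y)) i + z) = (v(i := \<beta> *\<^sub>R v i + z))(k := y)"
        using i by (auto simp: fun_eq_iff)
      ultimately show ?thesis by (simp only:)
    qed
    \<comment> \<open>Here \<open>v\<close> is arbitrary, while measurability in \<open>y\<close> is
      known for extensional arguments; \<open>f\<close> does not distinguish the two.\<close>
    have "restrict v {..<k} \<in> space (?M k)" by (auto simp: space_PiM)
    from fy[OF this] have "(\<lambda>y. f ((restrict v {..<k})(k := y))) \<in> borel_measurable lborel" by simp
    moreover have "(\<lambda>y. f ((restrict v {..<k})(k := y))) = (\<lambda>y. f (v(k := y)))"
      by (intro ext tri_homogeneous_cong[OF Suc.prems(2)]) auto
    ultimately have [measurable]: "(\<lambda>y. f (v(k := y))) \<in> borel_measurable lborel" by simp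
    have "f' (v(i := \<beta> *\<^sub>R v i + z)) = (\<integral>\<^sup>+y. ennreal (\<beta> powr p) * (f (v(k := y)) * ennreal (exp (- (norm y)\<^sup>2))) \<partial>lborel)"
      unfolding f'_def by (intro nn_integral_cong) (simp only: e mult.assoc)
    also have "\<dots> = ennreal (\<beta> powr p) * f' v"
      unfolding f'_def by (rule nn_integral_cmult) measurable
    finally show "f' (v(i := \<beta> *\<^sub>R v i + z)) = ennreal (\<beta> powr p) * f' v" .
  qed
  have "(\<integral>\<^sup>+v. f v * ennreal (exp (- inertia s \<sigma> (Suc k) v)) \<partial>?M (Suc k))
    = (\<integral>\<^sup>+v. \<integral>\<^sup>+y. f (v(k := y)) * ennreal (exp (- inertia s \<sigma> (Suc k) (v(k := y)))) \<partial>lborel \<partial>?M k)"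
    by (rule nn_integral_PL_Suc(1)) measurable
  also have "\<dots> = (\<integral>\<^sup>+v. ennreal (\<alpha> powr ?a) * (f' v * ennreal (exp (- inertia s \<sigma> k v))) \<partial>?M k)"
    by (intro nn_integral_cong) (simp only: inner f'_def mult_ac)
  also have "\<dots> = ennreal (\<alpha> powr ?a) * (\<integral>\<^sup>+v. f' v * ennreal (exp (- inertia s \<sigma> k v)) \<partial>?M k)"
    by (rule nn_integral_cmult) measurable
  also have "(\<integral>\<^sup>+v. f' v * ennreal (exp (- inertia s \<sigma> k v)) \<partial>?M k)
    = ennreal (((\<Prod>i<k. s i) * \<sigma> / T) powr ?a) * (\<integral>\<^sup>+v. f' v * ?w k v \<partial>?M k)"
    unfolding T_def by (rule Suc.IH[OF f'm f'h sp])
  also have "(\<integral>\<^sup>+v. f' v * ?w k v \<partial>?M k) = (\<integral>\<^sup>+v. \<integral>\<^sup>+y. f (v(k := y)) * ?w (Suc k) (v(k := y)) \<partial>lborel \<partial>?M k)"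
  proof (rule nn_integral_cong)
    fix v assume v: "v \<in> space (?M k)"
    note [measurable] = fy[OF v]
    have "(\<integral>\<^sup>+y. f (v(k := y)) * ?w (Suc k) (v(k := y)) \<partial>lborel)
      = (\<integral>\<^sup>+y. f (v(k := y)) * ennreal (exp (- (norm y)\<^sup>2)) * ?w k v \<partial>lborel)"
      by (intro nn_integral_cong) (simp add: mult_ac)
    also have "\<dots> = f' v * ?w k v"
      unfolding f'_def by (rule nn_integral_multc) measurable
    finally show "f' v * ?w k v = (\<integral>\<^sup>+y. f (v(k := y)) * ?w (Suc k) (v(k := y)) \<partial>lborel)" ..
  qed
  also have "\<dots> = (\<integral>\<^sup>+v. f v * ?w (Suc k) v \<partial>?M (Suc k))"
    by (rule nn_integral_PL_Suc(1)[symmetric]) measurable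
  also have "ennreal (\<alpha> powr ?a) * (ennreal (((\<Prod>i<k. s i) * \<sigma> / T) powr ?a) * (\<integral>\<^sup>+v. f v * ?w (Suc k) v \<partial>?M (Suc k)))
    = ennreal (((\<Prod>i<Suc k. s i) * \<sigma> / weight_sum s \<sigma> (Suc k)) powr ?a) * (\<integral>\<^sup>+v. f v * ?w (Suc k) v \<partial>?M (Suc k))"
  proof -
    have "\<alpha> powr ?a * ((\<Prod>i<k. s i) * \<sigma> / T) powr ?a = (\<alpha> * ((\<Prod>i<k. s i) * \<sigma> / T)) powr ?a"
      by (rule powr_mult[symmetric])
    also have "\<alpha> * ((\<Prod>i<k. s i) * \<sigma> / T) = (\<Prod>i<Suc k. s i) * \<sigma> / weight_sum s \<sigma> (Suc k)"
      using T by (simp add: \<alpha>_def)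
    finally show ?thesis
      by (simp only: mult.assoc[symmetric] ennreal_mult[symmetric] powr_ge_zero)
  qed
  finally show ?case .
qed

lemma nn_integral_gauss:
  fixes t :: "'a::euclidean_space"
  assumes "S > 0"
  shows "(\<integral>\<^sup>+y. ennreal (exp (- (S * (norm (y + t))\<^sup>2))) \<partial>lborel) = ennreal ((pi / S) powr (real DIM('a) / 2))"
proof -
  have "(\<integral>\<^sup>+y. ennreal (exp (- (norm (y :: 'a))\<^sup>2)) \<partial>lborel) = (\<integral>\<^sup>+z. ennreal (exp (- (norm (z :: 'a))\<^sup>2) * norm (orth_proj UNIV z) powr 0) \<partial>lborel)"
    by (intro nn_integral_cong_AE) (use AE_lborel_singleton[of "0::'a"] in \<open>auto elim!: eventually_mono simp: orth_proj_id\<close>)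
  also have "\<dots> = ennreal (gauss_moment DIM('a) DIM('a) 0)"
    using nn_integral_gauss_orth_proj[of "UNIV :: 'a set" 0] by simp
  also have "gauss_moment DIM('a) DIM('a) 0 = pi powr (real DIM('a) / 2)"
  proof -
    define G where "G = Gamma (real DIM('a) / 2)"
    have "G > 0" unfolding G_def by (rule Gamma_real_pos) simp
    then show ?thesis by (simp add: gauss_moment_def flip: G_def)
  qed
  finally have 1: "(\<integral>\<^sup>+y. ennreal (exp (- (norm (y :: 'a))\<^sup>2)) \<partial>lborel) = ennreal (pi powr (real DIM('a) / 2))" .
  let ?c = "1 / sqrt S"
  have c: "?c > 0" using assms by simp
  have gm: "(\<lambda>y. ennreal (exp (- (S * (norm (y + t))\<^sup>2)))) \<in> borel_measurable borel"
    by measurable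
  have "(\<integral>\<^sup>+y. ennreal (exp (- (S * (norm (y + t))\<^sup>2))) \<partial>lborel)
    = ennreal (\<bar>?c\<bar> ^ DIM('a)) * (\<integral>\<^sup>+y. ennreal (exp (- (S * (norm ((- t + ?c *\<^sub>R y) + t))\<^sup>2))) \<partial>lborel)"
    using c by (intro nn_integral_lborel_affine[OF gm]) simp
  also have "\<dots> = ennreal (\<bar>?c\<bar> ^ DIM('a)) * ennreal (pi powr (real DIM('a) / 2))"
    using assms by (simp add: power_divide 1)
  also have "\<dots> = ennreal ((pi / S) powr (real DIM('a) / 2))"
  proof -
    have "?c = S powr (- 1 / 2)"
      using assms by (simp add: powr_half_sqrt[symmetric] powr_minus_divide)
    moreover have "\<bar>?c\<bar> ^ DIM('a) = ?c powr real DIM('a)"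
      using c by (simp only: powr_realpow abs_of_pos)
    ultimately have "\<bar>?c\<bar> ^ DIM('a) = S powr (- (real DIM('a) / 2))"
      by (simp add: powr_powr)
    then show ?thesis
      using assms by (simp add: powr_divide powr_minus_divide flip: ennreal_mult)
  qed
  finally show ?thesis .
qed

lemma measurable_PL_component: "i \<in> I \<Longrightarrow> (\<lambda>y. y i) \<in> borel_measurable (Pi\<^sub>M I (\<lambda>_. lborel :: 'a::euclidean_space measure))"
  using measurable_component_singleton[of i I "\<lambda>_. lborel :: 'a measure"] by simp

lemma measurable_differences:
  fixes f :: "(nat \<Rightarrow> 'a::euclidean_space) \<Rightarrow> ennreal"
  assumes f: "f \<in> borel_measurable (Pi\<^sub>M {..<k} (\<lambda>_. lborel))" and hom: "tri_homogeneous k p f"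
  shows "(\<lambda>y. f (\<lambda>i. y i - y k)) \<in> borel_measurable (Pi\<^sub>M {..<Suc k} (\<lambda>_. lborel))"
proof -
  have "(\<lambda>y. \<lambda>i\<in>{..<k}. y i - y k) \<in> Pi\<^sub>M {..<Suc k} (\<lambda>_. lborel :: 'a measure) \<rightarrow>\<^sub>M Pi\<^sub>M {..<k} (\<lambda>_. lborel)"
  proof (rule measurable_restrict)
    fix i assume "i \<in> {..<k}"
    then have "(\<lambda>y. y i - y k) \<in> borel_measurable (Pi\<^sub>M {..<Suc k} (\<lambda>_. lborel :: 'a measure))"
      by (intro borel_measurable_diff measurable_PL_component) auto
    then show "(\<lambda>y. y i - y k) \<in> Pi\<^sub>M {..<Suc k} (\<lambda>_. lborel :: 'a measure) \<rightarrow>\<^sub>M lborel" by simp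
  qed
  from measurable_compose[OF this f] show ?thesis
    using hom by (simp add: tri_homogeneous_def)
qed

text \<open>After the shift \<open>v i = y i - y k\<close> the exponent splits into
  \<open>inertia\<close>, with \<sigma> equal to \<open>s k\<close>, and \<open>S\<close> times the
  square of a translate of \<open>y k\<close>. Integrating over \<open>y k\<close> gives the power
  \<open>- DIM('a) / 2\<close> of \<open>S\<close>, and \<open>nn_integral_inertia\<close> gives the
  power \<open>(DIM('a) + p) / 2\<close>; the power \<open>p / 2\<close> remains.\<close>

lemma nn_integral_gauss_simplex:
  fixes f :: "(nat \<Rightarrow> 'a::euclidean_space) \<Rightarrow> ennreal"
  assumes f: "f \<in> borel_measurable (Pi\<^sub>M {..<k} (\<lambda>_. lborel))" and hom: "tri_homogeneous k p f"
    and s: "\<And>i. i < Suc k \<Longrightarrow> s i > 0"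
  shows "(\<integral>\<^sup>+y. f (\<lambda>i. y i - y k) * (\<Prod>i<Suc k. ennreal (exp (- (s i * (norm (y i))\<^sup>2)))) \<partial>Pi\<^sub>M {..<Suc k} (\<lambda>_. lborel))
    = ennreal (pi powr (real DIM('a) / 2) * (\<Prod>i<Suc k. s i) powr (- (real DIM('a) + p) / 2) * (\<Sum>i<Suc k. s i) powr (p / 2))
      * (\<integral>\<^sup>+v. f v * (\<Prod>i<k. ennreal (exp (- (norm (v i))\<^sup>2))) \<partial>Pi\<^sub>M {..<k} (\<lambda>_. lborel))"
proof -
  let ?M = "\<lambda>k. Pi\<^sub>M {..<k} (\<lambda>_. lborel :: 'a measure)" and ?a = "- (real DIM('a) + p) / 2"
  define S where "S = weight_sum s (s k) k"
  have S_eq: "S = (\<Sum>i<Suc k. s i)" by (simp add: S_def weight_sum_def)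
  have sk: "s k > 0" and si: "\<And>i. i < k \<Longrightarrow> s i > 0" using s by auto
  have S: "S > 0" unfolding S_def using sk si by (rule weight_sum_pos)
  define E where "E v y = (\<Prod>i<k. ennreal (exp (- (s i * (norm (v i + y))\<^sup>2)))) * ennreal (exp (- (s k * (norm y)\<^sup>2)))"
    for v :: "nat \<Rightarrow> 'a" and y
  have E_eq: "E v y = ennreal (exp (- inertia s (s k) k v)) * ennreal (exp (- (S * (norm (y + (1 / S) *\<^sub>R (\<Sum>i<k. s i *\<^sub>R v i)))\<^sup>2)))"
    for v y
  proof -
    let ?w = "\<Sum>i<k. s i *\<^sub>R v i"
    have "(\<Sum>i<k. s i * (norm (v i + y))\<^sup>2) = (\<Sum>i<k. s i * (norm (v i))\<^sup>2 + 2 * (s i * (v i \<bullet> y)) + s i * (norm y)\<^sup>2)"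
      unfolding power2_norm_eq_inner by (intro sum.cong refl) (simp add: inner_add_left inner_add_right inner_commute algebra_simps)
    also have "\<dots> = (\<Sum>i<k. s i * (norm (v i))\<^sup>2) + 2 * (?w \<bullet> y) + (\<Sum>i<k. s i) * (norm y)\<^sup>2"
      by (simp add: sum.distrib inner_sum_left sum_distrib_left sum_distrib_right)
    finally have 1: "(\<Sum>i<k. s i * (norm (v i + y))\<^sup>2) = (\<Sum>i<k. s i * (norm (v i))\<^sup>2) + 2 * (?w \<bullet> y) + (\<Sum>i<k. s i) * (norm y)\<^sup>2" .
    have "(norm (y + u *\<^sub>R ?w))\<^sup>2 = (norm y)\<^sup>2 + 2 * u * (?w \<bullet> y) + u\<^sup>2 * (norm ?w)\<^sup>2" for u
      unfolding power2_norm_eq_inner by (simp add: inner_add_left inner_add_right inner_commute power2_eq_square algebra_simps)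
    from this[of "1 / S"] have 2: "S * (norm (y + (1 / S) *\<^sub>R ?w))\<^sup>2 = S * (norm y)\<^sup>2 + 2 * (?w \<bullet> y) + (norm ?w)\<^sup>2 / S"
      using S by (simp add: distrib_left power2_eq_square)
    have 3: "(\<Sum>i<k. s i * (norm (v i + y))\<^sup>2) + s k * (norm y)\<^sup>2
      = inertia s (s k) k v + S * (norm (y + (1 / S) *\<^sub>R ?w))\<^sup>2"
      unfolding 1 2 inertia_def S_def[symmetric] by (simp add: S_eq algebra_simps)
    have "E v y = ennreal (exp (- ((\<Sum>i<k. s i * (norm (v i + y))\<^sup>2) + s k * (norm y)\<^sup>2)))"
      by (simp add: E_def prod_ennreal exp_sum sum_negf[symmetric] exp_diff exp_minus divide_inverse exp_add prod_nonneg
          flip: ennreal_mult prod_inversef)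
    also have "\<dots> = ennreal (exp (- inertia s (s k) k v)) * ennreal (exp (- (S * (norm (y + (1 / S) *\<^sub>R ?w))\<^sup>2)))"
      unfolding 3 by (simp add: ennreal_mult[symmetric] exp_add[symmetric] del: exp_add)
    finally show ?thesis .
  qed
  have m1: "(\<lambda>y. f (\<lambda>i. y i - y k) * (\<Prod>i<Suc k. ennreal (exp (- (s i * (norm (y i))\<^sup>2))))) \<in> borel_measurable (?M (Suc k))"
  proof (intro borel_measurable_times_ennreal measurable_differences[OF f hom] borel_measurable_prod_ennreal)
    fix i assume "i \<in> {..<Suc k}"
    note [measurable] = measurable_PL_component[OF this, where 'a = 'a]
    show "(\<lambda>y. ennreal (exp (- (s i * (norm (y i))\<^sup>2)))) \<in> borel_measurable (?M (Suc k))" by measurable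
  qed
  have Em: "(\<lambda>(v, y). f v * E v y) \<in> borel_measurable (?M k \<Otimes>\<^sub>M lborel)"
  proof -
    have [measurable]: "(\<lambda>x. f (fst x)) \<in> borel_measurable (?M k \<Otimes>\<^sub>M (lborel :: 'a measure))"
      by (rule measurable_compose[OF measurable_fst f])
    have [measurable]: "(\<lambda>x. fst x i) \<in> borel_measurable (?M k \<Otimes>\<^sub>M (lborel :: 'a measure))" if "i \<in> {..<k}" for i
      by (rule measurable_compose[OF measurable_fst measurable_PL_component[OF that]])
    have [measurable]: "(\<lambda>x. \<Prod>i<k. ennreal (exp (- (s i * (norm (fst x i + snd x))\<^sup>2)))) \<in> borel_measurable (?M k \<Otimes>\<^sub>M (lborel :: 'a measure))"
      by (intro borel_measurable_prod_ennreal) measurable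
    show ?thesis unfolding E_def case_prod_beta' by measurable
  qed
  interpret pair_sigma_finite "?M k" "lborel :: 'a measure"
    by (intro pair_sigma_finite.intro lb.sigma_finite lborel.sigma_finite_measure_axioms) simp
  have "(\<integral>\<^sup>+y. f (\<lambda>i. y i - y k) * (\<Prod>i<Suc k. ennreal (exp (- (s i * (norm (y i))\<^sup>2)))) \<partial>?M (Suc k))
    = (\<integral>\<^sup>+y. \<integral>\<^sup>+x. f (\<lambda>i. (x(k := y)) i - (x(k := y)) k) * (\<Prod>i<Suc k. ennreal (exp (- (s i * (norm ((x(k := y)) i))\<^sup>2)))) \<partial>?M k \<partial>lborel)"
    by (rule nn_integral_PL_Suc(2)[OF m1])
  also have "\<dots> = (\<integral>\<^sup>+y. \<integral>\<^sup>+v. f v * E v y \<partial>?M k \<partial>lborel)"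
  proof (rule nn_integral_cong)
    fix y :: 'a
    let ?G = "\<lambda>x. f (\<lambda>i. x i - y) * ((\<Prod>i<k. ennreal (exp (- (s i * (norm (x i))\<^sup>2)))) * ennreal (exp (- (s k * (norm y)\<^sup>2))))"
    have fc: "f (\<lambda>i. (x(k := y)) i - (x(k := y)) k) = f (\<lambda>i. x i - y)" for x
      by (rule tri_homogeneous_cong[OF hom]) simp
    have "(\<lambda>x. \<lambda>i\<in>{..<k}. x i - y) \<in> ?M k \<rightarrow>\<^sub>M ?M k"
    proof (rule measurable_restrict)
      fix i assume "i \<in> {..<k}"
      note [measurable] = measurable_PL_component[OF this, where 'a = 'a]
      show "(\<lambda>x. x i - y) \<in> ?M k \<rightarrow>\<^sub>M lborel" by measurable
    qed
    from measurable_compose[OF this f] have "(\<lambda>x. f (\<lambda>i. x i - y)) \<in> borel_measurable (?M k)"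
      using hom by (simp add: tri_homogeneous_def)
    moreover have "(\<lambda>x. \<Prod>i<k. ennreal (exp (- (s i * (norm (x i))\<^sup>2)))) \<in> borel_measurable (?M k)"
    proof (rule borel_measurable_prod_ennreal)
      fix i assume "i \<in> {..<k}"
      note [measurable] = measurable_PL_component[OF this, where 'a = 'a]
      show "(\<lambda>y. ennreal (exp (- (s i * (norm (y i))\<^sup>2)))) \<in> borel_measurable (?M k)" by measurable
    qed
    ultimately have Gm: "?G \<in> borel_measurable (?M k)" by simp
    have "(\<integral>\<^sup>+x. f (\<lambda>i. (x(k := y)) i - (x(k := y)) k) * (\<Prod>i<Suc k. ennreal (exp (- (s i * (norm ((x(k := y)) i))\<^sup>2)))) \<partial>?M k)
      = (\<integral>\<^sup>+x. ?G x \<partial>?M k)"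
      unfolding fc by simp
    also have "\<dots> = (\<integral>\<^sup>+x. ?G (\<lambda>i\<in>{..<k}. x i + y) \<partial>?M k)"
      using nn_integral_PiM_translate[OF finite_lessThan Gm, of "\<lambda>_. y"] by simp
    also have "\<dots> = (\<integral>\<^sup>+v. f v * E v y \<partial>?M k)"
    proof (rule nn_integral_cong)
      fix x :: "nat \<Rightarrow> 'a"
      have "f (\<lambda>i. (\<lambda>i\<in>{..<k}. x i + y) i - y) = f x"
        by (rule tri_homogeneous_cong[OF hom]) simp
      moreover have "(\<Prod>i<k. ennreal (exp (- (s i * (norm ((\<lambda>i\<in>{..<k}. x i + y) i))\<^sup>2)))) = (\<Prod>i<k. ennreal (exp (- (s i * (norm (x i + y))\<^sup>2))))"
        by (intro prod.cong) auto
      ultimately show "?G (\<lambda>i\<in>{..<k}. x i + y) = f x * E x y"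
        by (simp only: E_def)
    qed
    finally show "(\<integral>\<^sup>+x. f (\<lambda>i. (x(k := y)) i - (x(k := y)) k) * (\<Prod>i<Suc k. ennreal (exp (- (s i * (norm ((x(k := y)) i))\<^sup>2)))) \<partial>?M k)
      = (\<integral>\<^sup>+v. f v * E v y \<partial>?M k)" .
  qed
  also have "\<dots> = (\<integral>\<^sup>+v. \<integral>\<^sup>+y. f v * E v y \<partial>lborel \<partial>?M k)"
    by (rule Fubini'[OF Em])
  also have "\<dots> = (\<integral>\<^sup>+v. (f v * ennreal (exp (- inertia s (s k) k v))) * ennreal ((pi / S) powr (real DIM('a) / 2)) \<partial>?M k)"
  proof (rule nn_integral_cong)
    fix v
    show "(\<integral>\<^sup>+y. f v * E v y \<partial>lborel) = (f v * ennreal (exp (- inertia s (s k) k v))) * ennreal ((pi / S) powr (real DIM('a) / 2))"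
      unfolding E_eq mult.assoc[symmetric] by (subst nn_integral_cmult) (measurable, simp only: nn_integral_gauss[OF S])
  qed
  also have "\<dots> = (\<integral>\<^sup>+v. f v * ennreal (exp (- inertia s (s k) k v)) \<partial>?M k) * ennreal ((pi / S) powr (real DIM('a) / 2))"
  proof (rule nn_integral_multc)
    note [measurable] = f measurable_inertia
    show "(\<lambda>v. f v * ennreal (exp (- inertia s (s k) k v))) \<in> borel_measurable (?M k)" by measurable
  qed
  also have "(\<integral>\<^sup>+v. f v * ennreal (exp (- inertia s (s k) k v)) \<partial>?M k)
    = ennreal (((\<Prod>i<k. s i) * s k / S) powr ?a) * (\<integral>\<^sup>+v. f v * (\<Prod>i<k. ennreal (exp (- (norm (v i))\<^sup>2))) \<partial>?M k)"
    unfolding S_def by (rule nn_integral_inertia[OF f hom sk si])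
  also have "ennreal (((\<Prod>i<k. s i) * s k / S) powr ?a) * (\<integral>\<^sup>+v. f v * (\<Prod>i<k. ennreal (exp (- (norm (v i))\<^sup>2))) \<partial>?M k)
      * ennreal ((pi / S) powr (real DIM('a) / 2))
    = ennreal (pi powr (real DIM('a) / 2) * (\<Prod>i<Suc k. s i) powr ?a * S powr (p / 2))
      * (\<integral>\<^sup>+v. f v * (\<Prod>i<k. ennreal (exp (- (norm (v i))\<^sup>2))) \<partial>?M k)"
  proof -
    have e: "(P / S) powr x * (pi / S) powr y = pi powr y * P powr x * S powr (- x - y)" if "P > 0" for P x y
      using that S by (simp add: powr_divide powr_diff powr_minus field_simps)
    have x: "- ?a - real DIM('a) / 2 = p / 2" by (simp add: field_simps)
    have "0 < (\<Prod>i<Suc k. s i)" using s by (intro prod_pos) auto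
    from e[OF this, of ?a "real DIM('a) / 2"] have K: "((\<Prod>i<k. s i) * s k / S) powr ?a * (pi / S) powr (real DIM('a) / 2)
      = pi powr (real DIM('a) / 2) * (\<Prod>i<Suc k. s i) powr ?a * S powr (p / 2)"
      by (simp only: x prod.lessThan_Suc)
    show ?thesis
      unfolding K[symmetric] by (simp only: ennreal_mult powr_ge_zero mult_ac)
  qed
  finally show ?thesis unfolding S_eq .
qed

text \<open>An injective map distorts volumes by a factor between two positive constants, which
  reduces the claim to the identity, where the value is explicit. The lower bound serves negative
  \<open>p\<close>.\<close>

lemma gauss_pvol_finite:
  fixes A :: "'a::euclidean_space \<Rightarrow> 'a"
  assumes A: "linear A" "inj A" and k: "k \<le> DIM('a)" and p: "p > -1"
  shows "gauss_pvol k A p < \<infinity>"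
proof -
  obtain B where B: "B > 0" "\<And>x. norm (A x) \<le> B * norm x"
    using linear_bounded_pos[OF A(1)] by blast
  obtain b where b: "b > 0" "\<And>x. b * norm x \<le> norm (A x)"
    using linear_inj_bounded_below_pos[OF A] by blast
  define m where "m = max ((B ^ k) powr p) ((b ^ k) powr p)"
  have le: "pvol k (\<lambda>i. A (W i)) powr p \<le> m * pvol k W powr p" for W :: "nat \<Rightarrow> 'a"
  proof (cases "pvol k W = 0")
    case True
    then show ?thesis using pvol_linear_image_zero[OF A(1) True] by simp
  next
    case False
    let ?e = "gs_unit W"
    have e: "orthonormal_family k ?e" using False by (rule orthonormal_gs_unit)
    have up: "norm (gs (\<lambda>i. A (?e i)) i) \<le> B" if "i < k" for i
      using norm_gs_le[of "\<lambda>i. A (?e i)" i] B(2)[of "?e i"] orthonormal_family_norm[OF e that] by simp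
    \<comment> \<open>The residual is \<open>A (?e i - z)\<close> with \<open>z\<close> in the span
      of the earlier unit vectors. As \<open>?e i - z\<close> has inner product 1 with
      \<open>?e i\<close>, its norm is at least 1.\<close>
    have lo: "b \<le> norm (gs (\<lambda>i. A (?e i)) i)" if i: "i < k" for i
    proof -
      have "A (?e i) - gs (\<lambda>i. A (?e i)) i \<in> A ` span (?e ` {..<i})"
        using diff_gs_in_span[of "\<lambda>i. A (?e i)" i] by (simp add: span_linear_image_lessThan[OF A(1)])
      then obtain z where z: "z \<in> span (?e ` {..<i})" "A (?e i) - gs (\<lambda>i. A (?e i)) i = A z" by auto
      then have g: "gs (\<lambda>i. A (?e i)) i = A (?e i - z)" by (simp add: linear_diff[OF A(1)] algebra_simps)
      have "?e i \<bullet> z = 0"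
        using gs_perp[of z ?e i] z(1) gs_orthonormal[OF e i] by simp
      then have "(?e i - z) \<bullet> ?e i = 1"
        using orthonormal_familyD[OF e i i] by (simp add: inner_diff_left inner_commute[of z])
      then have "1 \<le> norm (?e i - z) * norm (?e i)"
        by (metis norm_cauchy_schwarz)
      then have "1 \<le> norm (?e i - z)" using orthonormal_family_norm[OF e i] by simp
      then have "b * 1 \<le> b * norm (?e i - z)" using b(1) by (intro mult_left_mono) auto
      then show ?thesis using b(2)[of "?e i - z"] g by simp
    qed
    have U: "pvol k (\<lambda>i. A (?e i)) \<le> B ^ k"
      using prod_mono[of "{..<k}" "\<lambda>i. norm (gs (\<lambda>i. A (?e i)) i)" "\<lambda>_. B"] up by (simp add: pvol_def)
    have L: "b ^ k \<le> pvol k (\<lambda>i. A (?e i))"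
      using prod_mono[of "{..<k}" "\<lambda>_. b" "\<lambda>i. norm (gs (\<lambda>i. A (?e i)) i)"] lo b(1) by (simp add: pvol_def)
    have "pvol k (\<lambda>i. A (?e i)) powr p \<le> m"
    proof (cases "p \<ge> 0")
      case True
      then have "pvol k (\<lambda>i. A (?e i)) powr p \<le> (B ^ k) powr p"
        using U pvol_nonneg by (intro powr_mono2) auto
      then show ?thesis by (simp add: m_def)
    next
      case False
      then have "pvol k (\<lambda>i. A (?e i)) powr p \<le> (b ^ k) powr p"
        using L b(1) by (intro powr_mono2') auto
      then show ?thesis by (simp add: m_def)
    qed
    then show ?thesis
      using pvol_linear_image[OF A(1) False]
      by (simp add: powr_mult pvol_nonneg mult_right_mono mult.commute[of m] mult_left_mono)
  qed
  have m0: "m \<ge> 0" by (simp add: m_def le_max_iff_disj)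
  have [measurable]: "(\<lambda>W. pvol k W) \<in> borel_measurable (Pi\<^sub>M {..<k} (\<lambda>_. lborel :: 'a measure))"
    by (intro borel_measurable_pvol measurable_PL_component) simp
  note [measurable] = measurable_gauss_weight[OF order_refl]
  have "gauss_pvol k A p \<le> (\<integral>\<^sup>+W. ennreal m * ((\<Prod>i<k. ennreal (exp (- (norm (W i))\<^sup>2))) * ennreal (pvol k W powr p)) \<partial>Pi\<^sub>M {..<k} (\<lambda>_. lborel :: 'a measure))"
    unfolding gauss_pvol_def
  proof (rule nn_integral_mono)
    fix W :: "nat \<Rightarrow> 'a"
    have "ennreal (pvol k (\<lambda>i. A (W i)) powr p) \<le> ennreal m * ennreal (pvol k W powr p)"
      using le[of W] m0 by (simp add: ennreal_mult[symmetric])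
    then have "(\<Prod>i<k. ennreal (exp (- (norm (W i))\<^sup>2))) * ennreal (pvol k (\<lambda>i. A (W i)) powr p)
      \<le> (\<Prod>i<k. ennreal (exp (- (norm (W i))\<^sup>2))) * (ennreal m * ennreal (pvol k W powr p))"
      by (rule mult_left_mono) simp
    then show "(\<Prod>i<k. ennreal (exp (- (norm (W i))\<^sup>2))) * ennreal (pvol k (\<lambda>i. A (W i)) powr p)
      \<le> ennreal m * ((\<Prod>i<k. ennreal (exp (- (norm (W i))\<^sup>2))) * ennreal (pvol k W powr p))"
      by (simp only: mult.left_commute)
  qed
  also have "\<dots> = ennreal m * gauss_pvol k (orth_proj (UNIV :: 'a set)) p"
    unfolding gauss_pvol_def by (subst nn_integral_cmult) (measurable, simp only: orth_proj_id[OF subspace_UNIV UNIV_I])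
  also have "\<dots> < \<infinity>"
    using gauss_pvol_orth_proj[of "UNIV :: 'a set" k p] k p by (simp add: ennreal_mult_less_top)
  finally show ?thesis .
qed

section \<open>Simplices in a ball\<close>

lemma ennreal_times_assoc:
  "0 \<le> x \<Longrightarrow> 0 \<le> y \<Longrightarrow> ennreal x * (ennreal y * C) = ennreal (x * y) * C"
  "0 \<le> x \<Longrightarrow> 0 \<le> y \<Longrightarrow> 0 \<le> z \<Longrightarrow> ennreal x * C * ennreal y * ennreal z = ennreal (x * y * z) * C"
  by (simp_all add: ennreal_mult mult_ac)

lemma nn_integral_Beta:
  assumes "a > 0" "b > 0"
  shows "(\<integral>\<^sup>+t. ennreal (t powr (a - 1) * (1 - t) powr (b - 1)) * indicator {0..1} t \<partial>lborel) = ennreal (Beta a b)"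
proof -
  have "((\<lambda>t. t powr (a - 1) * (1 - t) powr (b - 1)) has_integral Beta a b) {0..1}"
    using assms by (rule has_integral_Beta_real)
  from nn_integral_has_integral_lebesgue[OF _ this] show ?thesis
    by (simp add: ennreal_mult' ennreal_indicator mult.commute)
qed

lemma nn_integral_density_pair:
  assumes "sigma_finite_measure N1" "sigma_finite_measure N2"
    and [measurable]: "h \<in> borel_measurable N1" "F \<in> borel_measurable N2" "\<Psi> \<in> borel_measurable (N1 \<Otimes>\<^sub>M N2)"
  shows "(\<integral>\<^sup>+x. \<Psi> x \<partial>density (N1 \<Otimes>\<^sub>M N2) (\<lambda>x. h (fst x) * F (snd x))) = (\<integral>\<^sup>+u. h u * (\<integral>\<^sup>+y. F y * \<Psi> (u, y) \<partial>N2) \<partial>N1)"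
proof -
  interpret N2: sigma_finite_measure N2 by fact
  have "(\<integral>\<^sup>+x. \<Psi> x \<partial>density (N1 \<Otimes>\<^sub>M N2) (\<lambda>x. h (fst x) * F (snd x))) = (\<integral>\<^sup>+x. h (fst x) * F (snd x) * \<Psi> x \<partial>(N1 \<Otimes>\<^sub>M N2))"
    by (rule nn_integral_density) measurable
  also have "\<dots> = (\<integral>\<^sup>+u. \<integral>\<^sup>+y. h u * F y * \<Psi> (u, y) \<partial>N2 \<partial>N1)"
  proof -
    have "(\<lambda>x. h (fst x) * F (snd x) * \<Psi> x) \<in> borel_measurable (N1 \<Otimes>\<^sub>M N2)" by measurable
    from N2.nn_integral_fst[OF this] show ?thesis by simp
  qed
  also have "\<dots> = (\<integral>\<^sup>+u. h u * (\<integral>\<^sup>+y. F y * \<Psi> (u, y) \<partial>N2) \<partial>N1)"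
  proof (rule nn_integral_cong)
    fix u assume [measurable]: "u \<in> space N1"
    have "(\<lambda>y. F y * \<Psi> (u, y)) \<in> borel_measurable N2" by measurable
    from nn_integral_cmult[OF this, of "h u"]
    show "(\<integral>\<^sup>+y. h u * F y * \<Psi> (u, y) \<partial>N2) = h u * (\<integral>\<^sup>+y. F y * \<Psi> (u, y) \<partial>N2)"
      by (simp only: mult.assoc)
  qed
  finally show ?thesis .
qed

lemma nn_integral_PiM_scale:
  fixes H :: "('i \<Rightarrow> 'a::euclidean_space) \<Rightarrow> ennreal"
  assumes "finite I" "H \<in> borel_measurable (Pi\<^sub>M I (\<lambda>_. lborel))" "c > 0"
  shows "(\<integral>\<^sup>+y. H y \<partial>Pi\<^sub>M I (\<lambda>_. lborel)) = ennreal (c ^ (DIM('a) * card I)) * (\<integral>\<^sup>+y. H (\<lambda>i\<in>I. c *\<^sub>R y i) \<partial>Pi\<^sub>M I (\<lambda>_. lborel))"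
proof -
  let ?K = "ennreal (1 / c ^ DIM('a))"
  have K: "(\<integral>\<^sup>+x. g (c *\<^sub>R x) * 1 \<partial>lborel) = ?K * (\<integral>\<^sup>+x. g x \<partial>lborel)" if "g \<in> borel_measurable lborel" for g :: "'a \<Rightarrow> ennreal"
  proof -
    have "?K * (\<integral>\<^sup>+x. g x \<partial>lborel) = ?K * (ennreal (c ^ DIM('a)) * (\<integral>\<^sup>+x. g (c *\<^sub>R x) \<partial>lborel))"
      using nn_integral_lborel_affine[of g c 0] that assms(3) by simp
    also have "\<dots> = (\<integral>\<^sup>+x. g (c *\<^sub>R x) \<partial>lborel)"
      using assms(3) by (simp add: mult.assoc[symmetric] ennreal_mult[symmetric])
    finally show ?thesis by simp
  qed
  have "(\<integral>\<^sup>+x. H (\<lambda>i\<in>I. c *\<^sub>R x i) * (\<Prod>i\<in>I. 1) \<partial>Pi\<^sub>M I (\<lambda>_. lborel)) = (\<Prod>i\<in>I. ?K) * (\<integral>\<^sup>+x. H x \<partial>Pi\<^sub>M I (\<lambda>_. lborel))"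
    by (rule nn_integral_PiM_transform[where f = "\<lambda>_ x. c *\<^sub>R x" and w = "\<lambda>_ _. 1" and K = "\<lambda>_. ?K"])
      (use assms K in \<open>simp_all add: lb.product_sigma_finite_axioms\<close>)
  then have "(\<integral>\<^sup>+x. H (\<lambda>i\<in>I. c *\<^sub>R x i) \<partial>Pi\<^sub>M I (\<lambda>_. lborel)) = ennreal (1 / c ^ (DIM('a) * card I)) * (\<integral>\<^sup>+x. H x \<partial>Pi\<^sub>M I (\<lambda>_. lborel))"
    using assms(3) by (simp add: ennreal_power power_mult power_one_over)
  then have "ennreal (c ^ (DIM('a) * card I)) * (\<integral>\<^sup>+y. H (\<lambda>i\<in>I. c *\<^sub>R y i) \<partial>Pi\<^sub>M I (\<lambda>_. lborel))
    = (ennreal (c ^ (DIM('a) * card I)) * ennreal (1 / c ^ (DIM('a) * card I))) * (\<integral>\<^sup>+x. H x \<partial>Pi\<^sub>M I (\<lambda>_. lborel))"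
    by (simp only: mult.assoc)
  also have "ennreal (c ^ (DIM('a) * card I)) * ennreal (1 / c ^ (DIM('a) * card I)) = 1"
    using assms(3) by (simp flip: ennreal_mult)
  finally show ?thesis by (simp only: mult_1_left)
qed

text \<open>The k + 1 Lebesgue measures contribute \<open>DIM('a) * Suc k\<close> to the exponent,
  and the p-th power of a k-dimensional volume contributes \<open>k * p\<close>.\<close>

lemma ball_simplex_scale:
  fixes A :: "'a::euclidean_space \<Rightarrow> 'a" and k :: nat and p :: real
  assumes A: "linear A" and c: "c > 0"
  defines "F \<equiv> \<lambda>y. ennreal (pvol k (\<lambda>i. A (y i - y k)) powr p)"
  shows "(\<integral>\<^sup>+y. F y * (\<Prod>i<Suc k. indicator {..c\<^sup>2} ((norm (y i))\<^sup>2)) \<partial>Pi\<^sub>M {..<Suc k} (\<lambda>_. lborel))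
    = ennreal (c powr (DIM('a) * Suc k + k * p)) * (\<integral>\<^sup>+y. F y * (\<Prod>i<Suc k. indicator (cball 0 1) (y i)) \<partial>Pi\<^sub>M {..<Suc k} (\<lambda>_. lborel))"
    and "F \<in> borel_measurable (Pi\<^sub>M {..<Suc k} (\<lambda>_. lborel))"
proof -
  let ?M = "Pi\<^sub>M {..<Suc k} (\<lambda>_. lborel :: 'a measure)"
  have fm: "(\<lambda>v. ennreal (pvol k (\<lambda>i. A (v i)) powr p)) \<in> borel_measurable (Pi\<^sub>M {..<k} (\<lambda>_. lborel :: 'a measure))"
    using measurable_pvol_linear[OF A, of k] by measurable
  show Fm [measurable]: "F \<in> borel_measurable ?M"
    unfolding F_def by (rule measurable_differences[OF fm tri_homogeneous_pvol[OF A]])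
  have im [measurable]: "(\<lambda>y. \<Prod>i<Suc k. indicator S (y i) :: ennreal) \<in> borel_measurable ?M"
    if "S \<in> sets borel" for S :: "'a set"
    using that by (intro borel_measurable_prod_ennreal measurable_compose[OF measurable_PL_component]) auto
  have [measurable]: "(\<lambda>y. \<Prod>i<Suc k. indicator {..c\<^sup>2} ((norm (y i))\<^sup>2) :: ennreal) \<in> borel_measurable ?M"
  proof (rule borel_measurable_prod_ennreal)
    fix i assume "i \<in> {..<Suc k}"
    note [measurable] = measurable_PL_component[OF this, where 'a = 'a]
    show "(\<lambda>y. indicator {..c\<^sup>2} ((norm (y i))\<^sup>2) :: ennreal) \<in> borel_measurable ?M" by measurable
  qed
  have cb: "cball (0::'a) 1 \<in> sets borel" by (intro borel_closed closed_cball)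
  note [measurable] = im[OF cb]
  have eq: "F (\<lambda>i\<in>{..<Suc k}. c *\<^sub>R y i) * (\<Prod>i<Suc k. indicator {..c\<^sup>2} ((norm ((\<lambda>i\<in>{..<Suc k}. c *\<^sub>R y i) i))\<^sup>2))
    = ennreal (c powr (k * p)) * (F y * (\<Prod>i<Suc k. indicator (cball 0 1) (y i)))" for y
  proof -
    have "pvol k (\<lambda>i. A ((\<lambda>i\<in>{..<Suc k}. c *\<^sub>R y i) i - (\<lambda>i\<in>{..<Suc k}. c *\<^sub>R y i) k)) = pvol k (\<lambda>i. c *\<^sub>R A (y i - y k))"
      by (rule pvol_cong) (simp add: linear_scale[OF A, symmetric] scaleR_diff_right)
    also have "\<dots> = c ^ k * pvol k (\<lambda>i. A (y i - y k))"
      using c by (simp add: pvol_scaleR)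
    finally have 1: "F (\<lambda>i\<in>{..<Suc k}. c *\<^sub>R y i) = ennreal (c powr (k * p)) * F y"
      using c unfolding F_def by (simp add: powr_mult pvol_nonneg powr_powr flip: powr_realpow ennreal_mult)
    have 2: "(\<Prod>i<Suc k. indicator {..c\<^sup>2} ((norm ((\<lambda>i\<in>{..<Suc k}. c *\<^sub>R y i) i))\<^sup>2)) = (\<Prod>i<Suc k. indicator (cball 0 1) (y i) :: ennreal)"
    proof (rule prod.cong)
      fix i assume i: "i \<in> {..<Suc k}"
      have "(norm (c *\<^sub>R y i))\<^sup>2 \<le> c\<^sup>2 \<longleftrightarrow> norm (y i) \<le> 1"
        using c by (simp add: power_mult_distrib abs_square_le_1)
      then show "indicator {..c\<^sup>2} ((norm ((\<lambda>i\<in>{..<Suc k}. c *\<^sub>R y i) i))\<^sup>2) = (indicator (cball 0 1) (y i) :: ennreal)"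
        using i by (simp add: indicator_def)
    qed simp
    show ?thesis unfolding 1 2 by (simp only: mult.assoc)
  qed
  have "(\<integral>\<^sup>+y. F y * (\<Prod>i<Suc k. indicator {..c\<^sup>2} ((norm (y i))\<^sup>2)) \<partial>?M)
    = ennreal (c ^ (DIM('a) * card {..<Suc k})) * (\<integral>\<^sup>+y. F (\<lambda>i\<in>{..<Suc k}. c *\<^sub>R y i) * (\<Prod>i<Suc k. indicator {..c\<^sup>2} ((norm ((\<lambda>i\<in>{..<Suc k}. c *\<^sub>R y i) i))\<^sup>2)) \<partial>?M)"
    by (rule nn_integral_PiM_scale) (simp, measurable, rule c)
  also have "\<dots> = ennreal (c ^ (DIM('a) * Suc k)) * (ennreal (c powr (k * p)) * (\<integral>\<^sup>+y. F y * (\<Prod>i<Suc k. indicator (cball 0 1) (y i)) \<partial>?M))"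
    unfolding eq card_lessThan by (subst nn_integral_cmult[OF borel_measurable_times_ennreal[OF Fm im[OF cb]]]) (rule refl)
  also have "\<dots> = ennreal (c powr (DIM('a) * Suc k + k * p)) * (\<integral>\<^sup>+y. F y * (\<Prod>i<Suc k. indicator (cball 0 1) (y i)) \<partial>?M)"
  proof -
    have "c ^ (DIM('a) * Suc k) * c powr (k * p) = c powr (DIM('a) * Suc k + k * p)"
      using c by (simp only: powr_add powr_realpow)
    then show ?thesis
      using c by (simp only: mult.assoc[symmetric] ennreal_mult[symmetric] zero_le_power less_imp_le powr_ge_zero)
  qed
  finally show "(\<integral>\<^sup>+y. F y * (\<Prod>i<Suc k. indicator {..c\<^sup>2} ((norm (y i))\<^sup>2)) \<partial>?M)
    = ennreal (c powr (DIM('a) * Suc k + k * p)) * (\<integral>\<^sup>+y. F y * (\<Prod>i<Suc k. indicator (cball 0 1) (y i)) \<partial>?M)" .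
qed

text \<open>Under the first law, all \<open>|y i|^2 + u\<close> are at most 1 iff the points lie in
  the ball of radius \<open>sqrt (1 - u)\<close>; scaling turns the integral over \<open>u\<close>
  into \<open>Beta b (D + 1)\<close>. Under the second, each Gamma variable contributes
  \<open>(1 - u) powr a / a\<close>, and the integral over \<open>u\<close> is
  \<open>Beta \<beta> (Suc k * a + 1)\<close>, up to constants. The stated constant is the quotient,
  with \<open>a * Gamma a = Gamma (a + 1)\<close>.\<close>

lemma ball_simplex_moment:
  fixes A :: "'a::euclidean_space \<Rightarrow> 'a" and k :: nat and p a D :: real
  assumes A: "linear A" "inj A" and k: "k \<le> DIM('a)" and p: "p > -1"
  defines "a \<equiv> (DIM('a) + p) / 2" and "D \<equiv> (DIM('a) * Suc k + k * p) / 2"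
  shows "(\<integral>\<^sup>+y. ennreal (pvol k (\<lambda>i. A (y i - y k)) powr p) * (\<Prod>i<Suc k. indicator (cball 0 1) (y i)) \<partial>Pi\<^sub>M {..<Suc k} (\<lambda>_. lborel))
    = ennreal (pi powr (DIM('a) / 2) * Gamma (Suc k * a + 1) / (Gamma (D + 1) * Gamma (a + 1) ^ Suc k)) * gauss_pvol k A p"
proof -
  let ?n = "Suc k" and ?MY = "Pi\<^sub>M {..<Suc k} (\<lambda>_. lborel :: 'a measure)" and ?MR = "Pi\<^sub>M {..<Suc k} (\<lambda>_. lborel :: real measure)"
  define F where "F y = ennreal (pvol k (\<lambda>i. A (y i - y k)) powr p)" for y :: "nat \<Rightarrow> 'a"
  define G where "G = (\<integral>\<^sup>+y. F y * (\<Prod>i<?n. indicator (cball 0 1) (y i)) \<partial>?MY)"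
  define C where "C = gauss_pvol k A p"
  \<comment> \<open>Any \<open>b\<close> with \<open>b > 0\<close> and \<open>b > p / 2\<close> would do.\<close>
  define b where "b = \<bar>p\<bar> / 2 + 1"
  \<comment> \<open>The factor \<open>S powr (p / 2)\<close> turns the \<open>S powr (- b)\<close>
    of the common variable into \<open>S powr (- \<beta>)\<close>.\<close>
  define \<beta> where "\<beta> = b - p / 2"
  \<comment> \<open>Chosen so that the transforms in \<open>lapM\<close> and \<open>lapN\<close> get
    the same constant.\<close>
  define c where "c = pi powr (DIM('a) / 2) * Gamma b / (Gamma \<beta> * Gamma a ^ ?n)"
  have d1: "real DIM('a) \<ge> 1" by (simp add: Suc_leI)
  have "real DIM('a) + p > 0" using p d1 by linarith
  then have a: "a > 0" by (simp add: a_def)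
  have b: "b > 0" by (simp add: b_def)
  have \<beta>: "\<beta> > 0" by (simp add: \<beta>_def b_def)
  have D: "D > 0"
  proof -
    define x where "x = real k * p"
    define z where "z = real (DIM('a) * Suc k)"
    have "real k * (-1) \<le> x" unfolding x_def using p by (intro mult_left_mono) auto
    moreover have "1 * real (Suc k) \<le> z" unfolding z_def of_nat_mult using d1 by (intro mult_right_mono) auto
    ultimately have "0 < z + x" by simp
    then show ?thesis by (simp only: D_def x_def z_def) simp
  qed
  have c: "c > 0" using b \<beta> a by (simp add: c_def Gamma_real_pos)
  have Cfin: "C < \<infinity>" unfolding C_def by (rule gauss_pvol_finite[OF A k p])
  \<comment> \<open>Gamma densities of shapes \<open>b\<close>, \<beta> and, for \<rho>,
    \<open>a\<close>, without normalization and without the exponential factor, which the Laplace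
    transform supplies.\<close>
  define h where "h u = ennreal (u powr (b - 1)) * indicator {0..} u" for u :: real
  define h2 where "h2 u = ennreal c * C * (ennreal (u powr (\<beta> - 1)) * indicator {0..} u)" for u :: real
  define \<rho> where "\<rho> r = ennreal (r powr (a - 1)) * indicator {0..} r" for r :: real
  define R where "R r = (\<Prod>i<?n. \<rho> (r i))" for r :: "nat \<Rightarrow> real"
  have [measurable]: "h \<in> borel_measurable borel" "h2 \<in> borel_measurable borel" "\<rho> \<in> borel_measurable borel"
    unfolding h_def h2_def \<rho>_def by measurable
  have Fm [measurable]: "F \<in> borel_measurable ?MY"
    unfolding F_def by (rule ball_simplex_scale(2)[OF A(1) zero_less_one])
  have cR: "(\<lambda>y. y i) \<in> borel_measurable ?MR" if "i < ?n" for i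
    using that by (intro measurable_PL_component) auto
  have cY: "(\<lambda>y. y i) \<in> borel_measurable ?MY" if "i < ?n" for i
    using that by (intro measurable_PL_component) auto
  have Rm [measurable]: "R \<in> borel_measurable ?MR"
    unfolding R_def by (intro borel_measurable_prod_ennreal measurable_compose[OF cR]) auto
  have sfY: "sigma_finite_measure ?MY" and sfR: "sigma_finite_measure ?MR"
    by (auto intro: lb.sigma_finite)
  \<comment> \<open>\<open>X\<close> under \<open>M\<close> and \<open>Y\<close> under \<open>N\<close> have the same joint Laplace transform.\<close>
  define M where "M = density (lborel \<Otimes>\<^sub>M ?MY) (\<lambda>x. h (fst x) * F (snd x))"
  define N where "N = density (lborel \<Otimes>\<^sub>M ?MR) (\<lambda>x. h2 (fst x) * R (snd x))"
  define X where "X i x = (norm (snd x i))\<^sup>2 + fst x" for i :: nat and x :: "real \<times> (nat \<Rightarrow> 'a)"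
  define Y where "Y i x = snd x i + fst x" for i :: nat and x :: "real \<times> (nat \<Rightarrow> real)"
  have XmP: "X i \<in> borel_measurable (lborel \<Otimes>\<^sub>M ?MY)" if "i < ?n" for i
  proof -
    note [measurable] = measurable_compose[OF measurable_snd cY[OF that]]
    show ?thesis unfolding X_def by measurable
  qed
  have YmP: "Y i \<in> borel_measurable (lborel \<Otimes>\<^sub>M ?MR)" if "i < ?n" for i
  proof -
    note [measurable] = measurable_compose[OF measurable_snd cR[OF that]]
    show ?thesis unfolding Y_def by measurable
  qed
  have Xm: "X i \<in> borel_measurable M" if "i < ?n" for i
    using XmP[OF that] by (simp add: M_def)
  have Ym: "Y i \<in> borel_measurable N" if "i < ?n" for i
    using YmP[OF that] by (simp add: N_def)
  have dM: "(\<lambda>x. h (fst x) * F (snd x)) \<in> borel_measurable (lborel \<Otimes>\<^sub>M ?MY)"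
    and dN: "(\<lambda>x. h2 (fst x) * R (snd x)) \<in> borel_measurable (lborel \<Otimes>\<^sub>M ?MR)"
    by measurable
  have Xnn: "AE x in M. 0 \<le> X i x" for i
    unfolding M_def AE_density[OF dM]
    by (rule AE_I2) (auto simp: h_def X_def indicator_def split: if_splits)
  have Ynn: "AE x in N. 0 \<le> Y i x" if "i < ?n" for i
    unfolding N_def AE_density[OF dN]
  proof (rule AE_I2, rule impI)
    fix x :: "real \<times> (nat \<Rightarrow> real)" assume "0 < h2 (fst x) * R (snd x)"
    then have h: "h2 (fst x) \<noteq> 0" and R: "R (snd x) \<noteq> 0" by auto
    have "fst x \<ge> 0"
      using h by (auto simp: h2_def indicator_def split: if_splits)
    moreover have "\<rho> (snd x i) \<noteq> 0"
      using R that by (simp add: R_def del: prod.lessThan_Suc)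
    ultimately show "0 \<le> Y i x" by (auto simp: Y_def \<rho>_def indicator_def split: if_splits)
  qed
  have intM: "(\<integral>\<^sup>+x. (\<Prod>i<?n. g i (X i x)) \<partial>M) = (\<integral>\<^sup>+u. h u * (\<integral>\<^sup>+y. F y * (\<Prod>i<?n. g i ((norm (y i))\<^sup>2 + u)) \<partial>?MY) \<partial>lborel)"
    if g: "\<And>i. g i \<in> borel_measurable borel" for g :: "nat \<Rightarrow> real \<Rightarrow> ennreal"
  proof -
    have "(\<lambda>x. \<Prod>i<?n. g i (X i x)) \<in> borel_measurable (lborel \<Otimes>\<^sub>M ?MY)"
      by (intro borel_measurable_prod_ennreal measurable_compose[OF XmP g]) auto
    from nn_integral_density_pair[OF lborel.sigma_finite_measure_axioms sfY _ Fm this, of h]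
    show ?thesis by (simp add: M_def X_def)
  qed
  have intN: "(\<integral>\<^sup>+x. (\<Prod>i<?n. g i (Y i x)) \<partial>N) = (\<integral>\<^sup>+u. h2 u * (\<Prod>i<?n. \<integral>\<^sup>+r. \<rho> r * g i (r + u) \<partial>lborel) \<partial>lborel)"
    if g [measurable]: "\<And>i. g i \<in> borel_measurable borel" for g :: "nat \<Rightarrow> real \<Rightarrow> ennreal"
  proof -
    have "(\<lambda>x. \<Prod>i<?n. g i (Y i x)) \<in> borel_measurable (lborel \<Otimes>\<^sub>M ?MR)"
      by (intro borel_measurable_prod_ennreal measurable_compose[OF YmP g]) auto
    from nn_integral_density_pair[OF lborel.sigma_finite_measure_axioms sfR _ Rm this, of h2]
    have "(\<integral>\<^sup>+x. (\<Prod>i<?n. g i (Y i x)) \<partial>N) = (\<integral>\<^sup>+u. h2 u * (\<integral>\<^sup>+r. R r * (\<Prod>i<?n. g i (r i + u)) \<partial>?MR) \<partial>lborel)"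
      by (simp add: N_def Y_def)
    also have "(\<lambda>u. \<integral>\<^sup>+r. R r * (\<Prod>i<?n. g i (r i + u)) \<partial>?MR) = (\<lambda>u. \<Prod>i<?n. \<integral>\<^sup>+r. \<rho> r * g i (r + u) \<partial>lborel)"
    proof
      fix u
      have "(\<integral>\<^sup>+r. R r * (\<Prod>i<?n. g i (r i + u)) \<partial>?MR) = (\<integral>\<^sup>+r. (\<Prod>i<?n. \<rho> (r i) * g i (r i + u)) \<partial>?MR)"
        by (simp only: R_def prod.distrib)
      also have "\<dots> = (\<Prod>i<?n. \<integral>\<^sup>+r. \<rho> r * g i (r + u) \<partial>lborel)"
        by (rule lb.product_nn_integral_prod) simp_all
      finally show "(\<integral>\<^sup>+r. R r * (\<Prod>i<?n. g i (r i + u)) \<partial>?MR) = (\<Prod>i<?n. \<integral>\<^sup>+r. \<rho> r * g i (r + u) \<partial>lborel)" .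
    qed
    finally show ?thesis .
  qed
  have hom: "tri_homogeneous k p (\<lambda>v. ennreal (pvol k (\<lambda>i. A (v i)) powr p))"
    by (rule tri_homogeneous_pvol[OF A(1)])
  have fm: "(\<lambda>v. ennreal (pvol k (\<lambda>i. A (v i)) powr p)) \<in> borel_measurable (Pi\<^sub>M {..<k} (\<lambda>_. lborel :: 'a measure))"
    using measurable_pvol_linear[OF A(1), of k] by measurable
  have lapM: "(\<integral>\<^sup>+x. (\<Prod>i<?n. ennreal (exp (- (s i * X i x)))) \<partial>M)
      = ennreal (pi powr (DIM('a) / 2) * Gamma b * (\<Prod>i<?n. s i) powr (- a) * (\<Sum>i<?n. s i) powr (- \<beta>)) * C"
    (is "?L = _") if s: "\<And>i. i < ?n \<Longrightarrow> s i > 0" for s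
  proof -
    define S where "S = (\<Sum>i<?n. s i)"
    define \<Phi> where "\<Phi> = ennreal (pi powr (DIM('a) / 2) * (\<Prod>i<?n. s i) powr (- a) * S powr (p / 2)) * C"
    have S: "S > 0" unfolding S_def using s by (intro sum_pos) auto
    have "?L = (\<integral>\<^sup>+u. h u * (\<integral>\<^sup>+y. F y * (\<Prod>i<?n. ennreal (exp (- (s i * ((norm (y i))\<^sup>2 + u))))) \<partial>?MY) \<partial>lborel)"
      by (rule intM[of "\<lambda>i r. ennreal (exp (- (s i * r)))"]) measurable
    also have "\<dots> = (\<integral>\<^sup>+u. (ennreal (exp (- (S * u)) * u powr (b - 1)) * indicator {0..} u) * \<Phi> \<partial>lborel)"
    proof (rule nn_integral_cong)
      fix u :: real
      have e: "(\<Prod>i<?n. ennreal (exp (- (s i * ((norm (y i))\<^sup>2 + u))))) = ennreal (exp (- (S * u))) * (\<Prod>i<?n. ennreal (exp (- (s i * (norm (y i))\<^sup>2))))"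
        for y :: "nat \<Rightarrow> 'a"
      proof -
        have "(\<Prod>i<?n. ennreal (exp (- (s i * ((norm (y i))\<^sup>2 + u))))) = (\<Prod>i<?n. ennreal (exp (- (s i * u))) * ennreal (exp (- (s i * (norm (y i))\<^sup>2))))"
          by (intro prod.cong refl) (simp add: algebra_simps flip: ennreal_mult exp_add)
        also have "\<dots> = (\<Prod>i<?n. ennreal (exp (- (s i * u)))) * (\<Prod>i<?n. ennreal (exp (- (s i * (norm (y i))\<^sup>2))))"
          by (rule prod.distrib)
        also have "(\<Prod>i<?n. ennreal (exp (- (s i * u)))) = ennreal (\<Prod>i<?n. exp (- (s i * u)))"
          by (rule prod_ennreal) simp
        also have "(\<Prod>i<?n. exp (- (s i * u))) = exp (\<Sum>i<?n. - (s i * u))"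
          by (rule exp_sum[symmetric]) simp
        also have "(\<Sum>i<?n. - (s i * u)) = - (S * u)"
          by (simp only: S_def sum_negf sum_distrib_right)
        finally show ?thesis .
      qed
      have m: "(\<lambda>y. F y * (\<Prod>i<?n. ennreal (exp (- (s i * (norm (y i))\<^sup>2))))) \<in> borel_measurable ?MY"
      proof (intro borel_measurable_times_ennreal Fm borel_measurable_prod_ennreal)
        fix i assume "i \<in> {..<?n}"
        then have "i < ?n" by simp
        note [measurable] = cY[OF this]
        show "(\<lambda>y. ennreal (exp (- (s i * (norm (y i))\<^sup>2)))) \<in> borel_measurable ?MY" by measurable
      qed
      have "(\<integral>\<^sup>+y. F y * (\<Prod>i<?n. ennreal (exp (- (s i * ((norm (y i))\<^sup>2 + u))))) \<partial>?MY)
        = (\<integral>\<^sup>+y. ennreal (exp (- (S * u))) * (F y * (\<Prod>i<?n. ennreal (exp (- (s i * (norm (y i))\<^sup>2))))) \<partial>?MY)"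
        unfolding e by (simp only: mult.left_commute)
      also have "\<dots> = ennreal (exp (- (S * u))) * (\<integral>\<^sup>+y. F y * (\<Prod>i<?n. ennreal (exp (- (s i * (norm (y i))\<^sup>2)))) \<partial>?MY)"
        by (rule nn_integral_cmult[OF m])
      also have "(\<integral>\<^sup>+y. F y * (\<Prod>i<?n. ennreal (exp (- (s i * (norm (y i))\<^sup>2)))) \<partial>?MY) = \<Phi>"
      proof -
        have "gauss_pvol k A p = (\<integral>\<^sup>+v. ennreal (pvol k (\<lambda>i. A (v i)) powr p) * (\<Prod>i<k. ennreal (exp (- (norm (v i))\<^sup>2))) \<partial>Pi\<^sub>M {..<k} (\<lambda>_. lborel :: 'a measure))"
          unfolding gauss_pvol_def by (simp only: mult.commute)
        moreover have "- (real DIM('a) + p) / 2 = - a" by (simp only: a_def minus_divide_left)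
        ultimately show ?thesis
          using nn_integral_gauss_simplex[OF fm hom s] unfolding F_def \<Phi>_def C_def S_def by (simp only:)
      qed
      finally have inn: "(\<integral>\<^sup>+y. F y * (\<Prod>i<?n. ennreal (exp (- (s i * ((norm (y i))\<^sup>2 + u))))) \<partial>?MY) = ennreal (exp (- (S * u))) * \<Phi>" .
      show "h u * (\<integral>\<^sup>+y. F y * (\<Prod>i<?n. ennreal (exp (- (s i * ((norm (y i))\<^sup>2 + u))))) \<partial>?MY)
        = (ennreal (exp (- (S * u)) * u powr (b - 1)) * indicator {0..} u) * \<Phi>"
        unfolding inn h_def by (simp only: ennreal_mult exp_ge_zero powr_ge_zero mult_ac)
    qed
    also have "\<dots> = ennreal (Gamma b / S powr b) * \<Phi>"
      by (subst nn_integral_multc) (measurable, simp only: nn_integral_Gamma[OF b S])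
    also have "\<dots> = ennreal (pi powr (DIM('a) / 2) * Gamma b * (\<Prod>i<?n. s i) powr (- a) * S powr (- \<beta>)) * C"
    proof -
      have e: "S powr (- \<beta>) = S powr (p / 2) / S powr b"
        by (simp add: \<beta>_def powr_diff[symmetric])
      have K: "pi powr (DIM('a) / 2) * Gamma b * (\<Prod>i<?n. s i) powr (- a) * S powr (- \<beta>)
        = (Gamma b / S powr b) * (pi powr (DIM('a) / 2) * (\<Prod>i<?n. s i) powr (- a) * S powr (p / 2))"
        unfolding e by simp
      have "0 \<le> Gamma b / S powr b" using b by (simp add: Gamma_real_nonneg)
      moreover have "0 \<le> pi powr (DIM('a) / 2) * (\<Prod>i<?n. s i) powr (- a) * S powr (p / 2)" by simp
      ultimately show ?thesis
        unfolding \<Phi>_def K by (rule ennreal_times_assoc(1))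
    qed
    finally show ?thesis unfolding S_def .
  qed
  have lapN: "(\<integral>\<^sup>+x. (\<Prod>i<?n. ennreal (exp (- (s i * Y i x)))) \<partial>N)
      = ennreal (pi powr (DIM('a) / 2) * Gamma b * (\<Prod>i<?n. s i) powr (- a) * (\<Sum>i<?n. s i) powr (- \<beta>)) * C"
    (is "?L = _") if s: "\<And>i. i < ?n \<Longrightarrow> s i > 0" for s
  proof -
    define S where "S = (\<Sum>i<?n. s i)"
    define \<Gamma> where "\<Gamma> = Gamma a ^ ?n * (\<Prod>i<?n. s i) powr (- a)"
    have S: "S > 0" unfolding S_def using s by (intro sum_pos) auto
    have \<Gamma>0: "\<Gamma> \<ge> 0" using a by (simp add: \<Gamma>_def Gamma_real_nonneg)
    have "?L = (\<integral>\<^sup>+u. h2 u * (\<Prod>i<?n. \<integral>\<^sup>+r. \<rho> r * ennreal (exp (- (s i * (r + u)))) \<partial>lborel) \<partial>lborel)"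
      by (rule intN[of "\<lambda>i r. ennreal (exp (- (s i * r)))"]) measurable
    also have "\<dots> = (\<integral>\<^sup>+u. (ennreal c * C * ennreal \<Gamma>) * (ennreal (exp (- (S * u)) * u powr (\<beta> - 1)) * indicator {0..} u) \<partial>lborel)"
    proof (rule nn_integral_cong)
      fix u :: real
      have "(\<Prod>i<?n. \<integral>\<^sup>+r. \<rho> r * ennreal (exp (- (s i * (r + u)))) \<partial>lborel) = (\<Prod>i<?n. ennreal (exp (- (s i * u)) * (Gamma a / s i powr a)))"
      proof (rule prod.cong)
        fix i assume "i \<in> {..<?n}"
        then have si: "s i > 0" using s by simp
        have "(\<integral>\<^sup>+r. \<rho> r * ennreal (exp (- (s i * (r + u)))) \<partial>lborel)
          = (\<integral>\<^sup>+r. ennreal (exp (- (s i * u))) * (ennreal (exp (- (s i * r)) * r powr (a - 1)) * indicator {0..} r) \<partial>lborel)"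
        proof (rule nn_integral_cong)
          fix r :: real
          have "exp (- (s i * (r + u))) = exp (- (s i * u)) * exp (- (s i * r))"
            by (simp add: algebra_simps flip: exp_add)
          then show "\<rho> r * ennreal (exp (- (s i * (r + u)))) = ennreal (exp (- (s i * u))) * (ennreal (exp (- (s i * r)) * r powr (a - 1)) * indicator {0..} r)"
            by (simp only: \<rho>_def ennreal_mult exp_ge_zero powr_ge_zero mult_ac)
        qed
        also have "\<dots> = ennreal (exp (- (s i * u))) * ennreal (Gamma a / s i powr a)"
          by (subst nn_integral_cmult) (measurable, simp only: nn_integral_Gamma[OF a si])
        finally show "(\<integral>\<^sup>+r. \<rho> r * ennreal (exp (- (s i * (r + u)))) \<partial>lborel) = ennreal (exp (- (s i * u)) * (Gamma a / s i powr a))"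
          using Gamma_real_pos[OF a] by (simp only: ennreal_mult exp_ge_zero divide_nonneg_nonneg less_imp_le powr_ge_zero)
      qed simp
      also have "\<dots> = ennreal (\<Prod>i<?n. exp (- (s i * u)) * (Gamma a / s i powr a))"
        using a by (intro prod_ennreal) (simp add: Gamma_real_nonneg)
      also have "(\<Prod>i<?n. exp (- (s i * u)) * (Gamma a / s i powr a)) = (\<Prod>i<?n. exp (- (s i * u))) * (\<Prod>i<?n. Gamma a / s i powr a)"
        by (rule prod.distrib)
      also have "(\<Prod>i<?n. exp (- (s i * u))) = exp (\<Sum>i<?n. - (s i * u))"
        by (rule exp_sum[symmetric]) simp
      also have "(\<Sum>i<?n. - (s i * u)) = - (S * u)"
        by (simp only: S_def sum_negf sum_distrib_right)
      also have "(\<Prod>i<?n. Gamma a / s i powr a) = \<Gamma>"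
      proof -
        have "(\<Prod>i<?n. s i) powr (- a) = (\<Prod>i<?n. s i powr (- a))"
          by (rule prod_powr_distrib)
        then have "\<Gamma> = (\<Prod>i<?n. Gamma a) * (\<Prod>i<?n. s i powr (- a))" by (simp add: \<Gamma>_def)
        also have "\<dots> = (\<Prod>i<?n. Gamma a * s i powr (- a))" by (rule prod.distrib[symmetric])
        also have "\<dots> = (\<Prod>i<?n. Gamma a / s i powr a)"
          by (simp only: powr_minus divide_inverse)
        finally show ?thesis ..
      qed
      finally have "(\<Prod>i<?n. \<integral>\<^sup>+r. \<rho> r * ennreal (exp (- (s i * (r + u)))) \<partial>lborel) = ennreal (exp (- (S * u)) * \<Gamma>)" .
      then show "h2 u * (\<Prod>i<?n. \<integral>\<^sup>+r. \<rho> r * ennreal (exp (- (s i * (r + u)))) \<partial>lborel)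
        = (ennreal c * C * ennreal \<Gamma>) * (ennreal (exp (- (S * u)) * u powr (\<beta> - 1)) * indicator {0..} u)"
        using \<Gamma>0 by (simp only: h2_def ennreal_mult exp_ge_zero powr_ge_zero mult_ac)
    qed
    also have "\<dots> = (ennreal c * C * ennreal \<Gamma>) * ennreal (Gamma \<beta> / S powr \<beta>)"
      by (subst nn_integral_cmult) (measurable, simp only: nn_integral_Gamma[OF \<beta> S])
    also have "\<dots> = ennreal (pi powr (DIM('a) / 2) * Gamma b * (\<Prod>i<?n. s i) powr (- a) * S powr (- \<beta>)) * C"
    proof -
      have g: "Gamma \<beta> > 0" "Gamma a > 0" using \<beta> a by (auto intro: Gamma_real_pos)
      have K: "pi powr (DIM('a) / 2) * Gamma b * (\<Prod>i<?n. s i) powr (- a) * S powr (- \<beta>) = c * \<Gamma> * (Gamma \<beta> / S powr \<beta>)"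
        using g by (simp add: c_def \<Gamma>_def powr_minus field_simps)
      have "0 \<le> Gamma \<beta> / S powr \<beta>" using g by simp
      then show ?thesis
        unfolding K using c \<Gamma>0 by (intro ennreal_times_assoc(2)) simp_all
    qed
    finally show ?thesis unfolding S_def .
  qed
  have box: "(\<integral>\<^sup>+x. (\<Prod>i<?n. indicator {..1} (X i x)) \<partial>M) = (\<integral>\<^sup>+x. (\<Prod>i<?n. indicator {..1} (Y i x)) \<partial>N)"
  proof (rule laplace_uniqueness_multi[OF finite_lessThan])
    fix s :: "nat \<Rightarrow> real" assume "\<And>i. i \<in> {..<?n} \<Longrightarrow> s i > 0"
    then have s: "\<And>i. i < ?n \<Longrightarrow> s i > 0" by simp
    show "(\<integral>\<^sup>+x. (\<Prod>i<?n. ennreal (exp (- (s i * X i x)))) \<partial>M) = (\<integral>\<^sup>+x. (\<Prod>i<?n. ennreal (exp (- (s i * Y i x)))) \<partial>N)"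
      using lapM[of s, OF s] lapN[of s, OF s] by (simp only:)
    show "(\<integral>\<^sup>+x. (\<Prod>i<?n. ennreal (exp (- (s i * X i x)))) \<partial>M) < \<infinity>"
    proof -
      have "ennreal x * C < \<infinity>" for x
        using Cfin by (simp add: ennreal_mult_less_top)
      then show ?thesis
        using lapM[of s, OF s] by (simp only:)
    qed
  qed (use Xm Ym Xnn Ynn in auto)
  have boxM: "(\<integral>\<^sup>+x. (\<Prod>i<?n. indicator {..1} (X i x)) \<partial>M) = ennreal (Beta b (D + 1)) * G"
  proof -
    have "(\<integral>\<^sup>+x. (\<Prod>i<?n. indicator {..1} (X i x)) \<partial>M) = (\<integral>\<^sup>+u. h u * (\<integral>\<^sup>+y. F y * (\<Prod>i<?n. indicator {..1} ((norm (y i))\<^sup>2 + u)) \<partial>?MY) \<partial>lborel)"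
      by (rule intM[of "\<lambda>_. indicator {..1}"]) measurable
    also have "\<dots> = (\<integral>\<^sup>+u. (ennreal (u powr (b - 1) * (1 - u) powr (D + 1 - 1)) * indicator {0..1} u) * G \<partial>lborel)"
    proof (rule nn_integral_cong_AE)
      show "AE u in lborel. h u * (\<integral>\<^sup>+y. F y * (\<Prod>i<?n. indicator {..1} ((norm (y i))\<^sup>2 + u)) \<partial>?MY)
        = (ennreal (u powr (b - 1) * (1 - u) powr (D + 1 - 1)) * indicator {0..1} u) * G"
        \<comment> \<open>At u = 1 the ball has radius 0, while \<open>ball_simplex_scale\<close>
          applies to positive radii.\<close>
        using AE_lborel_singleton[of "1::real"]
      proof (rule eventually_mono)
        fix u :: real assume "u \<noteq> 1"
        then consider "u < 0" | "0 \<le> u" "u < 1" | "u > 1" by linarith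
        then show "h u * (\<integral>\<^sup>+y. F y * (\<Prod>i<?n. indicator {..1} ((norm (y i))\<^sup>2 + u)) \<partial>?MY)
          = (ennreal (u powr (b - 1) * (1 - u) powr (D + 1 - 1)) * indicator {0..1} u) * G"
        proof cases
          case 1
          then show ?thesis by (simp add: h_def)
        next
          case 2
          let ?c = "sqrt (1 - u)"
          have c0: "?c > 0" using 2 by simp
          have "(indicator {..1} ((norm (y i))\<^sup>2 + u) :: ennreal) = indicator {..?c\<^sup>2} ((norm (y i))\<^sup>2)" for y :: "nat \<Rightarrow> 'a" and i
            using 2 by (auto simp: indicator_def)
          then have "(\<integral>\<^sup>+y. F y * (\<Prod>i<?n. indicator {..1} ((norm (y i))\<^sup>2 + u)) \<partial>?MY)
            = (\<integral>\<^sup>+y. F y * (\<Prod>i<?n. indicator {..?c\<^sup>2} ((norm (y i))\<^sup>2)) \<partial>?MY)" by (simp only:)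
          also have "\<dots> = ennreal (?c powr (DIM('a) * ?n + k * p)) * G"
            unfolding F_def G_def by (rule ball_simplex_scale(1)[OF A(1) c0])
          also have "?c powr (DIM('a) * ?n + k * p) = (1 - u) powr D"
            using 2 by (simp add: powr_half_sqrt[symmetric] powr_powr D_def)
          finally show ?thesis
            using 2 by (simp add: h_def ennreal_mult mult_ac)
        next
          case 3
          have "(\<Prod>i<?n. indicator {..1} ((norm (y i))\<^sup>2 + u) :: ennreal) = 0" for y :: "nat \<Rightarrow> 'a"
          proof -
            have "\<not> (norm (y 0))\<^sup>2 + u \<le> 1" using 3 zero_le_power2[of "norm (y 0)"] by linarith
            then have "(indicator {..1} ((norm (y 0))\<^sup>2 + u) :: ennreal) = 0" by (simp add: indicator_def)
            then show ?thesis by (intro prod_zero) auto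
          qed
          then show ?thesis using 3 by (simp only: mult_zero_right nn_integral_const mult_zero_left) simp
        qed
      qed
    qed
    also have "\<dots> = ennreal (Beta b (D + 1)) * G"
      using D by (subst nn_integral_multc) (measurable, simp only: nn_integral_Beta[OF b] add_pos_pos zero_less_one)
    finally show ?thesis .
  qed
  have boxN: "(\<integral>\<^sup>+x. (\<Prod>i<?n. indicator {..1} (Y i x)) \<partial>N) = ennreal (c * (1 / a) ^ ?n * Beta \<beta> (?n * a + 1)) * C"
  proof -
    have "(\<integral>\<^sup>+x. (\<Prod>i<?n. indicator {..1} (Y i x)) \<partial>N) = (\<integral>\<^sup>+u. h2 u * (\<Prod>i<?n. \<integral>\<^sup>+r. \<rho> r * indicator {..1} (r + u) \<partial>lborel) \<partial>lborel)"
      by (rule intN[of "\<lambda>_. indicator {..1}"]) measurable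
    also have "\<dots> = (\<integral>\<^sup>+u. (ennreal c * C * ennreal ((1 / a) ^ ?n)) * (ennreal (u powr (\<beta> - 1) * (1 - u) powr (?n * a + 1 - 1)) * indicator {0..1} u) \<partial>lborel)"
    proof (rule nn_integral_cong)
      fix u :: real
      consider "u < 0" | "0 \<le> u" "u \<le> 1" | "u > 1" by linarith
      then show "h2 u * (\<Prod>i<?n. \<integral>\<^sup>+r. \<rho> r * indicator {..1} (r + u) \<partial>lborel)
        = (ennreal c * C * ennreal ((1 / a) ^ ?n)) * (ennreal (u powr (\<beta> - 1) * (1 - u) powr (?n * a + 1 - 1)) * indicator {0..1} u)"
      proof cases
        case 1
        then show ?thesis by (simp add: h2_def)
      next
        case 2
        have "\<rho> r * indicator {..1} (r + u) = ennreal (r powr (a - 1)) * indicator {0..1 - u} r" for r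
          by (auto simp: \<rho>_def indicator_def)
        then have "(\<integral>\<^sup>+r. \<rho> r * indicator {..1} (r + u) \<partial>lborel) = ennreal ((1 - u) powr a / a)"
          using nn_integral_powr_0[OF a, of "1 - u"] 2 by simp
        then have "(\<Prod>i<?n. \<integral>\<^sup>+r. \<rho> r * indicator {..1} (r + u) \<partial>lborel) = ennreal (((1 - u) powr a / a) ^ ?n)"
          using a by (simp only: prod_constant card_lessThan ennreal_power divide_nonneg_pos powr_ge_zero)
        also have "((1 - u) powr a / a) ^ ?n = (1 / a) ^ ?n * (1 - u) powr (?n * a + 1 - 1)"
        proof (cases "u = 1")
          case True
          then show ?thesis using a by simp
        next
          case False
          then have "1 - u > 0" using 2 by simp
          then have "((1 - u) powr a) ^ ?n = (1 - u) powr (?n * a)"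
            by (simp only: powr_power mult.commute)
          then show ?thesis by (simp add: power_divide)
        qed
        finally have E: "(\<Prod>i<?n. \<integral>\<^sup>+r. \<rho> r * indicator {..1} (r + u) \<partial>lborel) = ennreal ((1 / a) ^ ?n * (1 - u) powr (?n * a + 1 - 1))" .
        have "(indicator {0..} u :: ennreal) = 1" "(indicator {0..1} u :: ennreal) = 1" using 2 by simp_all
        moreover have "0 \<le> (1 / a) ^ ?n" using a by simp
        ultimately show ?thesis
          unfolding E h2_def by (simp only: ennreal_mult powr_ge_zero mult_1_right mult_ac)
      next
        case 3
        have "\<rho> r * indicator {..1} (r + u) = 0" for r
          using 3 by (auto simp: \<rho>_def indicator_def)
        then have "(\<integral>\<^sup>+r. \<rho> r * indicator {..1} (r + u) \<partial>lborel) = 0"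
          by (simp only: nn_integral_const mult_zero_left)
        then show ?thesis using 3 by simp
      qed
    qed
    also have "\<dots> = (ennreal c * C * ennreal ((1 / a) ^ ?n)) * ennreal (Beta \<beta> (?n * a + 1))"
    proof -
      have "?n * a + 1 > 0" using a by (simp add: add_pos_pos)
      then show ?thesis
        by (subst nn_integral_cmult) (measurable, simp only: nn_integral_Beta[OF \<beta>])
    qed
    also have "\<dots> = ennreal (c * (1 / a) ^ ?n * Beta \<beta> (?n * a + 1)) * C"
    proof -
      have "?n * a + 1 > 0" using a by (simp add: add_pos_pos)
      then have "0 \<le> Beta \<beta> (?n * a + 1)"
        using \<beta> by (simp add: Beta_def Gamma_real_nonneg)
      moreover have "0 \<le> (1 / a) ^ ?n" using a by simp
      ultimately show ?thesis
        using c by (intro ennreal_times_assoc(2)) simp_all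
    qed
    finally show ?thesis .
  qed
  have key: "ennreal (Beta b (D + 1)) * G = ennreal (c * (1 / a) ^ ?n * Beta \<beta> (?n * a + 1)) * C"
    using box boxM boxN by simp
  define B where "B = Beta b (D + 1)"
  have B: "B > 0" using b D by (simp add: B_def Beta_def Gamma_real_pos)
  have n1: "?n * a + 1 > 0" using a by (simp add: add_pos_pos)
  have "c * (1 / a) ^ ?n * Beta \<beta> (?n * a + 1) / B
    = pi powr (DIM('a) / 2) * Gamma (?n * a + 1) / (Gamma (D + 1) * Gamma (a + 1) ^ ?n)"
  proof -
    define Gb where "Gb = Gamma b"
    define G\<beta> where "G\<beta> = Gamma \<beta>"
    define Ga where "Ga = Gamma a"
    define GD where "GD = Gamma (D + 1)"
    define Gn where "Gn = Gamma (?n * a + 1)"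
    define Gs where "Gs = Gamma (b + (D + 1))"
    define q where "q = pi powr (DIM('a) / 2)"
    have pos: "Gb > 0" "G\<beta> > 0" "Ga > 0" "GD > 0" "Gs > 0"
      using b \<beta> a D by (simp_all add: Gb_def G\<beta>_def Ga_def GD_def Gs_def Gamma_real_pos)
    \<comment> \<open>Both Beta values therefore have the same denominator, and together with
      \<open>c\<close> the auxiliary \<open>b\<close> drops out.\<close>
    have E: "\<beta> + (?n * a + 1) = b + (D + 1)"
      by (simp add: \<beta>_def a_def D_def field_simps)
    have "Beta \<beta> (?n * a + 1) = G\<beta> * Gn / Gs" "B = Gb * GD / Gs"
      unfolding Beta_def B_def E by (simp_all only: Gb_def G\<beta>_def GD_def Gn_def Gs_def)
    moreover have "Gamma (a + 1) = a * Ga"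
      unfolding Ga_def using a by (intro Gamma_plus1) (auto elim!: nonpos_Ints_cases)
    moreover have "c = q * Gb / (G\<beta> * Ga ^ ?n)"
      by (simp add: c_def q_def Gb_def G\<beta>_def Ga_def)
    ultimately show ?thesis
      unfolding q_def[symmetric] GD_def[symmetric] Gn_def[symmetric]
      using pos a by (simp add: power_mult_distrib power_one_over del: power_Suc)
  qed
  moreover have "G = ennreal (c * (1 / a) ^ ?n * Beta \<beta> (?n * a + 1) / B) * C"
  proof -
    have "ennreal (1 / B) * (ennreal B * G) = (ennreal (1 / B) * ennreal B) * G" by (simp only: mult.assoc)
    also have "ennreal (1 / B) * ennreal B = 1" using B by (simp flip: ennreal_mult)
    finally have "G = ennreal (1 / B) * (ennreal (c * (1 / a) ^ ?n * Beta \<beta> (?n * a + 1)) * C)"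
      using key by (simp add: B_def)
    also have "\<dots> = ennreal (1 / B * (c * (1 / a) ^ ?n * Beta \<beta> (?n * a + 1))) * C"
    proof -
      have "0 \<le> Beta \<beta> (?n * a + 1)"
        using \<beta> n1 by (simp add: Beta_def Gamma_real_nonneg)
      then have "0 \<le> c * (1 / a) ^ ?n * Beta \<beta> (?n * a + 1)" using c a by simp
      moreover have "0 \<le> 1 / B" using B by simp
      ultimately show ?thesis by (rule ennreal_times_assoc(1)[rotated])
    qed
    finally show ?thesis by (simp only: times_divide_eq_left mult_1_left)
  qed
  ultimately show ?thesis
    unfolding G_def F_def C_def by (simp only:)
qed

section \<open>Ellipsoids\<close>

text \<open>\<open>J\<close> is the absolute determinant of \<open>T\<close>, obtained as the volume
  of the image of an orthonormal basis; \<open>nn_integral_comb_gs\<close> then is the substitution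
  rule.\<close>

lemma nn_integral_linear_substitution:
  fixes T :: "'a::euclidean_space \<Rightarrow> 'a"
  assumes T: "linear T" "inj T"
  obtains J where "J > 0" "\<And>F. F \<in> borel_measurable borel \<Longrightarrow> (\<integral>\<^sup>+x. F x \<partial>lborel) = ennreal J * (\<integral>\<^sup>+x. F (T x) \<partial>lborel)"
proof -
  let ?d = "DIM('a)"
  have "orthonormal_family 0 (\<lambda>_. 0 :: 'a)" by (simp add: orthonormal_family_def)
  then obtain e :: "nat \<Rightarrow> 'a" where e: "orthonormal_family ?d e"
    by (rule orthonormal_family_extend) simp
  let ?v = "\<lambda>i. T (e i)"
  have "dim (span (?v ` {..<?d})) = dim (span (e ` {..<?d}))"
    unfolding span_linear_image_lessThan[OF T(1)]
    using T by (intro dim_image_eq) (auto intro: inj_on_subset)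
  then have nz: "pvol ?d ?v \<noteq> 0"
    using orthonormal_family_dim[OF e] by (simp add: pvol_nonzero_iff_dim)
  show ?thesis
  proof (rule that[of "pvol ?d ?v"])
    show "pvol ?d ?v > 0" using nz pvol_nonneg[of ?d ?v] by simp
    fix F :: "'a \<Rightarrow> ennreal" assume F: "F \<in> borel_measurable borel"
    have FT: "(\<lambda>x. F (T x)) \<in> borel_measurable borel"
      by (rule measurable_compose[OF borel_measurable_linear[OF T(1)] F])
    show "(\<integral>\<^sup>+x. F x \<partial>lborel) = ennreal (pvol ?d ?v) * (\<integral>\<^sup>+x. F (T x) \<partial>lborel)"
      unfolding nn_integral_orthonormal[OF orthonormal_gs_unit[OF nz] F] nn_integral_orthonormal[OF e FT]
        nn_integral_comb_gs[OF nz F] linear_comb[OF T(1)] ..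
  qed
qed

text \<open>The factor \<open>J\<close> scales integrals over \<open>E\<close> and the volume of
  \<open>E\<close> alike, so the uniform law on \<open>E\<close> is the image of the uniform law on
  the unit ball; \<open>unit_ball_vol\<close> normalizes the latter.\<close>

lemma nn_integral_uniform_ellipsoid:
  fixes T :: "'a::euclidean_space \<Rightarrow> 'a" and c :: 'a
  assumes T: "linear T" "inj T" and g: "g \<in> borel_measurable borel"
  defines "E \<equiv> (\<lambda>x. c + T x) ` cball 0 1"
  shows "(\<integral>\<^sup>+x. g (c + T x) * indicator (cball 0 1) x \<partial>lborel) = ennreal (unit_ball_vol DIM('a)) * (\<integral>\<^sup>+x. g x \<partial>uniform_measure lborel E)"
    and "emeasure lborel E \<noteq> 0" "emeasure lborel E \<noteq> \<infinity>"
proof -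
  obtain J where J: "J > 0" "\<And>F. F \<in> borel_measurable borel \<Longrightarrow> (\<integral>\<^sup>+x. F x \<partial>lborel) = ennreal J * (\<integral>\<^sup>+x. F (T x) \<partial>lborel)"
    using nn_integral_linear_substitution[OF T] by blast
  have "compact ((+) c ` T ` cball 0 1)"
    using T by (intro compact_translation compact_linear_image) auto
  then have E [measurable]: "E \<in> sets borel"
    unfolding E_def by (intro borel_closed compact_imp_closed) (simp add: image_image)
  have iff: "c + T x \<in> E \<longleftrightarrow> x \<in> cball 0 1" for x
  proof -
    have "c + T x \<in> E \<longleftrightarrow> T x \<in> T ` cball 0 1" unfolding E_def by auto
    also have "\<dots> \<longleftrightarrow> x \<in> cball 0 1" by (rule inj_image_mem_iff[OF T(2)])
    finally show ?thesis .
  qed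
  have sub: "(\<integral>\<^sup>+x. f x * indicator E x \<partial>lborel) = ennreal J * (\<integral>\<^sup>+x. f (c + T x) * indicator (cball 0 1) x \<partial>lborel)"
    if [measurable]: "f \<in> borel_measurable borel" for f
  proof -
    have "(\<integral>\<^sup>+x. f x * indicator E x \<partial>lborel) = (\<integral>\<^sup>+x. f (x + c) * indicator E (x + c) \<partial>lborel)"
      by (rule nn_integral_lborel_translate[symmetric]) measurable
    also have "\<dots> = ennreal J * (\<integral>\<^sup>+x. f (T x + c) * indicator E (T x + c) \<partial>lborel)"
      by (rule J(2)) measurable
    also have "(\<lambda>x. f (T x + c) * indicator E (T x + c)) = (\<lambda>x. f (c + T x) * indicator (cball 0 1) x)"
      using iff by (simp add: fun_eq_iff indicator_def add.commute)
    finally show ?thesis .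
  qed
  have vol: "emeasure lborel E = ennreal J * ennreal (unit_ball_vol DIM('a))"
    using sub[of "\<lambda>_. 1"] by (simp add: emeasure_cball)
  have kpos: "unit_ball_vol (real DIM('a)) > 0" by simp
  show nz: "emeasure lborel E \<noteq> 0" "emeasure lborel E \<noteq> \<infinity>"
    unfolding vol using J(1) by (simp_all add: ennreal_mult_eq_top_iff less_imp_neq[OF kpos, symmetric])
  have "(\<integral>\<^sup>+x. g x \<partial>uniform_measure lborel E) = (\<integral>\<^sup>+x. g x * indicator E x \<partial>lborel) / emeasure lborel E"
    using g E by (intro nn_integral_uniform_measure) auto
  then have "emeasure lborel E * (\<integral>\<^sup>+x. g x \<partial>uniform_measure lborel E) = (\<integral>\<^sup>+x. g x * indicator E x \<partial>lborel)"
    using nz by (metis ennreal_mult_divide_eq ennreal_times_divide infinity_ennreal_def mult.commute)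
  then have "ennreal J * (ennreal (unit_ball_vol DIM('a)) * (\<integral>\<^sup>+x. g x \<partial>uniform_measure lborel E))
    = ennreal J * (\<integral>\<^sup>+x. g (c + T x) * indicator (cball 0 1) x \<partial>lborel)"
    unfolding vol sub[OF g] by (simp only: mult.assoc)
  then show "(\<integral>\<^sup>+x. g (c + T x) * indicator (cball 0 1) x \<partial>lborel) = ennreal (unit_ball_vol DIM('a)) * (\<integral>\<^sup>+x. g x \<partial>uniform_measure lborel E)"
    using J(1) by (simp add: ennreal_mult_cancel_left)
qed

text \<open>All vertices are pulled back to the unit ball by the same affine map, and the centre
  \<open>c\<close> cancels in the differences.\<close>

lemma ellipsoid_simplex_moment:
  fixes T :: "'a::euclidean_space \<Rightarrow> 'a" and c :: 'a and p a D :: real and k :: nat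
  assumes T: "linear T" "inj T" and k: "k \<le> DIM('a)" and p: "p > -1"
  defines "E \<equiv> (\<lambda>x. c + T x) ` cball 0 1" and "a \<equiv> (DIM('a) + p) / 2" and "D \<equiv> (DIM('a) * Suc k + k * p) / 2"
  shows "ennreal (unit_ball_vol DIM('a) ^ Suc k) * (\<integral>\<^sup>+x. ennreal (pvol k (\<lambda>i. x i - x k) powr p) \<partial>Pi\<^sub>M {..<Suc k} (\<lambda>_. uniform_measure lborel E))
    = ennreal (pi powr (DIM('a) / 2) * Gamma (Suc k * a + 1) / (Gamma (D + 1) * Gamma (a + 1) ^ Suc k)) * gauss_pvol k T p"
proof -
  let ?U = "uniform_measure lborel E" and ?I = "{..<Suc k}"
  define F where "F x = ennreal (pvol k (\<lambda>i. x i - x k) powr p)" for x :: "nat \<Rightarrow> 'a"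
  note ue = nn_integral_uniform_ellipsoid[OF T, where c = c, folded E_def]
  have one: "(\<lambda>_. 1) \<in> borel_measurable (borel :: 'a measure)" by simp
  have ps: "prob_space ?U"
    using ue(2,3)[OF one] by (intro prob_space_uniform_measure) auto
  interpret U: product_sigma_finite "\<lambda>_. ?U"
    using ps by (intro product_sigma_finite.intro prob_space_imp_sigma_finite)
  have cU: "(\<lambda>x. x i) \<in> borel_measurable (Pi\<^sub>M ?I (\<lambda>_. ?U))" if "i < Suc k" for i
  proof -
    have "(\<lambda>x. x i) \<in> Pi\<^sub>M ?I (\<lambda>_. ?U) \<rightarrow>\<^sub>M ?U"
      using that by (intro measurable_component_singleton) simp
    also have "measurable (Pi\<^sub>M ?I (\<lambda>_. ?U)) ?U = measurable (Pi\<^sub>M ?I (\<lambda>_. ?U)) borel"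
      by (rule measurable_cong_sets) simp_all
    finally show ?thesis .
  qed
  have "(\<lambda>x. pvol k (\<lambda>i. x i - x k)) \<in> borel_measurable (Pi\<^sub>M ?I (\<lambda>_. ?U))"
    by (intro borel_measurable_pvol borel_measurable_diff cU) auto
  then have Fm: "F \<in> borel_measurable (Pi\<^sub>M ?I (\<lambda>_. ?U))"
    unfolding F_def by measurable
  have tm: "(\<lambda>x. c + T x) \<in> lborel \<rightarrow>\<^sub>M ?U"
  proof -
    note [measurable] = borel_measurable_linear[OF T(1)]
    have "(\<lambda>x. c + T x) \<in> lborel \<rightarrow>\<^sub>M borel" by measurable
    also have "measurable lborel borel = measurable lborel ?U"
      by (rule measurable_cong_sets) simp_all
    finally show ?thesis .
  qed
  have im: "indicator (cball (0::'a) 1) \<in> borel_measurable lborel"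
    by (intro borel_measurable_indicator) simp
  have "(\<integral>\<^sup>+x. F (\<lambda>i\<in>?I. c + T (x i)) * (\<Prod>i\<in>?I. indicator (cball 0 1) (x i)) \<partial>Pi\<^sub>M ?I (\<lambda>_. lborel))
    = (\<Prod>i\<in>?I. ennreal (unit_ball_vol DIM('a))) * (\<integral>\<^sup>+x. F x \<partial>Pi\<^sub>M ?I (\<lambda>_. ?U))"
  proof (rule nn_integral_PiM_transform[where f = "\<lambda>_ x. c + T x" and w = "\<lambda>_. indicator (cball 0 1)" and K = "\<lambda>_. ennreal (unit_ball_vol DIM('a))"])
    fix g :: "'a \<Rightarrow> ennreal" assume "g \<in> borel_measurable ?U"
    then have "g \<in> borel_measurable borel"
      using measurable_cong_sets[of ?U borel borel borel] by simp
    then show "(\<integral>\<^sup>+x. g (c + T x) * indicator (cball 0 1) x \<partial>lborel) = ennreal (unit_ball_vol DIM('a)) * (\<integral>\<^sup>+x. g x \<partial>?U)"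
      by (rule ue(1))
  qed (use tm im Fm lb.product_sigma_finite_axioms U.product_sigma_finite_axioms in auto)
  also have "(\<Prod>i\<in>?I. ennreal (unit_ball_vol DIM('a))) = ennreal (unit_ball_vol DIM('a) ^ Suc k)"
    by (simp only: prod_constant card_lessThan ennreal_power unit_ball_vol_nonneg of_nat_0_le_iff)
  also have "(\<integral>\<^sup>+x. F (\<lambda>i\<in>?I. c + T (x i)) * (\<Prod>i\<in>?I. indicator (cball 0 1) (x i)) \<partial>Pi\<^sub>M ?I (\<lambda>_. lborel))
    = (\<integral>\<^sup>+y. ennreal (pvol k (\<lambda>i. T (y i - y k)) powr p) * (\<Prod>i<Suc k. indicator (cball 0 1) (y i)) \<partial>Pi\<^sub>M {..<Suc k} (\<lambda>_. lborel))"
  proof (rule nn_integral_cong)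
    fix x :: "nat \<Rightarrow> 'a"
    have "pvol k (\<lambda>i. (\<lambda>i\<in>?I. c + T (x i)) i - (\<lambda>i\<in>?I. c + T (x i)) k) = pvol k (\<lambda>i. T (x i - x k))"
      by (rule pvol_cong) (simp add: linear_diff[OF T(1)])
    then show "F (\<lambda>i\<in>?I. c + T (x i)) * (\<Prod>i\<in>?I. indicator (cball 0 1) (x i))
      = ennreal (pvol k (\<lambda>i. T (x i - x k)) powr p) * (\<Prod>i<Suc k. indicator (cball 0 1) (x i))"
      by (simp only: F_def)
  qed
  finally show ?thesis
    using ball_simplex_moment[OF T k p] unfolding a_def D_def F_def by simp
qed

section \<open>Flag coefficients and the comparison of constants\<close>

lemma unit_sphere_area_Gamma: "q > 0 \<Longrightarrow> unit_sphere_area q = 2 * pi powr (q / 2) / Gamma (q / 2)"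
proof -
  assume q: "q > 0"
  have G: "Gamma (q / 2 + 1) = q / 2 * Gamma (q / 2)"
    using q by (intro Gamma_plus1) (auto elim!: nonpos_Ints_cases)
  show ?thesis
    unfolding unit_sphere_area_def unit_ball_vol_def G using q by simp
qed

text \<open>The denominators of the two flag coefficients cancel. For the remaining factors, with l
  = d - k + i, the quotient of \<open>unit_sphere_area\<close> at l and at l + p is
  \<open>pi powr (- ((d + p) / 2)) * gauss_moment d l p\<close>. So the flag coefficients encode the
  Gaussian constant of the full space in \<open>projected_ellipsoid_moment\<close>.\<close>

lemma flag_coeff_ratio:
  fixes d k :: nat and p :: real
  assumes k: "k \<le> d" and p: "p > -1"
  shows "flag_coeff d k / flag_coeff (d + p) k = pi powr (- (real k * ((d + p) / 2))) * (\<Prod>i<k. gauss_moment d (d - i) p)"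
proof -
  define W where "W = (\<Prod>i=1..k. unit_sphere_area (real i))"
  have "W > 0"
    unfolding W_def by (intro prod_pos) (auto simp: unit_sphere_area_Gamma Gamma_real_pos)
  then have W: "(x / W) / (y / W) = x / y" for x y by simp
  have "flag_coeff d k / flag_coeff (d + p) k
    = (\<Prod>i=1..k. unit_sphere_area (real d - real k + real i)) / (\<Prod>i=1..k. unit_sphere_area (d + p - real k + real i))"
    unfolding flag_coeff_def W_def[symmetric] W ..
  also have "\<dots> = (\<Prod>i=1..k. unit_sphere_area (real d - real k + real i) / unit_sphere_area (d + p - real k + real i))"
    by (rule prod_dividef[symmetric])
  also have "\<dots> = (\<Prod>i<k. pi powr (- ((d + p) / 2)) * gauss_moment d (d - i) p)"
  \<comment> \<open>Reversing the order matches the index \<open>d - k + i\<close> with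
    \<open>d - (k - i)\<close>.\<close>
  proof (rule prod.reindex_bij_witness[of _ "\<lambda>i. k - i" "\<lambda>i. k - i"])
    fix i assume i: "i \<in> {1..k}"
    define l where "l = d - (k - i)"
    have l: "real d - real k + real i = real l" "d + p - real k + real i = real l + p"
      using i k by (auto simp: l_def of_nat_diff)
    have l1: "l \<ge> 1" using i k unfolding l_def atLeastAtMost_iff by arith
    have lp: "real l + p > 0" using l1 p by linarith
    have "unit_sphere_area l / unit_sphere_area (l + p)
      = (pi powr (l / 2) / pi powr ((l + p) / 2)) * (Gamma ((l + p) / 2) / Gamma (l / 2))"
      using l1 lp by (simp add: unit_sphere_area_Gamma)
    also have "pi powr (l / 2) / pi powr ((l + p) / 2) = pi powr (- ((d + p) / 2)) * pi powr (d / 2)"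
      by (simp add: powr_diff[symmetric] powr_add[symmetric] field_simps)
    finally show "pi powr (- ((d + p) / 2)) * gauss_moment d (d - (k - i)) p
      = unit_sphere_area (real d - real k + real i) / unit_sphere_area (d + p - real k + real i)"
      unfolding l l_def[symmetric] by (simp add: gauss_moment_def)
  qed auto
  also have "\<dots> = (pi powr (- ((d + p) / 2))) ^ k * (\<Prod>i<k. gauss_moment d (d - i) p)"
    by (simp only: prod.distrib prod_constant card_lessThan)
  also have "(pi powr (- ((d + p) / 2))) ^ k = pi powr (- (real k * ((d + p) / 2)))"
    by (simp add: powr_power)
  finally show ?thesis .
qed

text \<open>The Gamma factors match one by one; what remains is a count of powers of
  \<open>pi\<close>: \<open>Suc k * a\<close> from \<open>unit_ball_vol (d + p) ^ Suc k\<close>,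
  \<open>D - Suc k * a\<close> from the quotient of ball volumes and \<open>- (k * a)\<close> from
  the flag coefficients add up to \<open>d / 2\<close>.\<close>

lemma simplex_constant:
  fixes d k :: nat and p a D :: real
  assumes k: "k \<le> d" and p: "p > -1" and d: "d \<ge> 1"
  defines "a \<equiv> (d + p) / 2" and "D \<equiv> (d * Suc k + k * p) / 2"
  shows "pi powr (d / 2) * Gamma (Suc k * a + 1) / (Gamma (D + 1) * Gamma (a + 1) ^ Suc k) * (\<Prod>i<k. gauss_moment d (d - i) p)
    = unit_ball_vol (d + p) ^ Suc k * (unit_ball_vol (k * (d + p) + d) / unit_ball_vol ((k + 1) * (d + p)))
      * (flag_coeff d k / flag_coeff (d + p) k)"
proof -
  define P where "P = (\<Prod>i<k. gauss_moment d (d - i) p)"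
  have 1: "(k * (d + p) + d) / 2 = D" by (simp add: D_def field_simps)
  have 2: "(k + 1) * (d + p) / 2 = Suc k * a" by (simp add: a_def field_simps)
  have 3: "flag_coeff d k / flag_coeff (d + p) k = pi powr (- (k * a)) * P"
    using flag_coeff_ratio[OF k p] by (simp add: a_def P_def)
  have 4: "unit_ball_vol (d + p) ^ Suc k = pi powr (Suc k * a) / Gamma (a + 1) ^ Suc k"
  proof -
    have "(pi powr ((d + p) / 2)) ^ Suc k = pi powr (Suc k * ((d + p) / 2))"
      by (subst powr_power) (simp_all add: mult.commute del: of_nat_Suc)
    then show ?thesis
      unfolding unit_ball_vol_def a_def power_divide by (simp only:)
  qed
  have e: "pi powr (Suc k * a) * (pi powr D / pi powr (Suc k * a)) * pi powr (- (k * a)) = pi powr (d / 2)"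
  proof -
    have x: "Suc k * a + (D - Suc k * a) + - (k * a) = d / 2"
      by (simp add: D_def a_def field_simps)
    show ?thesis unfolding powr_diff[symmetric] powr_add[symmetric] x ..
  qed
  show ?thesis
    unfolding 3 4 P_def[symmetric] e[symmetric]
    by (simp only: unit_ball_vol_def 1 2) (simp add: field_simps del: power_Suc of_nat_Suc)
qed

theorem theorem1p7:
  fixes M :: "'w measure"
    and X :: "nat \<Rightarrow> 'w \<Rightarrow> real ^ 'n"
    and \<xi> :: "'w \<Rightarrow> (real ^ 'n) set"
    and E :: "(real ^ 'n) set"
    and d k :: nat and p :: real
  assumes "d = CARD('n)"
    and "k \<in> {1..d}"
    and "nondegenerate_ellipsoid E"
    and "prob_space M"
    and "prob_space.indep_vars M (\<lambda>_. borel) X {0..k}"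
    and "\<And>i. i \<in> {0..k} \<Longrightarrow> distr M borel (X i) = uniform_measure lborel E"
    and "uniform_random_subspace M k \<xi>"
    and "p > -1"
  shows "prob_space.expectation M
           (\<lambda>\<omega>. flat_volume k (convex hull ((\<lambda>i. X i \<omega>) ` {0..k})) powr p) =
         1 / (fact k powr p)
         * (unit_ball_vol (d + p) ^ (k + 1) / unit_ball_vol d ^ (k + 1))
         * (unit_ball_vol (k * (d + p) + d) / unit_ball_vol ((k + 1) * (d + p)))
         * (flag_coeff d k / flag_coeff (d + p) k)
         * (prob_space.expectation M (\<lambda>\<omega>. flat_volume k (orth_proj (\<xi> \<omega>) ` E) powr p)
            / unit_ball_vol k powr p)"
proof -
  interpret prob_space M by fact
  have k: "k \<le> CARD('n)" "k \<le> d" "d \<ge> 1" using assms(1,2) by auto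
  have k': "k \<le> DIM(real ^ 'n)" using k by simp
  note p = \<open>p > -1\<close>
  obtain c :: "real ^ 'n" and A :: "real ^ 'n ^ 'n" where A: "invertible A" "E = (\<lambda>x. c + A *v x) ` cball 0 1"
    using assms(3) by (auto simp: nondegenerate_ellipsoid_def)
  define T where "T x = A *v x" for x
  have E: "E = (\<lambda>x. c + T x) ` cball 0 1" by (simp add: A(2) T_def)
  have T: "linear T" unfolding T_def by (rule matrix_vector_mul_linear)
  have "bij T" using A(1) unfolding T_def[abs_def] by (simp add: invertible_eq_bij)
  then have inj: "inj T" and surj: "surj T" by (auto simp: bij_def)
  \<comment> \<open>Both expectations are multiples of this number, which is eliminated at the
    end.\<close>
  define C where "C = enn2real (gauss_pvol k T p)"
  define V where "V \<omega> = pvol k (\<lambda>i. X i \<omega> - X k \<omega>)" for \<omega>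
  \<comment> \<open>\<open>c1\<close> relates \<open>C\<close> to the moment of the simplex, and
    \<open>c2\<close> relates it to the moment of the projected ellipsoid.\<close>
  define c1 where "c1 = pi powr (d / 2) * Gamma (Suc k * ((d + p) / 2) + 1) / (Gamma ((d * Suc k + k * p) / 2 + 1) * Gamma ((d + p) / 2 + 1) ^ Suc k)"
  define c2 where "c2 = (\<Prod>i<k. gauss_moment d (d - i) p)"
  define \<nu> where "\<nu> = distr M (grassmannian k) \<xi>"
  define f where "f L = flat_volume k (orth_proj L ` E) powr p" for L

  have I: "{0..k} = {..<Suc k}" by auto
  have Xm [measurable]: "X i \<in> borel_measurable M" if "i < Suc k" for i
    using assms(5) that unfolding indep_vars_def I by auto
  have [measurable]: "V \<in> borel_measurable M"
    unfolding V_def by (intro borel_measurable_pvol borel_measurable_diff Xm) auto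
  have law: "distr M (Pi\<^sub>M {..<Suc k} (\<lambda>_. borel)) (\<lambda>\<omega>. \<lambda>i\<in>{..<Suc k}. X i \<omega>) = Pi\<^sub>M {..<Suc k} (\<lambda>_. uniform_measure lborel E)"
  proof -
    have "distr M (Pi\<^sub>M {..<Suc k} (\<lambda>_. borel)) (\<lambda>\<omega>. \<lambda>i\<in>{..<Suc k}. X i \<omega>) = Pi\<^sub>M {..<Suc k} (\<lambda>i. distr M borel (X i))"
      using assms(5) Xm unfolding I by (subst (asm) indep_vars_iff_distr_eq_PiM') auto
    also have "\<dots> = Pi\<^sub>M {..<Suc k} (\<lambda>_. uniform_measure lborel E)"
      using assms(6) unfolding I by (intro PiM_cong) auto
    finally show ?thesis .
  qed
  have intV: "(\<integral>\<^sup>+\<omega>. ennreal (V \<omega> powr p) \<partial>M) = (\<integral>\<^sup>+x. ennreal (pvol k (\<lambda>i. x i - x k) powr p) \<partial>Pi\<^sub>M {..<Suc k} (\<lambda>_. uniform_measure lborel E))"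
  proof -
    have cm: "(\<lambda>x. x i) \<in> borel_measurable (Pi\<^sub>M {..<Suc k} (\<lambda>_. borel :: (real ^ 'n) measure))" if "i < Suc k" for i
      using that by (intro measurable_component_singleton) simp
    have "(\<lambda>x. pvol k (\<lambda>i. x i - x k)) \<in> borel_measurable (Pi\<^sub>M {..<Suc k} (\<lambda>_. borel :: (real ^ 'n) measure))"
      by (intro borel_measurable_pvol borel_measurable_diff cm) auto
    then have m: "(\<lambda>x. ennreal (pvol k (\<lambda>i. x i - x k) powr p)) \<in> borel_measurable (Pi\<^sub>M {..<Suc k} (\<lambda>_. borel :: (real ^ 'n) measure))"
      by measurable
    have Xr: "(\<lambda>\<omega>. \<lambda>i\<in>{..<Suc k}. X i \<omega>) \<in> M \<rightarrow>\<^sub>M Pi\<^sub>M {..<Suc k} (\<lambda>_. borel)"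
      by (rule measurable_restrict) (use Xm in auto)
    have "pvol k (\<lambda>i. (\<lambda>i\<in>{..<Suc k}. X i \<omega>) i - (\<lambda>i\<in>{..<Suc k}. X i \<omega>) k) = V \<omega>" for \<omega>
      unfolding V_def by (rule pvol_cong) simp
    then show ?thesis
      unfolding law[symmetric] by (subst nn_integral_distr[OF Xr]) (simp_all only: measurable_distr_eq1 m)
  qed
  have "ennreal (unit_ball_vol d ^ Suc k) * (\<integral>\<^sup>+\<omega>. ennreal (V \<omega> powr p) \<partial>M) = ennreal c1 * gauss_pvol k T p"
    using ellipsoid_simplex_moment[OF T inj k' p, of c] unfolding intV E c1_def assms(1) by simp
  then have "enn2real (ennreal (unit_ball_vol d ^ Suc k) * (\<integral>\<^sup>+\<omega>. ennreal (V \<omega> powr p) \<partial>M)) = enn2real (ennreal c1 * gauss_pvol k T p)"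
    by (rule arg_cong)
  \<comment> \<open>Nonnegativity makes \<open>enn2real (ennreal c1)\<close> equal to
    \<open>c1\<close>.\<close>
  moreover have "c1 \<ge> 0"
  proof -
    have dp: "real d + p > 0" using k(3) p by linarith
    have "real k * (-1) \<le> real k * p" using p by (intro mult_left_mono) auto
    moreover have "1 * Suc k \<le> d * Suc k" using k(3) by (intro mult_right_mono) auto
    then have "real (Suc k) \<le> real (d * Suc k)" by (simp only: of_nat_le_iff mult_1)
    ultimately have "0 < real (d * Suc k) + real k * p" by simp
    from add_pos_pos[OF half_gt_zero[OF this] zero_less_one]
    have A1: "0 < (real (d * Suc k) + real k * p) / 2 + 1" .
    have A2: "0 < (real d + p) / 2 + 1" "0 < real (Suc k) * ((real d + p) / 2) + 1"
      by (rule add_pos_pos[OF half_gt_zero[OF dp] zero_less_one],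
        rule add_pos_pos[OF mult_pos_pos[OF _ half_gt_zero[OF dp]] zero_less_one]) simp
    show ?thesis
      unfolding c1_def
      by (intro divide_nonneg_nonneg mult_nonneg_nonneg zero_le_power less_imp_le[OF Gamma_real_pos] A1 A2 powr_ge_zero)
  qed
  \<comment> \<open>The expectation of a nonnegative measurable function is \<open>enn2real\<close>
    of its nonnegative integral, finite or not, so the identity in \<open>ennreal\<close> transfers
    directly.\<close>
  ultimately have 1: "unit_ball_vol d ^ Suc k * expectation (\<lambda>\<omega>. V \<omega> powr p) = c1 * C"
    by (simp add: enn2real_mult C_def integral_eq_nn_integral)

  have unif: "rotation_invariant_prob k \<nu>" and \<xi>m: "\<xi> \<in> M \<rightarrow>\<^sub>M grassmannian k"
    using assms(7) by (simp_all add: uniform_random_subspace_def \<nu>_def)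
  have sets\<nu>: "sets \<nu> = sets (grassmannian k)" by (simp add: \<nu>_def)
  note pm = projected_ellipsoid_moment[OF unif T surj k(1) p, of c, folded E]
  have "(\<lambda>L. ennreal (f L)) \<in> borel_measurable \<nu>" using pm(2) by (simp add: f_def)
  \<comment> \<open>As \<open>f\<close> is nonnegative, its measurability is recovered from that of
    \<open>ennreal (f L)\<close>.\<close>
  then have "(\<lambda>L. enn2real (ennreal (f L))) \<in> borel_measurable \<nu>" by measurable
  then have fm\<nu>: "f \<in> borel_measurable (grassmannian k)"
    using sets\<nu> by (simp add: f_def[abs_def] cong: measurable_cong_sets)
  have fm: "(\<lambda>\<omega>. f (\<xi> \<omega>)) \<in> borel_measurable M"
    by (rule measurable_compose[OF \<xi>m fm\<nu>])
  have "(\<integral>\<^sup>+L. ennreal (f L) \<partial>\<nu>) = (\<integral>\<^sup>+\<omega>. ennreal (f (\<xi> \<omega>)) \<partial>M)"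
    unfolding \<nu>_def using fm\<nu> by (subst nn_integral_distr[OF \<xi>m]) simp_all
  then have "(\<integral>\<^sup>+\<omega>. ennreal (f (\<xi> \<omega>)) \<partial>M) * ennreal c2 = ennreal (unit_ball_vol k powr p) * gauss_pvol k T p"
    using pm(1) by (simp add: f_def c2_def assms(1))
  then have "enn2real ((\<integral>\<^sup>+\<omega>. ennreal (f (\<xi> \<omega>)) \<partial>M) * ennreal c2) = enn2real (ennreal (unit_ball_vol k powr p) * gauss_pvol k T p)"
    by (rule arg_cong)
  moreover have c2: "c2 > 0" unfolding c2_def by (rule gauss_moment_prod_pos[OF k(2) p])
  ultimately have 2: "expectation (\<lambda>\<omega>. f (\<xi> \<omega>)) * c2 = unit_ball_vol k powr p * C"
    using fm by (simp add: enn2real_mult C_def integral_eq_nn_integral f_def)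

  have 3: "expectation (\<lambda>\<omega>. flat_volume k (convex hull ((\<lambda>i. X i \<omega>) ` {0..k})) powr p) = expectation (\<lambda>\<omega>. V \<omega> powr p) / fact k powr p"
    unfolding flat_volume_convex_hull[OF k'] V_def[symmetric]
    by (simp add: powr_divide V_def pvol_nonneg)
  have 4: "c1 * c2 = unit_ball_vol (d + p) ^ Suc k * (unit_ball_vol (k * (d + p) + d) / unit_ball_vol ((k + 1) * (d + p)))
      * (flag_coeff d k / flag_coeff (d + p) k)"
    unfolding c1_def c2_def by (rule simplex_constant[OF k(2) p k(3)])
  have kd: "unit_ball_vol (real d) ^ Suc k > 0" and kk: "unit_ball_vol (real k) powr p > 0"
    by (simp_all add: unit_ball_vol_pos less_imp_neq[OF unit_ball_vol_pos, symmetric])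
  have "expectation (\<lambda>\<omega>. V \<omega> powr p) = c1 * C / unit_ball_vol d ^ Suc k"
    using 1 by (simp only: nonzero_eq_divide_eq[OF less_imp_neq[OF kd, symmetric]] mult.commute)
  also have "C = expectation (\<lambda>\<omega>. f (\<xi> \<omega>)) * c2 / unit_ball_vol k powr p"
    using 2 by (simp only: nonzero_eq_divide_eq[OF less_imp_neq[OF kk, symmetric]] mult.commute)
  finally have "expectation (\<lambda>\<omega>. V \<omega> powr p)
    = (c1 * c2) / unit_ball_vol d ^ Suc k * (expectation (\<lambda>\<omega>. f (\<xi> \<omega>)) / unit_ball_vol k powr p)"
    by (simp add: mult_ac)
  then show ?thesis
    unfolding 3 4 f_def by (simp add: mult_ac)
qed

end
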